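(* Let $\beta=2/\log(e/2)\approx 6.51778$, let $G=\mathcal G(n,p)$ and $m=m(G)$. (i) If $p(n-1)=\beta(\log n-\tfrac12\log\log n)+w(n)$ for some $w(n)\to\infty$, then a.a.s. $A(G)=\lceil m/(n-1)\rceil$. If $pn\to\infty$, then a.a.s. $A(G)\in\{\lceil m/(n-1)\rceil,\lceil m/(n-1)\rceil+1\}$. (ii) If $p=\Theta(1/n)$, then there are constants $0<c_1\le c_2$ such that a.a.s. $(1+c_1)pn/2\le A(G)\le(1+c_2)pn/2$. Moreover, there exists $k=k(n)>0$ (depending on $p$) such that a.a.s. $A(G)\in\{k,k+1\}$. (iii) If $pn\to0$, then a.a.s. $A(G)\le 1$.
   Context: $\mathcal G(n,p)$ is the Erdős–Rényi random graph on $[n]$ with each edge present independently with probability $p=p(n)$; "a.a.s." means with probability tending to $1$ as $n\to\infty$. $m(G)$ is the number of edges of $G$, and the arboricity $A(G)$ is the minimum number of forests (subgraphs of $G$ without cycles) whose edge sets cover $E(G)$. $p=\Theta(1/n)$ means there are constants $0<a\le b$ with $a/n\le p\le b/n$ for all large $n$. *)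

theory Defs
  imports "HOL-Analysis.Analysis"
begin

definition all_edges :: "nat \<Rightarrow> nat set set" where
  "all_edges n = {{u, v} | u v. u < n \<and> v < n \<and> u \<noteq> v}"

definition gnp_prob :: "nat \<Rightarrow> real \<Rightarrow> (nat set set \<Rightarrow> bool) \<Rightarrow> real" where
  "gnp_prob n p P =
     (\<Sum>E\<in>Pow (all_edges n). if P E
        then p ^ card E * (1 - p) ^ (card (all_edges n) - card E) else 0)"

definition aas :: "(nat \<Rightarrow> real) \<Rightarrow> (nat \<Rightarrow> nat set set \<Rightarrow> bool) \<Rightarrow> bool" where
  "aas p P \<longleftrightarrow> (\<lambda>n. gnp_prob n (p n) (P n)) \<longlonglongrightarrow> 1"

definition has_cycle :: "nat set set \<Rightarrow> bool" where
  "has_cycle F \<longleftrightarrow> (\<exists>vs. length vs \<ge> 3 \<and> distinct vs \<and>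
     (\<forall>i<length vs. {vs ! i, vs ! ((i + 1) mod length vs)} \<in> F))"

definition is_forest :: "nat set set \<Rightarrow> bool" where
  "is_forest F \<longleftrightarrow> \<not> has_cycle F"

definition arboricity :: "nat set set \<Rightarrow> nat" where
  "arboricity E = (LEAST k. \<exists>Fs :: nat \<Rightarrow> nat set set.
      (\<forall>i<k. Fs i \<subseteq> E \<and> is_forest (Fs i)) \<and> E \<subseteq> (\<Union>i<k. Fs i))"

definition arb_beta :: real where
  "arb_beta = 2 / ln (exp 1 / 2)"

end

theory Submission
  imports Defs "HOL-Real_Asymp.Real_Asymp"
begin

text \<open>By Nash-Williams' theorem, \<open>k\<close> forests cover \<open>G\<close> iff \<open>e(S) \<le> k (|S| - 1)\<close> for every nonempty vertex
  set \<open>S\<close>; it is obtained from matroid partition with the graphic matroid in each coordinate.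
  Everything else is a comparison of the densities of vertex sets, by union bounds over exponential
  moments.

  Let \<open>p n \<rightarrow> \<infinity>\<close> and \<open>d = p (n - 1)\<close>. Sets with at most \<open>n/2\<close> vertices are sparser than \<open>G\<close>. For larger \<open>S\<close>
  one bounds from below the number of edges touching the complement \<open>T\<close>, which must be compared
  with \<open>|T| m/(n - 1) \<approx> d |T| / 2\<close>: it is large enough unless \<open>|T| = O(n exp(-d/100))\<close>, and then the deficit
  is at most \<open>|S| - 1\<close>, at the price of one more forest. No extra forest is needed if all degrees exceed
  \<open>m/(n - 1)\<close>, and \<open>\<beta> (log n - (log log n)/2)\<close> is the threshold for this: the vertices of degree at most
  \<open>0.55 d\<close> are then a.a.s. far apart, so that a small \<open>T\<close> spans too few edges to spoil the sum of its degrees.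

  For \<open>p = \<Theta>(1/n)\<close>, the lower bound comes from deleting the linearly many isolated vertices, the upper
  bound from the sparsity of small sets, and two-point concentration from the Efron--Stein inequality.\<close>

section \<open>Matroid partition\<close>

text \<open>The constant \<open>\<beta>\<close> comes from the law of a single degree. With mean
  \<open>d\<close>, the value \<open>d / 2\<close> has probability of order
  \<open>exp (- d) d ^ (d / 2) / fact (d / 2)\<close>; since \<open>2 / \<beta> = 1 - ln 2\<close>,
  this is of order \<open>exp (- d / \<beta>) / sqrt d\<close>. The expected number of such vertices
  tends to 0 if \<open>d\<close> exceeds \<open>\<beta> (ln n - ln (ln n) / 2)\<close> by a term
  tending to infinity, so the factor \<open>sqrt d\<close> decides the second-order term.
  Exponential moments lose this factor; hence the lower tail of the degrees near the threshold is
  bounded through binomial point probabilities, while the other estimates have enough slack for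
  exponential moments or variances. The complement is used because the densities of almost spanning
  sets can differ from \<open>m / (n - 1)\<close> by less than the fluctuation of \<open>m\<close>
  itself. With \<open>x = m / (n - 1)\<close>, the condition \<open>e(S) \<le> x (|S| - 1)\<close>
  is equivalent to: at least \<open>x |T|\<close> edges touch \<open>T\<close>. There
  \<open>m\<close> enters only through \<open>x\<close>, for which a rough upper bound
  suffices.\<close>

definition rank_on :: "('a set \<Rightarrow> int) \<Rightarrow> 'a set \<Rightarrow> bool" where
  "rank_on r E \<longleftrightarrow> r {} = 0
     \<and> (\<forall>A\<subseteq>E. \<forall>e\<in>E. r A \<le> r (insert e A) \<and> r (insert e A) \<le> r A + 1)
     \<and> (\<forall>A\<subseteq>E. \<forall>B\<subseteq>E. r (A \<union> B) + r (A \<inter> B) \<le> r A + r B)"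

lemma rank_on_subset: "rank_on r E \<Longrightarrow> D \<subseteq> E \<Longrightarrow> rank_on r D"
  unfolding rank_on_def by (meson order_trans subsetD)

text \<open>The rank function of the contraction by \<open>e\<close>, which must not be a loop:
  \<open>r {e} = 1\<close> makes the shifted function vanish at the empty set.\<close>

lemma rank_on_contract:
  assumes "rank_on r (insert e E)" and "r {e} = 1"
  shows "rank_on (\<lambda>A. r (insert e A) - 1) E"
proof -
  have "r (insert e (A \<union> B)) + r (insert e (A \<inter> B)) \<le> r (insert e A) + r (insert e B)"
    if "A \<subseteq> E" "B \<subseteq> E" for A B
  proof -
    have "insert e A \<union> insert e B = insert e (A \<union> B)" "insert e A \<inter> insert e B = insert e (A \<inter> B)"
      by auto
    then show ?thesis
      using assms(1) that unfolding rank_on_def by (metis insert_mono)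
  qed
  moreover have "r (insert e A) \<le> r (insert e (insert x A)) \<and> r (insert e (insert x A)) \<le> r (insert e A) + 1"
    if "A \<subseteq> E" "x \<in> E" for A x
    using assms(1) that unfolding rank_on_def by (metis insert_commute insert_iff insert_mono)
  ultimately show ?thesis
    using assms(2) unfolding rank_on_def by (simp add: algebra_simps)
qed

text \<open>An element \<open>e\<close> can be given to the \<open>i\<close>-th part, that is,
  contracted in the \<open>i\<close>-th matroid, unless a tight set spans it there; tight sets are closed under
  union, so if this failed for all \<open>i\<close>, a single tight set would span \<open>e\<close> in every matroid.\<close>

theorem edmonds_matroid_partition:
  fixes r :: "nat \<Rightarrow> 'a set \<Rightarrow> int"
  assumes "finite E" and "\<And>i. i < k \<Longrightarrow> rank_on (r i) E"
    and "\<And>A. A \<subseteq> E \<Longrightarrow> int (card A) \<le> (\<Sum>i<k. r i A)"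
  shows "\<exists>I. (\<forall>i<k. I i \<subseteq> E \<and> r i (I i) = int (card (I i))) \<and> E \<subseteq> (\<Union>i<k. I i)"
  using assms
proof (induction E arbitrary: r rule: finite_induct)
  case empty
  have "r i {} = 0" if "i < k" for i
    using empty.prems(1) that unfolding rank_on_def by blast
  then show ?case by (intro exI[of _ "\<lambda>_. {}"]) auto
next
  case (insert e E)
  let ?r = "\<lambda>A. \<Sum>j<k. r j A"
  note rk = insert.prems(1)
  have r0: "r i {} = 0" if "i < k" for i
    using rk[OF that] unfolding rank_on_def by blast
  have step: "r i A \<le> r i (insert x A)" "r i (insert x A) \<le> r i A + 1"
    if "i < k" "A \<subseteq> insert e E" "x \<in> insert e E" for i A x
    using rk[OF that(1)] that unfolding rank_on_def by blast+
  have submod: "r i (A \<union> B) + r i (A \<inter> B) \<le> r i A + r i B"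
    if "i < k" "A \<subseteq> insert e E" "B \<subseteq> insert e E" for i A B
    using rk[OF that(1)] that unfolding rank_on_def by blast
  show ?case
  \<comment> \<open>Contracting \<open>e\<close> in matroid \<open>i\<close> changes the right-hand
    side of the hypothesis at \<open>A\<close> by \<open>r i (insert e A) - r i A - 1\<close>, so
    this is exactly the case in which the induction hypothesis applies to the contracted
    family.\<close>
  proof (cases "\<exists>i<k. r i {e} = 1 \<and> (\<forall>A\<subseteq>E. int (card A) \<le> ?r A + r i (insert e A) - r i A - 1)")
    case True
    then obtain i where i: "i < k" "r i {e} = 1"
      and gain: "\<And>A. A \<subseteq> E \<Longrightarrow> int (card A) \<le> ?r A + r i (insert e A) - r i A - 1" by blast
    define r' where "r' = r(i := \<lambda>A. r i (insert e A) - 1)"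
    have "rank_on (r' j) E" if "j < k" for j
      using rank_on_contract[OF rk[OF i(1)] i(2)] rank_on_subset[OF rk[OF that]]
      by (auto simp: r'_def)
    moreover have "int (card A) \<le> (\<Sum>j<k. r' j A)" if "A \<subseteq> E" for A
    proof -
      have "?r A = r i A + (\<Sum>j\<in>{..<k}-{i}. r j A)"
        using i(1) by (subst sum.remove[of _ i]) auto
      moreover have "(\<Sum>j<k. r' j A) = r' i A + (\<Sum>j\<in>{..<k}-{i}. r' j A)"
        using i(1) by (subst sum.remove[of _ i]) auto
      moreover have "(\<Sum>j\<in>{..<k}-{i}. r' j A) = (\<Sum>j\<in>{..<k}-{i}. r j A)"
        by (rule sum.cong) (auto simp: r'_def)
      ultimately show ?thesis using gain[OF that] by (simp add: r'_def)
    qed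
    ultimately obtain I where I: "\<forall>j<k. I j \<subseteq> E \<and> r' j (I j) = int (card (I j))" "E \<subseteq> (\<Union>j<k. I j)"
      using insert.IH[of r'] by blast
    define I' where "I' = I(i := insert e (I i))"
    have "I' j \<subseteq> insert e E \<and> r j (I' j) = int (card (I' j))" if "j < k" for j
    proof (cases "j = i")
      case True
      have "finite (I i)" "e \<notin> I i"
        using I(1) i(1) insert.hyps by (auto dest: finite_subset)
      then show ?thesis
        using I(1) i(1) True by (auto simp: I'_def r'_def)
    next
      case False
      then show ?thesis using I(1) that by (auto simp: I'_def r'_def)
    qed
    moreover have "insert e E \<subseteq> (\<Union>j<k. I' j)"
      using I(2) i(1) by (auto simp: I'_def)
    ultimately show ?thesis by blast
  next
    case False
    define tight where "tight A \<longleftrightarrow> A \<subseteq> E \<and> int (card A) = ?r A" for A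
    \<comment> \<open>If the inequality fails for \<open>A\<close>, there is no slack in
      \<open>card A \<le> ?r A\<close> nor in \<open>r i A \<le> r i (insert e A)\<close>, so both
      are equalities. If \<open>e\<close> is a loop of matroid \<open>i\<close>, the empty set is
      tight and already spans it.\<close>
    have ex: "\<exists>A. tight A \<and> r i (insert e A) = r i A" if "i < k" for i
    proof (cases "r i {e} = 1")
      case True
      with False that obtain A where A: "A \<subseteq> E" "\<not> int (card A) \<le> ?r A + r i (insert e A) - r i A - 1"
        by blast
      moreover have "r i A \<le> r i (insert e A)" using step(1)[OF that, of A e] A(1) by auto
      moreover have "int (card A) \<le> ?r A" using insert.prems(2)[of A] A(1) by auto
      ultimately show ?thesis unfolding tight_def by (intro exI[of _ A]) linarith
    next
      case False
      moreover have "r i {} \<le> r i {e}" "r i {e} \<le> r i {} + 1"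
        using step[OF that, of "{}" e] by auto
      ultimately have "r i {e} = 0" using r0[OF that] by linarith
      then show ?thesis using r0 that unfolding tight_def by (intro exI[of _ "{}"]) auto
    qed
    then obtain T where T: "\<And>i. i < k \<Longrightarrow> tight (T i) \<and> r i (insert e (T i)) = r i (T i)" by metis
    have tight_Un: "tight (A \<union> B)" if "tight A" "tight B" for A B
    proof -
      have sub: "A \<subseteq> E" "B \<subseteq> E" and fin: "finite A" "finite B"
        using that insert.hyps(1) by (auto simp: tight_def dest: finite_subset)
      have "?r (A \<union> B) + ?r (A \<inter> B) \<le> ?r A + ?r B"
        unfolding sum.distrib[symmetric] using sub by (intro sum_mono submod) auto
      moreover have "int (card (A \<union> B)) \<le> ?r (A \<union> B)" "int (card (A \<inter> B)) \<le> ?r (A \<inter> B)"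
        using sub by (auto intro!: insert.prems(2))
      moreover have "card A + card B = card (A \<union> B) + card (A \<inter> B)"
        by (rule card_Un_Int[OF fin])
      ultimately show ?thesis using that unfolding tight_def by auto
    qed
    have tight_UN: "tight (\<Union>i<j. T i)" if "j \<le> k" for j
      using that
    proof (induction j)
      case 0
      then show ?case using r0 by (auto simp: tight_def)
    next
      case (Suc j)
      then show ?case using tight_Un T[of j] by (auto simp: lessThan_Suc)
    qed
    define U where "U = (\<Union>i<k. T i)"
    have U: "tight U" unfolding U_def using tight_UN by simp
    then have UE: "U \<subseteq> E" by (simp add: tight_def)
    \<comment> \<open>By submodularity every set containing \<open>T i\<close> spans
      \<open>e\<close> in matroid \<open>i\<close> as well. Hence the rank sum of
      \<open>insert e U\<close> is at most \<open>card U\<close>, one less than the hypothesis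
      demands.\<close>
    have "r i (insert e U) \<le> r i U" if "i < k" for i
    proof -
      have TU: "T i \<subseteq> U" using that by (auto simp: U_def)
      have "e \<notin> U" using UE insert.hyps by blast
      then have "insert e (T i) \<union> U = insert e U" "insert e (T i) \<inter> U = T i"
        using TU by auto
      then show ?thesis using submod[OF that, of "insert e (T i)" U] T[OF that] TU UE by auto
    qed
    then have "?r (insert e U) \<le> ?r U" by (intro sum_mono) auto
    moreover have "int (card (insert e U)) \<le> ?r (insert e U)"
      using UE by (intro insert.prems(2)) auto
    moreover have "card (insert e U) = card U + 1"
      using UE insert.hyps by (subst card_insert_disjoint) (auto dest: finite_subset)
    ultimately have False using U unfolding tight_def by linarith
    then show ?thesis ..
  qed
qed

section \<open>Connected components and the rank function of the cycle matroid\<close>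

definition edges_on :: "nat set \<Rightarrow> nat set set" where
  "edges_on S = {{u, v} | u v. u \<in> S \<and> v \<in> S \<and> u \<noteq> v}"

definition conn :: "nat set set \<Rightarrow> (nat \<times> nat) set" where
  "conn F = {(u, v). {u, v} \<in> F}\<^sup>*"

definition component :: "nat set set \<Rightarrow> nat \<Rightarrow> nat set" where
  "component F u = {v. (u, v) \<in> conn F}"

text \<open>The size of a spanning forest. Components are counted as distinct values of
  \<open>component F\<close>, so an isolated vertex counts as one; integers avoid truncated
  subtraction.\<close>

definition graph_rank :: "nat set \<Rightarrow> nat set set \<Rightarrow> int" where
  "graph_rank V F = int (card V) - int (card (component F ` V))"

lemma all_edges_eq: "all_edges n = edges_on {..<n}"
  by (simp add: all_edges_def edges_on_def)

lemma edges_on_mono: "S \<subseteq> T \<Longrightarrow> edges_on S \<subseteq> edges_on T"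
  unfolding edges_on_def by blast

lemma edges_on_alt: "edges_on S = {e. e \<subseteq> S \<and> card e = 2}"
  unfolding edges_on_def by (auto simp: card_2_iff)

lemma finite_edges_on [simp, intro]: "finite S \<Longrightarrow> finite (edges_on S)"
  unfolding edges_on_alt by (rule finite_subset[of _ "Pow S"]) auto

lemma card_edges_on: "finite S \<Longrightarrow> card (edges_on S) = card S choose 2"
  unfolding edges_on_alt by (rule n_subsets)

lemma sym_adj: "sym {(u, v). {u, v} \<in> F}"
  by (auto simp: sym_def insert_commute)

lemma conn_refl [simp]: "(u, u) \<in> conn F"
  by (simp add: conn_def)

lemma conn_sym: "(u, v) \<in> conn F \<Longrightarrow> (v, u) \<in> conn F"
  unfolding conn_def by (rule symD[OF sym_rtrancl[OF sym_adj]])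

lemma conn_trans: "(u, v) \<in> conn F \<Longrightarrow> (v, w) \<in> conn F \<Longrightarrow> (u, w) \<in> conn F"
  unfolding conn_def by (rule rtrancl_trans)

lemma conn_edge: "{u, v} \<in> F \<Longrightarrow> (u, v) \<in> conn F"
  unfolding conn_def by blast

lemma conn_mono: "F \<subseteq> F' \<Longrightarrow> conn F \<subseteq> conn F'"
  unfolding conn_def by (rule rtrancl_mono) auto

text \<open>Several crossings of the new edge reduce to at most one, since the part of a walk
  between two visits to the same end can be cut out.\<close>

lemma conn_insert:
  "(u, v) \<in> conn (insert {a, b} F) \<longleftrightarrow>
     (u, v) \<in> conn F \<or> (u, a) \<in> conn F \<and> (b, v) \<in> conn F \<or> (u, b) \<in> conn F \<and> (a, v) \<in> conn F"
  (is "?L \<longleftrightarrow> ?R u v")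
proof
  assume ?L
  then show "?R u v"
    unfolding conn_def[of "insert _ _"]
  proof (induction rule: rtrancl_induct)
    case (step y z)
    from step(2) have "{y, z} \<in> F \<or> y = a \<and> z = b \<or> y = b \<and> z = a"
      by (auto simp: doubleton_eq_iff)
    then show ?case using step(3) conn_trans conn_edge conn_refl by metis
  qed auto
next
  have mono: "conn F \<subseteq> conn (insert {a, b} F)" by (rule conn_mono) auto
  have ab: "(a, b) \<in> conn (insert {a, b} F)" by (rule conn_edge) auto
  assume "?R u v"
  then show ?L using mono ab conn_trans conn_sym by (meson subsetD)
qed

lemma component_eq_iff: "component F u = component F v \<longleftrightarrow> (u, v) \<in> conn F"
  unfolding component_def using conn_refl conn_sym conn_trans by blast

lemma component_insert_connected: "(a, b) \<in> conn F \<Longrightarrow> component (insert {a, b} F) = component F"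
  unfolding component_def fun_eq_iff conn_insert using conn_trans conn_sym by blast

lemma component_insert:
  assumes "(a, b) \<notin> conn F"
  shows "component (insert {a, b} F) u = (if u \<in> component F a \<union> component F b then component F a \<union> component F b else component F u)"
  unfolding component_def conn_insert using assms by (auto intro: conn_sym conn_trans)

text \<open>An edge between different components replaces these two by their union, which was not a
  component before; an edge inside a component leaves the partition alone.\<close>

lemma graph_rank_insert:
  assumes "finite V" "a \<in> V" "b \<in> V"
  shows "graph_rank V (insert {a, b} F) = graph_rank V F + of_bool ((a, b) \<notin> conn F)"
proof (cases "(a, b) \<in> conn F")
  case True
  then show ?thesis by (simp add: graph_rank_def component_insert_connected)
next
  case False
  let ?C = "component F a \<union> component F b" and ?A = "component F ` V"
  have ca: "u \<in> component F a \<longleftrightarrow> component F u = component F a" and cb: "u \<in> component F b \<longleftrightarrow> component F u = component F b" for u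
    by (auto simp: component_eq_iff) (auto simp: component_def intro: conn_sym)
  have "component (insert {a, b} F) ` V = insert ?C (?A - {component F a, component F b})"
  proof (intro equalityI subsetI)
    fix X assume "X \<in> component (insert {a, b} F) ` V"
    then show "X \<in> insert ?C (?A - {component F a, component F b})"
      using False ca cb by (auto simp: component_insert)
  next
    fix X assume "X \<in> insert ?C (?A - {component F a, component F b})"
    then consider "X = ?C" | u where "u \<in> V" "X = component F u" "X \<noteq> component F a" "X \<noteq> component F b" by auto
    then show "X \<in> component (insert {a, b} F) ` V"
    proof cases
      case 1
      have "component (insert {a, b} F) a = ?C" using False ca by (simp add: component_insert)
      then show ?thesis using 1 assms by (metis imageI)
    next
      case 2
      then have "component (insert {a, b} F) u = X" using False ca cb by (auto simp: component_insert)
      then show ?thesis using 2 by blast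
    qed
  qed
  moreover have "?C \<notin> ?A"
  proof
    assume "?C \<in> ?A"
    then obtain u where "component F u = ?C" by (metis imageE)
    moreover have "a \<in> ?C" "b \<in> ?C" by (auto simp: component_def)
    ultimately have "a \<in> component F u" "b \<in> component F u" by metis+
    then have "(u, a) \<in> conn F" "(u, b) \<in> conn F" by (simp_all add: component_def)
    then show False using False conn_sym conn_trans by blast
  qed
  moreover have "card (?A - {component F a, component F b}) + 2 = card ?A"
  proof -
    have "card {component F a, component F b} = 2" using False by (auto simp: component_eq_iff card_2_iff)
    moreover have "{component F a, component F b} \<subseteq> ?A" using assms by auto
    ultimately show ?thesis
      using assms(1) by (metis card_Diff_subset card_mono finite.simps finite_imageI le_add_diff_inverse2)
  qed
  ultimately have "card (component (insert {a, b} F) ` V) + 1 = card ?A"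
    using assms(1) by simp
  then show ?thesis using False by (simp add: graph_rank_def)
qed

lemma component_empty: "component {} u = {u}"
  by (simp add: component_def conn_def)

lemma graph_rank_empty: "graph_rank V {} = 0"
proof -
  have "component {} ` V = (\<lambda>u. {u}) ` V" by (simp add: component_empty)
  then show ?thesis by (simp add: graph_rank_def card_image)
qed

lemma edges_onE:
  assumes "e \<in> edges_on V"
  obtains a b where "e = {a, b}" "a \<in> V" "b \<in> V" "a \<noteq> b"
  using assms unfolding edges_on_def by blast

text \<open>Vertices connected in the smaller graph stay connected in the larger one, so an edge
  that gains no rank over \<open>X\<close> gains none over \<open>Y\<close>. With
  \<open>X = A \<inter> B\<close>, \<open>Y = A\<close> and \<open>D = B - A\<close> this becomes
  submodularity.\<close>

lemma graph_rank_diminishing: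
  assumes "finite V" "finite D" "D \<subseteq> edges_on V" "X \<subseteq> Y"
  shows "graph_rank V (Y \<union> D) - graph_rank V Y \<le> graph_rank V (X \<union> D) - graph_rank V X"
  using assms(2,3)
proof (induction D rule: finite_induct)
  case (insert e D)
  obtain a b where e: "e = {a, b}" "a \<in> V" "b \<in> V" using insert.prems by (auto elim: edges_onE)
  have "conn (X \<union> D) \<subseteq> conn (Y \<union> D)" using assms(4) by (intro conn_mono) auto
  then have "graph_rank V (insert e (Y \<union> D)) - graph_rank V (Y \<union> D)
      \<le> graph_rank V (insert e (X \<union> D)) - graph_rank V (X \<union> D)"
    using e assms(1) by (auto simp: graph_rank_insert)
  then show ?case using insert by simp
qed simp

lemma rank_on_graph_rank:
  assumes "finite V" "E \<subseteq> edges_on V"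
  shows "rank_on (graph_rank V) E"
proof -
  have "graph_rank V (A \<union> B) + graph_rank V (A \<inter> B) \<le> graph_rank V A + graph_rank V B"
    if "A \<subseteq> E" "B \<subseteq> E" for A B
  proof -
    have "B - A \<subseteq> edges_on V" "finite (B - A)"
      using that assms by (auto intro: finite_subset[OF _ finite_edges_on[OF assms(1)]])
    then have "graph_rank V (A \<union> (B - A)) - graph_rank V A
        \<le> graph_rank V (A \<inter> B \<union> (B - A)) - graph_rank V (A \<inter> B)"
      using assms(1) by (intro graph_rank_diminishing) auto
    moreover have "A \<inter> B \<union> (B - A) = B" "A \<union> (B - A) = A \<union> B" by auto
    ultimately show ?thesis by simp
  qed
  moreover have "graph_rank V A \<le> graph_rank V (insert e A) \<and> graph_rank V (insert e A) \<le> graph_rank V A + 1"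
    if "e \<in> E" for A e
    using that assms by (elim edges_onE[OF subsetD]) (auto simp: graph_rank_insert)
  ultimately show ?thesis unfolding rank_on_def by (simp add: graph_rank_empty)
qed

section \<open>Forests and Nash-Williams' theorem\<close>

lemma graph_rank_le_card:
  assumes "finite V" "finite F" "F \<subseteq> edges_on V"
  shows "graph_rank V F \<le> int (card F)"
  using assms(2,3)
proof (induction F rule: finite_induct)
  case (insert e F)
  then obtain a b where "e = {a, b}" "a \<in> V" "b \<in> V" by (auto elim: edges_onE)
  then show ?case using insert assms(1) by (auto simp: graph_rank_insert)
qed (simp add: graph_rank_empty)

lemma graph_rank_less_card:
  assumes "finite V" "V \<noteq> {}"
  shows "graph_rank V F \<le> int (card V) - 1"
proof -
  have "card (component F ` V) \<noteq> 0" using assms by simp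
  then show ?thesis unfolding graph_rank_def by linarith
qed

text \<open>The closing edge of a cycle joins vertices connected by the rest of the cycle. Dropping
  it keeps the rank but lowers the number of edges, which bounds the rank.\<close>

lemma independent_imp_forest:
  assumes V: "finite V" and F: "F \<subseteq> edges_on V" and rk: "graph_rank V F = int (card F)"
  shows "is_forest F"
  unfolding is_forest_def
proof
  assume "has_cycle F"
  then obtain vs where l: "length vs \<ge> 3" and d: "distinct vs"
    and cyc: "\<And>i. i < length vs \<Longrightarrow> {vs ! i, vs ! ((i + 1) mod length vs)} \<in> F"
    unfolding has_cycle_def by blast
  define l where "l = length vs - 1"
  have len: "length vs = Suc l" "l \<ge> 2" using l by (auto simp: l_def)
  let ?e = "{vs ! 0, vs ! l}"
  define F' where "F' = F - {?e}"
  have fin: "finite F" using F V by (meson finite_edges_on finite_subset)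
  have "{vs ! l, vs ! 0} \<in> F" using cyc[of l] len by simp
  then have eF: "?e \<in> F" by (simp add: insert_commute)
  have "(vs ! 0, vs ! i) \<in> conn F'" if "i \<le> l" for i
    using that
  proof (induction i)
    case (Suc i)
    \<comment> \<open>Cycle length at least 3 matters here: with two vertices the path edge would be
      the closing edge itself.\<close>
    have "{vs ! i, vs ! Suc i} \<noteq> ?e"
      using d len Suc.prems by (auto simp: doubleton_eq_iff nth_eq_iff_index_eq)
    then have "{vs ! i, vs ! Suc i} \<in> F'" using cyc[of i] Suc.prems len by (simp add: F'_def)
    then show ?case using Suc by (auto intro: conn_trans conn_edge)
  qed simp
  then have c: "(vs ! 0, vs ! l) \<in> conn F'" by simp
  have "vs ! 0 \<in> V" "vs ! l \<in> V"
    using eF F unfolding edges_on_alt by auto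
  then have "graph_rank V (insert ?e F') = graph_rank V F'"
    using c V by (simp add: graph_rank_insert)
  moreover have "insert ?e F' = F" using eF by (auto simp: F'_def)
  moreover have "graph_rank V F' \<le> int (card F')"
    using V fin F by (intro graph_rank_le_card) (auto simp: F'_def)
  moreover have "card F' < card F"
    unfolding F'_def using fin eF by (rule card_Diff1_less)
  ultimately show False using rk by simp
qed

text \<open>When the walk returns to a vertex already on the path, the path is cut back to that
  vertex instead of being extended.\<close>

lemma conn_imp_simple_path:
  assumes "(a, b) \<in> conn F"
  shows "\<exists>vs. vs \<noteq> [] \<and> distinct vs \<and> hd vs = a \<and> last vs = b
      \<and> (\<forall>i. Suc i < length vs \<longrightarrow> {vs ! i, vs ! Suc i} \<in> F)"
  using assms unfolding conn_def
proof (induction rule: rtrancl_induct)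
  case base
  then show ?case by (intro exI[of _ "[a]"]) auto
next
  case (step y z)
  then obtain vs where vs: "vs \<noteq> []" "distinct vs" "hd vs = a" "last vs = y"
    and path: "\<And>i. Suc i < length vs \<Longrightarrow> {vs ! i, vs ! Suc i} \<in> F" by blast
  show ?case
  proof (cases "z \<in> set vs")
    case True
    then obtain i where i: "i < length vs" "vs ! i = z" by (auto simp: in_set_conv_nth)
    let ?us = "take (Suc i) vs"
    have "?us \<noteq> []" "distinct ?us" "hd ?us = a" using vs by (auto simp: hd_conv_nth)
    moreover have "last ?us = z" using i by (simp add: take_Suc_conv_app_nth)
    moreover have "\<forall>j. Suc j < length ?us \<longrightarrow> {?us ! j, ?us ! Suc j} \<in> F" using path by auto
    ultimately show ?thesis by blast
  next
    case False
    have "{(vs @ [z]) ! i, (vs @ [z]) ! Suc i} \<in> F" if "Suc i < length (vs @ [z])" for i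
    proof (cases "Suc i < length vs")
      case True
      then show ?thesis using path[of i] by (simp add: nth_append)
    next
      case False
      then have "i = length vs - 1" "Suc i = length vs" using that by auto
      then show ?thesis using vs(1,4) step(2) by (auto simp: nth_append last_conv_nth)
    qed
    then show ?thesis using vs False by (intro exI[of _ "vs @ [z]"]) auto
  qed
qed

lemma is_forest_subset: "is_forest F \<Longrightarrow> F' \<subseteq> F \<Longrightarrow> is_forest F'"
  unfolding is_forest_def has_cycle_def by blast

text \<open>Edges are added one at a time, and each must gain rank: otherwise a simple path between
  its ends closes to a cycle. That path has at least three vertices, as the ends differ and the edge
  is new.\<close>

lemma forest_imp_independent:
  assumes "finite V" "finite F" "F \<subseteq> edges_on V" "is_forest F"
  shows "graph_rank V F = int (card F)"
  using assms(2-)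
proof (induction F rule: finite_induct)
  case (insert e F)
  then obtain a b where e: "e = {a, b}" "a \<in> V" "b \<in> V" "a \<noteq> b" by (auto elim: edges_onE)
  have "(a, b) \<notin> conn F"
  proof
    assume "(a, b) \<in> conn F"
    then obtain vs where vs: "vs \<noteq> []" "distinct vs" "hd vs = a" "last vs = b"
      and path: "\<And>i. Suc i < length vs \<Longrightarrow> {vs ! i, vs ! Suc i} \<in> F"
      using conn_imp_simple_path by blast
    have nth: "vs ! 0 = a" "vs ! (length vs - 1) = b" using vs by (auto simp: hd_conv_nth last_conv_nth)
    have "length vs \<noteq> 1" using nth e(4) by auto
    moreover have "length vs \<noteq> 2" using nth path[of 0] insert.hyps e by auto
    moreover have "length vs \<noteq> 0" using vs(1) by simp
    ultimately have "length vs \<ge> 3" by linarith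
    moreover have "{vs ! i, vs ! ((i + 1) mod length vs)} \<in> insert e F" if "i < length vs" for i
    proof (cases "Suc i < length vs")
      case True
      then show ?thesis using path by simp
    next
      case False
      then have "i = length vs - 1" "Suc i = length vs" using that by auto
      then show ?thesis using nth e by (auto simp: insert_commute)
    qed
    ultimately have "has_cycle (insert e F)" unfolding has_cycle_def using vs(2) by blast
    then show False using insert.prems by (simp add: is_forest_def)
  qed
  then show ?case
    using insert e assms(1) is_forest_subset[of "insert e F" F] by (auto simp: graph_rank_insert)
qed (simp add: graph_rank_empty)

lemma forest_card_less:
  assumes "finite S" "S \<noteq> {}" "F \<subseteq> edges_on S" "is_forest F"
  shows "card F \<le> card S - 1"
proof -
  have "finite F" using assms(1,3) by (meson finite_edges_on finite_subset)
  then have "graph_rank S F = int (card F)" using assms by (intro forest_imp_independent)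
  then show ?thesis using graph_rank_less_card[OF assms(1,2), of F] by linarith
qed

lemma component_subset:
  assumes "A \<subseteq> edges_on V" "u \<in> V"
  shows "component A u \<subseteq> V"
proof
  fix v assume "v \<in> component A u"
  then have "(u, v) \<in> {(u, v). {u, v} \<in> A}\<^sup>*" by (simp add: component_def conn_def)
  then show "v \<in> V"
    using assms by (induction rule: rtrancl_induct) (auto simp: edges_on_alt)
qed

lemma sum_card_components:
  assumes "finite V" "A \<subseteq> edges_on V"
  shows "(\<Sum>C\<in>component A ` V. card C) = card V"
proof -
  have "\<Union>(component A ` V) = V"
    using component_subset[OF assms(2)] by (fastforce simp: component_def)
  moreover have "pairwise disjnt (component A ` V)"
  proof (rule pairwiseI)
    fix X Y assume "X \<in> component A ` V" "Y \<in> component A ` V" "X \<noteq> Y"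
    then obtain u v where "X = component A u" "Y = component A v" "(u, v) \<notin> conn A"
      using component_eq_iff[of A] by (metis imageE)
    then show "disjnt X Y"
      unfolding disjnt_iff component_def mem_Collect_eq using conn_trans conn_sym by blast
  qed
  moreover have "finite X" if "X \<in> component A ` V" for X
    using that component_subset[OF assms(2)] assms(1) by (auto dest: finite_subset)
  ultimately show ?thesis by (metis card_Union_disjoint)
qed

definition forest_cover :: "nat \<Rightarrow> nat set set \<Rightarrow> bool" where
  "forest_cover k E \<longleftrightarrow>
     (\<exists>Fs :: nat \<Rightarrow> nat set set. (\<forall>i<k. Fs i \<subseteq> E \<and> is_forest (Fs i)) \<and> E \<subseteq> (\<Union>i<k. Fs i))"

text \<open>Necessity counts edges forest by forest. For sufficiency, Edmonds' condition
  \<open>card A \<le> k * graph_rank V A\<close> splits over the components \<open>C\<close> of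
  \<open>A\<close>: the rank is the sum of \<open>card C - 1\<close>, and every edge of
  \<open>A\<close> lies within one \<open>C\<close>, to which the density hypothesis
  applies.\<close>

theorem nash_williams_arboricity:
  assumes V: "finite V" and E: "E \<subseteq> edges_on V"
  shows "forest_cover k E \<longleftrightarrow>
    (\<forall>S\<subseteq>V. S \<noteq> {} \<longrightarrow> card (E \<inter> edges_on S) \<le> k * (card S - 1))"
proof (intro iffI allI impI)
  fix S assume "forest_cover k E" and S: "S \<subseteq> V" "S \<noteq> {}"
  then obtain Fs where Fs: "\<And>i. i < k \<Longrightarrow> Fs i \<subseteq> E \<and> is_forest (Fs i)" "E \<subseteq> (\<Union>i<k. Fs i)"
    unfolding forest_cover_def by blast
  have finS: "finite S" using S V finite_subset by blast
  have "card (E \<inter> edges_on S) \<le> card (\<Union>i<k. Fs i \<inter> edges_on S)"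
    using Fs(2) finS by (intro card_mono) auto
  also have "\<dots> \<le> (\<Sum>i<k. card (Fs i \<inter> edges_on S))" by (rule card_UN_le) simp
  also have "\<dots> \<le> (\<Sum>i<k. card S - 1)"
    using Fs(1) S(2) finS
    by (intro sum_mono forest_card_less) (auto intro: is_forest_subset)
  finally show "card (E \<inter> edges_on S) \<le> k * (card S - 1)" by simp
next
  assume sparse: "\<forall>S\<subseteq>V. S \<noteq> {} \<longrightarrow> card (E \<inter> edges_on S) \<le> k * (card S - 1)"
  have "int (card A) \<le> (\<Sum>i<k. graph_rank V A)" if A: "A \<subseteq> E" for A
  proof -
    have AV: "A \<subseteq> edges_on V" using A E by blast
    let ?C = "component A ` V"
    have "u \<in> component A u" for u by (simp add: component_def)
    then have C: "C \<subseteq> V \<and> finite C \<and> C \<noteq> {}" if "C \<in> ?C" for C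
      using that component_subset[OF AV] V by (metis empty_iff finite_subset imageE)
    have "A \<subseteq> (\<Union>C\<in>?C. E \<inter> edges_on C)"
    proof
      fix e assume e: "e \<in> A"
      then obtain a b where ab: "e = {a, b}" "a \<in> V" "b \<in> V" "a \<noteq> b" using AV by (meson edges_onE subsetD)
      then have "(a, b) \<in> conn A" using e conn_edge by blast
      then have "a \<in> component A a" "b \<in> component A a" by (auto simp: component_def)
      then have "e \<in> edges_on (component A a)" using ab unfolding edges_on_def by blast
      then show "e \<in> (\<Union>C\<in>?C. E \<inter> edges_on C)" using e A ab by blast
    qed
    then have "card A \<le> card (\<Union>C\<in>?C. E \<inter> edges_on C)"
      using C V by (intro card_mono) auto
    also have "\<dots> \<le> (\<Sum>C\<in>?C. card (E \<inter> edges_on C))" using V by (intro card_UN_le) auto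
    also have "\<dots> \<le> (\<Sum>C\<in>?C. k * (card C - 1))" using sparse C by (intro sum_mono) auto
    finally have "int (card A) \<le> (\<Sum>C\<in>?C. int (k * (card C - 1)))"
      by (metis of_nat_le_iff of_nat_sum)
    also have "\<dots> = (\<Sum>C\<in>?C. int k * (int (card C) - 1))"
    proof (rule sum.cong)
      fix C assume "C \<in> ?C"
      then have "card C \<noteq> 0" using C by simp
      then show "int (k * (card C - 1)) = int k * (int (card C) - 1)" by (simp add: of_nat_diff)
    qed simp
    also have "\<dots> = int k * (int (\<Sum>C\<in>?C. card C) - int (card ?C))"
      by (simp add: sum_distrib_left[symmetric] sum_subtractf)
    also have "\<dots> = (\<Sum>i<k. graph_rank V A)"
      using sum_card_components[OF V AV] by (simp add: graph_rank_def)
    finally show ?thesis .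
  qed
  moreover have "finite E" using E V by (meson finite_edges_on finite_subset)
  ultimately obtain I where I: "\<forall>i<k. I i \<subseteq> E \<and> graph_rank V (I i) = int (card (I i))" "E \<subseteq> (\<Union>i<k. I i)"
    using edmonds_matroid_partition[of E k "\<lambda>_. graph_rank V"] rank_on_graph_rank[OF V E] by blast
  have "is_forest (I i)" if "i < k" for i
    using I(1) that E V by (intro independent_imp_forest) auto
  with I show "forest_cover k E" unfolding forest_cover_def by blast
qed

text \<open>The minimum defining \<open>arboricity\<close> is attained because \<open>card E\<close>
  forests suffice, and the density condition is monotone in \<open>k\<close>. Sets with at most one
  vertex span no edges.\<close>

lemma arboricity_le_iff:
  assumes "finite V" "E \<subseteq> edges_on V"
  shows "arboricity E \<le> k \<longleftrightarrow>
    (\<forall>S\<subseteq>V. S \<noteq> {} \<longrightarrow> card (E \<inter> edges_on S) \<le> k * (card S - 1))"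
proof -
  have mono: "forest_cover k E" if "forest_cover j E" "j \<le> k" for j k
    using that unfolding nash_williams_arboricity[OF assms] by (meson le_trans mult_le_mono1)
  have "card (E \<inter> edges_on S) \<le> card E * (card S - 1)" if S: "S \<subseteq> V" "S \<noteq> {}" for S
  proof (cases "card S \<ge> 2")
    case True
    have "finite E" using assms by (meson finite_edges_on finite_subset)
    then have "card (E \<inter> edges_on S) \<le> card E * 1" by (simp add: card_mono)
    also have "\<dots> \<le> card E * (card S - 1)" using True by (intro mult_le_mono2) auto
    finally show ?thesis .
  next
    case False
    have "finite S" using S assms by (auto dest: finite_subset)
    then have "card (edges_on S) = 0" using False by (simp add: card_edges_on)
    then have "edges_on S = {}" using \<open>finite S\<close> by simp
    then show ?thesis by simp
  qed
  then have "forest_cover (card E) E" unfolding nash_williams_arboricity[OF assms] by blast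
  moreover have arb: "arboricity E = (LEAST k. forest_cover k E)"
    unfolding arboricity_def forest_cover_def ..
  ultimately have "forest_cover (arboricity E) E"
    using LeastI[of "\<lambda>k. forest_cover k E" "card E"] by simp
  moreover have "arboricity E \<le> k" if "forest_cover k E" for k
    using Least_le[of "\<lambda>k. forest_cover k E" k, OF that] arb by simp
  ultimately show ?thesis using mono unfolding nash_williams_arboricity[OF assms, symmetric] by blast
qed

section \<open>Random subsets of a finite set\<close>

text \<open>A finite weighted sum in place of a product measure. Independence enters through the
  recursion \<open>bin_expect_insert\<close>, which conditions on a single element.\<close>

definition bin_expect :: "'a set \<Rightarrow> real \<Rightarrow> ('a set \<Rightarrow> real) \<Rightarrow> real" where
  "bin_expect A p f = (\<Sum>E\<in>Pow A. p ^ card E * (1 - p) ^ (card A - card E) * f E)"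

abbreviation bin_prob :: "'a set \<Rightarrow> real \<Rightarrow> ('a set \<Rightarrow> bool) \<Rightarrow> real" where
  "bin_prob A p Q \<equiv> bin_expect A p (\<lambda>E. of_bool (Q E))"

lemma gnp_prob_eq: "gnp_prob n p Q = bin_prob (all_edges n) p Q"
  unfolding gnp_prob_def bin_expect_def by (rule sum.cong) auto

lemma bin_expect_cong: "(\<And>E. E \<subseteq> A \<Longrightarrow> f E = g E) \<Longrightarrow> bin_expect A p f = bin_expect A p g"
  unfolding bin_expect_def by (rule sum.cong) auto

lemma bin_expect_insert:
  assumes "finite A" "a \<notin> A"
  shows "bin_expect (insert a A) p f = (1 - p) * bin_expect A p f + p * bin_expect A p (\<lambda>E. f (insert a E))"
proof -
  let ?w = "\<lambda>E. p ^ card E * (1 - p) ^ (card (insert a A) - card E) * f E"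
  have "bin_expect (insert a A) p f = sum ?w (Pow A) + sum ?w (insert a ` Pow A)"
    unfolding bin_expect_def Pow_insert using assms by (intro sum.union_disjoint) auto
  moreover have "sum ?w (Pow A) = (1 - p) * bin_expect A p f"
    unfolding bin_expect_def sum_distrib_left
  proof (rule sum.cong)
    fix E assume "E \<in> Pow A"
    then have "card E \<le> card A" using assms by (auto intro: card_mono)
    then show "?w E = (1 - p) * (p ^ card E * (1 - p) ^ (card A - card E) * f E)"
      using assms by (simp add: Suc_diff_le)
  qed simp
  moreover have "sum ?w (insert a ` Pow A) = p * bin_expect A p (\<lambda>E. f (insert a E))"
  proof -
    have "inj_on (insert a) (Pow A)" using assms by (auto simp: inj_on_def)
    then have "sum ?w (insert a ` Pow A) = (\<Sum>E\<in>Pow A. ?w (insert a E))" by (simp add: sum.reindex)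
    also have "\<dots> = p * bin_expect A p (\<lambda>E. f (insert a E))"
      unfolding bin_expect_def sum_distrib_left
    proof (rule sum.cong)
      fix E assume "E \<in> Pow A"
      then have "finite E" "a \<notin> E" using assms by (auto intro: finite_subset)
      then show "?w (insert a E) = p * (p ^ card E * (1 - p) ^ (card A - card E) * f (insert a E))"
        using assms by simp
    qed simp
    finally show ?thesis .
  qed
  ultimately show ?thesis by simp
qed

lemma bin_expect_empty [simp]: "bin_expect {} p f = f {}"
  by (simp add: bin_expect_def)

lemma bin_expect_add: "bin_expect A p (\<lambda>E. f E + g E) = bin_expect A p f + bin_expect A p g"
  unfolding bin_expect_def by (simp add: ring_distribs sum.distrib)

lemma bin_expect_cmult: "bin_expect A p (\<lambda>E. c * f E) = c * bin_expect A p f"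
  unfolding bin_expect_def sum_distrib_left by (rule sum.cong) auto

lemma bin_expect_diff: "bin_expect A p (\<lambda>E. f E - g E) = bin_expect A p f - bin_expect A p g"
  unfolding bin_expect_def by (simp add: right_diff_distrib sum_subtractf)

lemma bin_expect_sum: "bin_expect A p (\<lambda>E. \<Sum>i\<in>I. f i E) = (\<Sum>i\<in>I. bin_expect A p (f i))"
  unfolding bin_expect_def by (simp add: sum_distrib_left) (rule sum.swap)

lemma bin_expect_const: "finite A \<Longrightarrow> bin_expect A p (\<lambda>_. c) = c"
  by (induction A rule: finite_induct) (simp_all add: bin_expect_insert left_diff_distrib)

lemma bin_expect_mono:
  assumes "0 \<le> p" "p \<le> 1" "\<And>E. E \<subseteq> A \<Longrightarrow> f E \<le> g E"
  shows "bin_expect A p f \<le> bin_expect A p g"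
  unfolding bin_expect_def using assms by (intro sum_mono mult_left_mono) auto

lemma bin_prob_mono:
  assumes "0 \<le> p" "p \<le> 1" "\<And>E. E \<subseteq> A \<Longrightarrow> Q E \<Longrightarrow> R E"
  shows "bin_prob A p Q \<le> bin_prob A p R"
  using assms by (intro bin_expect_mono) auto

lemma bin_expect_nonneg: "0 \<le> p \<Longrightarrow> p \<le> 1 \<Longrightarrow> (\<And>E. E \<subseteq> A \<Longrightarrow> 0 \<le> f E) \<Longrightarrow> 0 \<le> bin_expect A p f"
  unfolding bin_expect_def by (intro sum_nonneg mult_nonneg_nonneg) auto

lemma bin_prob_not: "finite A \<Longrightarrow> bin_prob A p (\<lambda>E. \<not> Q E) = 1 - bin_prob A p Q"
  by (simp add: of_bool_not_iff bin_expect_diff bin_expect_const)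

lemma bin_prob_union_bound:
  assumes "0 \<le> p" "p \<le> 1" "finite I"
  shows "bin_prob A p (\<lambda>E. \<exists>i\<in>I. Q i E) \<le> (\<Sum>i\<in>I. bin_prob A p (Q i))"
  unfolding bin_expect_sum[symmetric]
proof (rule bin_expect_mono[OF assms(1,2)])
  fix E assume "E \<subseteq> A"
  show "of_bool (\<exists>i\<in>I. Q i E) \<le> (\<Sum>i\<in>I. of_bool (Q i E) :: real)"
  proof (cases "\<exists>i\<in>I. Q i E")
    case True
    then obtain i where "i \<in> I" "Q i E" by blast
    then have "(1::real) = (\<Sum>j\<in>{i}. of_bool (Q j E))" by simp
    also have "\<dots> \<le> (\<Sum>i\<in>I. of_bool (Q i E))"
      using \<open>i \<in> I\<close> assms(3) by (intro sum_mono2) auto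
    finally show ?thesis using True by simp
  qed (simp add: sum_nonneg)
qed

lemma bin_prob_disj:
  assumes "0 \<le> p" "p \<le> 1"
  shows "bin_prob A p (\<lambda>E. Q E \<or> R E) \<le> bin_prob A p Q + bin_prob A p R"
  unfolding bin_expect_add[symmetric] using assms by (intro bin_expect_mono) auto

lemma bin_prob_markov:
  assumes "0 \<le> p" "p \<le> 1" "\<And>E. E \<subseteq> A \<Longrightarrow> 0 \<le> f E" "t > 0"
  shows "bin_prob A p (\<lambda>E. Q E \<and> t \<le> f E) \<le> bin_expect A p (\<lambda>E. of_bool (Q E) * f E) / t"
proof -
  have "bin_prob A p (\<lambda>E. Q E \<and> t \<le> f E) \<le> bin_expect A p (\<lambda>E. (1 / t) * (of_bool (Q E) * f E))"
    using assms by (intro bin_expect_mono) (auto simp: field_simps)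
  then show ?thesis unfolding bin_expect_cmult by simp
qed

lemma bin_expect_prod:
  assumes "finite A"
  shows "bin_expect A p (\<lambda>E. \<Prod>a\<in>A. if a \<in> E then g a else h a) = (\<Prod>a\<in>A. p * g a + (1 - p) * h a)"
  using assms
proof (induction A rule: finite_induct)
  case (insert a A)
  have "bin_expect A p (\<lambda>E. \<Prod>x\<in>insert a A. if x \<in> E then g x else h x)
      = bin_expect A p (\<lambda>E. h a * (\<Prod>x\<in>A. if x \<in> E then g x else h x))"
    using insert.hyps by (intro bin_expect_cong) (auto simp: subset_iff)
  moreover have "bin_expect A p (\<lambda>E. \<Prod>x\<in>insert a A. if x \<in> insert a E then g x else h x)
      = bin_expect A p (\<lambda>E. g a * (\<Prod>x\<in>A. if x \<in> E then g x else h x))"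
  proof (rule bin_expect_cong)
    fix E
    have "(\<Prod>x\<in>A. if x \<in> insert a E then g x else h x) = (\<Prod>x\<in>A. if x \<in> E then g x else h x)"
      using insert.hyps by (intro prod.cong) auto
    then show "(\<Prod>x\<in>insert a A. if x \<in> insert a E then g x else h x) = g a * (\<Prod>x\<in>A. if x \<in> E then g x else h x)"
      using insert.hyps by simp
  qed
  ultimately show ?case
    using insert by (simp add: bin_expect_insert bin_expect_cmult distrib_right)
qed simp

text \<open>The expression factorizes over the elements: those of \<open>A0\<close> contribute
  \<open>p\<close>, those of \<open>B\<close> contribute \<open>1 + (z - 1) p\<close>. The
  prescribed part \<open>A0\<close> gives tail bounds jointly with the presence of given
  edges.\<close>

lemma bin_expect_mgf:
  assumes "finite A" "A0 \<subseteq> A" "B \<subseteq> A" "A0 \<inter> B = {}"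
  shows "bin_expect A p (\<lambda>E. of_bool (A0 \<subseteq> E) * z ^ card (E \<inter> B)) = p ^ card A0 * (1 + (z - 1) * p) ^ card B"
proof -
  let ?g = "\<lambda>a. if a \<in> B then z else 1" and ?h = "\<lambda>a. if a \<in> A0 then 0 else (1::real)"
  have "of_bool (A0 \<subseteq> E) * z ^ card (E \<inter> B) = (\<Prod>a\<in>A. if a \<in> E then ?g a else ?h a)" if "E \<subseteq> A" for E
  proof (cases "A0 \<subseteq> E")
    case True
    have "(\<Prod>a\<in>A. if a \<in> E then ?g a else ?h a) = (\<Prod>a\<in>A. if a \<in> E \<inter> B then z else 1)"
      using True by (intro prod.cong) auto
    also have "\<dots> = z ^ card (E \<inter> B)"
    proof -
      have "A \<inter> (E \<inter> B) = E \<inter> B" using that by auto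
      then show ?thesis using assms(1) by (simp add: prod.If_cases Int_def)
    qed
    finally show ?thesis using True by simp
  next
    case False
    then obtain a where "a \<in> A0" "a \<notin> E" by blast
    then have "(\<Prod>a\<in>A. if a \<in> E then ?g a else ?h a) = 0"
      using assms by (intro prod_zero) (auto intro!: bexI[of _ a])
    then show ?thesis using False by simp
  qed
  then have "bin_expect A p (\<lambda>E. of_bool (A0 \<subseteq> E) * z ^ card (E \<inter> B)) = (\<Prod>a\<in>A. p * ?g a + (1 - p) * ?h a)"
    unfolding bin_expect_prod[OF assms(1), symmetric] by (rule bin_expect_cong)
  also have "\<dots> = (\<Prod>a\<in>A. (if a \<in> A0 then p else 1) * (if a \<in> B then 1 + (z - 1) * p else 1))"
    using assms(4) by (intro prod.cong) (auto simp: algebra_simps)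
  also have "\<dots> = p ^ card A0 * (1 + (z - 1) * p) ^ card B"
    unfolding prod.distrib using assms by (simp add: prod.If_cases Int_absorb1 Int_absorb2 Int_commute)
  finally show ?thesis .
qed

section \<open>Tail bounds, variance and point probabilities for random subsets\<close>

lemma one_plus_power_le_exp: "- 1 \<le> (x::real) \<Longrightarrow> (1 + x) ^ m \<le> exp (x * real m)"
proof -
  assume "- 1 \<le> x"
  then have "(1 + x) ^ m \<le> exp x ^ m" by (intro power_mono) auto
  then show ?thesis by (simp add: exp_of_nat2_mult)
qed

text \<open>Exponential moment at the fixed parameter \<open>1 / 2\<close>. The best parameter is
  roughly the ratio of threshold to mean, and the thresholds to which this is applied are close to
  half the mean, because the edge density \<open>m / (n - 1)\<close> is about half the mean
  degree.\<close>

lemma bin_prob_lower_tail: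
  assumes "0 \<le> p" "p \<le> 1" "finite A" "A0 \<subseteq> A" "B \<subseteq> A" "A0 \<inter> B = {}"
  shows "bin_prob A p (\<lambda>E. A0 \<subseteq> E \<and> real (card (E \<inter> B)) \<le> k)
    \<le> p ^ card A0 * exp (k * ln 2 - p * real (card B) / 2)"
proof -
  have *: "exp (- k * ln 2) \<le> (1/2) ^ card (E \<inter> B)" if "real (card (E \<inter> B)) \<le> k" for E
  proof -
    have "exp (- k * ln 2) \<le> exp (real (card (E \<inter> B)) * - ln 2)" using that by (simp add: mult_right_mono)
    also have "\<dots> = (1/2) ^ card (E \<inter> B)" by (simp add: exp_of_nat_mult exp_minus power_one_over inverse_eq_divide)
    finally show ?thesis .
  qed
  have "bin_prob A p (\<lambda>E. A0 \<subseteq> E \<and> real (card (E \<inter> B)) \<le> k)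
      \<le> bin_prob A p (\<lambda>E. A0 \<subseteq> E \<and> exp (- k * ln 2) \<le> (1/2) ^ card (E \<inter> B))"
    using assms * by (intro bin_prob_mono) auto
  also have "\<dots> \<le> bin_expect A p (\<lambda>E. of_bool (A0 \<subseteq> E) * (1/2) ^ card (E \<inter> B)) / exp (- k * ln 2)"
    using assms by (intro bin_prob_markov) auto
  also have "\<dots> = p ^ card A0 * (1 + (- p / 2)) ^ card B / exp (- k * ln 2)"
    using assms by (subst bin_expect_mgf) auto
  also have "\<dots> \<le> p ^ card A0 * exp ((- p / 2) * real (card B)) / exp (- k * ln 2)"
    using assms by (intro divide_right_mono mult_left_mono one_plus_power_le_exp) auto
  also have "\<dots> = p ^ card A0 * exp (k * ln 2 - p * real (card B) / 2)"
  proof -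
    have "k * ln 2 - p * real (card B) / 2 = (- p / 2) * real (card B) - (- k * ln 2)" by simp
    then show ?thesis by (simp only: exp_diff times_divide_eq_right)
  qed
  finally show ?thesis .
qed

text \<open>The parameter \<open>z\<close> stays free: a set of \<open>s\<close> vertices spans only
  about a fraction \<open>s / n\<close> of the expected degree per vertex, so the useful
  \<open>z\<close> grows as \<open>s\<close> decreases.\<close>

lemma bin_prob_upper_tail:
  assumes "0 \<le> p" "p \<le> 1" "finite A" "B \<subseteq> A" "z \<ge> 1"
  shows "bin_prob A p (\<lambda>E. k \<le> real (card (E \<inter> B))) \<le> exp ((z - 1) * p * real (card B) - k * ln z)"
proof -
  have zp: "0 \<le> (z - 1) * p" using assms by simp
  have *: "exp (k * ln z) \<le> z ^ card (E \<inter> B)" if "k \<le> real (card (E \<inter> B))" for E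
  proof -
    have "exp (k * ln z) \<le> exp (real (card (E \<inter> B)) * ln z)"
      using that assms(5) by (simp add: mult_right_mono)
    also have "\<dots> = z ^ card (E \<inter> B)" using assms(5) by (simp add: exp_of_nat_mult)
    finally show ?thesis .
  qed
  have "bin_prob A p (\<lambda>E. k \<le> real (card (E \<inter> B)))
      \<le> bin_prob A p (\<lambda>E. {} \<subseteq> E \<and> exp (k * ln z) \<le> z ^ card (E \<inter> B))"
    using assms * by (intro bin_prob_mono) auto
  also have "\<dots> \<le> bin_expect A p (\<lambda>E. of_bool ({} \<subseteq> E) * z ^ card (E \<inter> B)) / exp (k * ln z)"
    using assms by (intro bin_prob_markov) auto
  also have "\<dots> = (1 + (z - 1) * p) ^ card B / exp (k * ln z)"
    using assms by (subst bin_expect_mgf) auto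
  also have "\<dots> \<le> exp (((z - 1) * p) * real (card B)) / exp (k * ln z)"
    using zp by (intro divide_right_mono one_plus_power_le_exp) auto
  also have "\<dots> = exp ((z - 1) * p * real (card B) - k * ln z)" by (simp add: exp_diff)
  finally show ?thesis .
qed

text \<open>The Efron--Stein inequality in the only case needed: for \<open>f\<close> of bounded differences, the two
  conditional means given one coordinate differ by at most \<open>c\<close>, which bounds the increment of the
  variance per coordinate by \<open>c\<^sup>2 p (1 - p)\<close>.\<close>

lemma bin_variance_le:
  assumes "finite A" "0 \<le> p" "p \<le> 1"
    and "\<And>E a. E \<subseteq> A \<Longrightarrow> a \<in> A - E \<Longrightarrow> \<bar>f (insert a E) - f E\<bar> \<le> c"
  shows "bin_expect A p (\<lambda>E. (f E)\<^sup>2) - (bin_expect A p f)\<^sup>2 \<le> c\<^sup>2 * p * real (card A)"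
  using assms(1,4)
proof (induction A arbitrary: f rule: finite_induct)
  case (insert a A)
  define g where "g E = f (insert a E)" for E
  define \<mu> \<nu> where "\<mu> = bin_expect A p f" and "\<nu> = bin_expect A p g"
  define V W where "V = bin_expect A p (\<lambda>E. (f E)\<^sup>2)" and "W = bin_expect A p (\<lambda>E. (g E)\<^sup>2)"
  have f: "V - \<mu>\<^sup>2 \<le> c\<^sup>2 * p * real (card A)"
    unfolding V_def \<mu>_def using insert.hyps insert.prems by (intro insert.IH) auto
  have g: "W - \<nu>\<^sup>2 \<le> c\<^sup>2 * p * real (card A)"
    unfolding W_def \<nu>_def
  proof (intro insert.IH)
    fix E b assume "E \<subseteq> A" "b \<in> A - E"
    then show "\<bar>g (insert b E) - g E\<bar> \<le> c"
      using insert.prems[of "insert a E" b] insert.hyps by (auto simp: g_def insert_commute)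
  qed
  have gf: "\<bar>g E - f E\<bar> \<le> c" if "E \<subseteq> A" for E
    using insert.prems[of E a] insert.hyps that by (auto simp: g_def)
  have "bin_expect A p (\<lambda>E. g E - f E) \<le> bin_expect A p (\<lambda>_. c)"
    using assms(2,3) abs_le_D1[OF gf] by (intro bin_expect_mono) auto
  moreover have "bin_expect A p (\<lambda>E. - c) \<le> bin_expect A p (\<lambda>E. g E - f E)"
  proof (rule bin_expect_mono[OF assms(2,3)])
    fix E assume "E \<subseteq> A"
    then show "- c \<le> g E - f E" using gf[of E] by linarith
  qed
  ultimately have "\<bar>\<nu> - \<mu>\<bar> \<le> c"
    using insert.hyps by (simp add: bin_expect_diff bin_expect_const \<mu>_def \<nu>_def)
  then have sq: "(\<nu> - \<mu>)\<^sup>2 \<le> c\<^sup>2" by (metis abs_ge_zero power2_abs power_mono)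
  have "(1 - p) * V + p * W - ((1 - p) * \<mu> + p * \<nu>)\<^sup>2
      = (1 - p) * (V - \<mu>\<^sup>2) + p * (W - \<nu>\<^sup>2) + p * (1 - p) * (\<nu> - \<mu>)\<^sup>2"
    by (simp add: power2_eq_square algebra_simps)
  also have "\<dots> \<le> (1 - p) * (c\<^sup>2 * p * real (card A)) + p * (c\<^sup>2 * p * real (card A)) + p * 1 * c\<^sup>2"
    using assms(2,3) f g sq by (intro add_mono mult_left_mono mult_mono) auto
  also have "\<dots> = c\<^sup>2 * p * real (card (insert a A))"
    using insert.hyps by (simp add: algebra_simps)
  finally show ?case
    using insert.hyps by (simp add: bin_expect_insert V_def W_def \<mu>_def \<nu>_def g_def[abs_def])
qed simp

lemma bin_chebyshev:
  assumes "finite A" "0 \<le> p" "p \<le> 1" "t > 0"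
    and "\<And>E a. E \<subseteq> A \<Longrightarrow> a \<in> A - E \<Longrightarrow> \<bar>f (insert a E) - f E\<bar> \<le> c"
  shows "bin_prob A p (\<lambda>E. t \<le> \<bar>f E - bin_expect A p f\<bar>) \<le> c\<^sup>2 * p * real (card A) / t\<^sup>2"
proof -
  define \<mu> where "\<mu> = bin_expect A p f"
  have "bin_prob A p (\<lambda>E. t \<le> \<bar>f E - \<mu>\<bar>) \<le> bin_prob A p (\<lambda>E. True \<and> t\<^sup>2 \<le> (f E - \<mu>)\<^sup>2)"
    using assms by (intro bin_prob_mono) (auto simp: abs_le_square_iff[symmetric])
  also have "\<dots> \<le> bin_expect A p (\<lambda>E. of_bool True * (f E - \<mu>)\<^sup>2) / t\<^sup>2"
    using assms by (intro bin_prob_markov) auto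
  also have "bin_expect A p (\<lambda>E. of_bool True * (f E - \<mu>)\<^sup>2)
      = bin_expect A p (\<lambda>E. (f E)\<^sup>2 - 2 * \<mu> * f E + \<mu>\<^sup>2)"
    by (intro bin_expect_cong) (simp add: power2_eq_square algebra_simps)
  also have "\<dots> = bin_expect A p (\<lambda>E. (f E)\<^sup>2) - \<mu>\<^sup>2"
    unfolding bin_expect_add bin_expect_diff bin_expect_cmult bin_expect_const[OF assms(1)] \<mu>_def[symmetric]
    by (simp add: power2_eq_square)
  also have "\<dots> \<le> c\<^sup>2 * p * real (card A)"
    unfolding \<mu>_def using assms by (intro bin_variance_le) auto
  finally show ?thesis unfolding \<mu>_def by (simp add: divide_right_mono)
qed

text \<open>The union over the possible intersections \<open>J\<close>, each of which has an
  explicit product probability. In contrast to an exponential moment this keeps the factor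
  \<open>1 / sqrt d\<close> at half the mean.\<close>

lemma bin_prob_card_eq_le:
  assumes "0 \<le> p" "p \<le> 1" "finite A" "B \<subseteq> A"
  shows "bin_prob A p (\<lambda>E. card (E \<inter> B) = j) \<le> real (card B choose j) * p ^ j * (1 - p) ^ (card B - j)"
proof -
  let ?I = "{J. J \<subseteq> B \<and> card J = j}"
  have B: "finite B" using assms by (auto dest: finite_subset)
  have pt: "bin_prob A p (\<lambda>E. E \<inter> B = J) = p ^ j * (1 - p) ^ (card B - j)" if "J \<in> ?I" for J
  proof -
    have J: "J \<subseteq> B" "finite J" "card J = j" using that B by (auto dest: finite_subset)
    let ?g = "\<lambda>a. of_bool (a \<notin> B - J)" and ?h = "\<lambda>a. of_bool (a \<notin> J) :: real"
    have "of_bool (E \<inter> B = J) = (\<Prod>a\<in>A. if a \<in> E then ?g a else ?h a)" if "E \<subseteq> A" for E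
    proof (cases "E \<inter> B = J")
      case True
      then have "(\<Prod>a\<in>A. if a \<in> E then ?g a else ?h a) = 1" by (intro prod.neutral) auto
      then show ?thesis using True by simp
    next
      case False
      then obtain a where "a \<in> E \<and> a \<in> B - J \<or> a \<notin> E \<and> a \<in> J" using J by blast
      then have "(\<Prod>a\<in>A. if a \<in> E then ?g a else ?h a) = 0"
        using assms J that by (intro prod_zero) (auto intro!: bexI[of _ a])
      then show ?thesis using False by simp
    qed
    then have "bin_prob A p (\<lambda>E. E \<inter> B = J) = (\<Prod>a\<in>A. p * ?g a + (1 - p) * ?h a)"
      unfolding bin_expect_prod[OF assms(3), symmetric] by (rule bin_expect_cong)
    also have "\<dots> = (\<Prod>a\<in>A. (if a \<in> J then p else 1) * (if a \<in> B - J then 1 - p else 1))"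
      using J by (intro prod.cong) auto
    also have "\<dots> = p ^ card (A \<inter> J) * (1 - p) ^ card (A \<inter> (B - J))"
      unfolding prod.distrib using assms by (simp add: prod.If_cases Int_def)
    finally have "bin_prob A p (\<lambda>E. E \<inter> B = J) = p ^ card (A \<inter> J) * (1 - p) ^ card (A \<inter> (B - J))" .
    moreover have "A \<inter> J = J" "A \<inter> (B - J) = B - J" using J assms by auto
    ultimately show ?thesis using J B by (simp add: card_Diff_subset)
  qed
  have "bin_prob A p (\<lambda>E. card (E \<inter> B) = j) \<le> bin_prob A p (\<lambda>E. \<exists>J\<in>?I. E \<inter> B = J)"
    using assms by (intro bin_prob_mono) auto
  also have "\<dots> \<le> (\<Sum>J\<in>?I. bin_prob A p (\<lambda>E. E \<inter> B = J))"
    using assms B by (intro bin_prob_union_bound) auto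
  also have "\<dots> = real (card ?I) * (p ^ j * (1 - p) ^ (card B - j))" using pt by simp
  also have "card ?I = card B choose j" by (rule n_subsets[OF B])
  finally show ?thesis by (simp add: mult.assoc)
qed

section \<open>Rules for events that hold a.a.s\<close>

lemma finite_all_edges [simp]: "finite (all_edges n)"
  by (simp add: all_edges_eq finite_edges_on)

lemma aasI:
  assumes "\<And>n. 0 \<le> p n \<and> p n \<le> 1"
    and "\<forall>\<^sub>F n in sequentially. bin_prob (all_edges n) (p n) (\<lambda>E. \<not> P n E) \<le> r n"
    and "r \<longlonglongrightarrow> 0"
  shows "aas p P"
proof -
  have "(\<lambda>n. bin_prob (all_edges n) (p n) (\<lambda>E. \<not> P n E)) \<longlonglongrightarrow> 0"
    using assms by (intro tendsto_sandwich[OF _ assms(2) tendsto_const assms(3)])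
      (auto intro!: always_eventually bin_expect_nonneg)
  then have "(\<lambda>n. 1 - bin_prob (all_edges n) (p n) (\<lambda>E. \<not> P n E)) \<longlonglongrightarrow> 1 - 0"
    by (intro tendsto_intros)
  then show ?thesis unfolding aas_def gnp_prob_eq by (simp add: bin_prob_not)
qed

lemma aasD:
  assumes "aas p P"
  shows "(\<lambda>n. bin_prob (all_edges n) (p n) (\<lambda>E. \<not> P n E)) \<longlonglongrightarrow> 0"
proof -
  have "(\<lambda>n. 1 - bin_prob (all_edges n) (p n) (P n)) \<longlonglongrightarrow> 1 - 1"
    using assms unfolding aas_def gnp_prob_eq by (intro tendsto_intros)
  then show ?thesis by (simp add: bin_prob_not)
qed

lemma aas_mono:
  assumes "\<And>n. 0 \<le> p n \<and> p n \<le> 1" "aas p P"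
    and "\<forall>\<^sub>F n in sequentially. \<forall>E\<subseteq>all_edges n. P n E \<longrightarrow> Q n E"
  shows "aas p Q"
proof (rule aasI[OF assms(1) _ aasD[OF assms(2)]])
  show "\<forall>\<^sub>F n in sequentially. bin_prob (all_edges n) (p n) (\<lambda>E. \<not> Q n E)
      \<le> bin_prob (all_edges n) (p n) (\<lambda>E. \<not> P n E)"
    using assms(3) by eventually_elim (use assms(1) in \<open>auto intro!: bin_prob_mono\<close>)
qed

lemma aas_conj:
  assumes "\<And>n. 0 \<le> p n \<and> p n \<le> 1" "aas p P" "aas p Q"
  shows "aas p (\<lambda>n E. P n E \<and> Q n E)"
proof (rule aasI[OF assms(1)])
  let ?r = "\<lambda>n. bin_prob (all_edges n) (p n) (\<lambda>E. \<not> P n E) + bin_prob (all_edges n) (p n) (\<lambda>E. \<not> Q n E)"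
  show "\<forall>\<^sub>F n in sequentially. bin_prob (all_edges n) (p n) (\<lambda>E. \<not> (P n E \<and> Q n E)) \<le> ?r n"
    unfolding de_Morgan_conj using assms(1) by (intro always_eventually allI bin_prob_disj) auto
  show "?r \<longlonglongrightarrow> 0" using tendsto_add[OF aasD[OF assms(2)] aasD[OF assms(3)]] by simp
qed

section \<open>Union bounds over vertex sets\<close>

lemma sum_power_div_fact_le_exp:
  assumes "finite I" "0 \<le> (x::real)"
  shows "(\<Sum>i\<in>I. x ^ i / fact i) \<le> exp x"
proof -
  have "(\<Sum>i\<in>I. inverse (fact i) * x ^ i) \<le> (\<Sum>i. inverse (fact i) * x ^ i)"
    using assms summable_exp[of x] by (intro sum_le_suminf) auto
  then show ?thesis by (simp add: exp_def field_simps scaleR_conv_of_real)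
qed

text \<open>The bound \<open>(e n / s) ^ s\<close>, as an exponential so that the entropy adds to
  the exponents of the tail bounds. It follows from
  \<open>s ^ s / fact s \<le> exp s\<close>.\<close>

lemma binomial_le_exp:
  assumes "1 \<le> s" "s \<le> n"
  shows "real (n choose s) \<le> exp (real s * (1 + ln (real n / real s)))"
proof -
  have "real s ^ s / fact s \<le> exp (real s)"
    using sum_power_div_fact_le_exp[of "{s}" "real s"] by simp
  then have "real s ^ s \<le> exp (real s) * fact s" by (simp add: field_simps)
  moreover have "real (n choose s) * fact s \<le> real n ^ s"
    using binomial_fact_pow[of n s] by (metis of_nat_fact of_nat_le_iff of_nat_mult of_nat_power)
  ultimately have "(real (n choose s) * fact s) * real s ^ s \<le> real n ^ s * (exp (real s) * fact s)"
    by (intro mult_mono) auto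
  then have "real (n choose s) * real s ^ s \<le> real n ^ s * exp (real s)" by (simp add: field_simps)
  then have "real (n choose s) \<le> exp (real s) * (real n / real s) ^ s"
    using assms by (simp add: field_simps power_divide)
  also have "\<dots> = exp (real s) * exp (real s * ln (real n / real s))"
    using assms by (simp add: exp_of_nat_mult)
  finally show ?thesis by (simp add: exp_add[symmetric] distrib_left)
qed

lemma real_card_edges_on: "finite S \<Longrightarrow> real (card (edges_on S)) = real (card S) * (real (card S) - 1) / 2"
proof -
  assume S: "finite S"
  have "2 * (m choose 2) = m * (m - 1)" for m
    by (cases m) (simp_all add: choose_two dvd_mult_div_cancel del: mult_Suc mult_Suc_right)
  then have "2 * real (m choose 2) = real m * real (m - 1)" for m by (metis of_nat_mult of_nat_numeral)
  then have "2 * real (m choose 2) = real m * (real m - 1)" for m by (cases m) auto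
  from this[of "card S"] show ?thesis using S by (simp add: card_edges_on)
qed

text \<open>The edges with at least one end in \<open>T\<close>, encoded as a difference so that
  every edge set splits into these and the edges inside the complement. For a singleton it is the
  star at a vertex.\<close>

definition touching :: "nat \<Rightarrow> nat set \<Rightarrow> nat set set" where
  "touching n T = all_edges n - edges_on ({..<n} - T)"

lemma real_card_touching:
  assumes "T \<subseteq> {..<n}"
  shows "real (card (touching n T)) = real (card T) * (real n - 1) - real (card T) * (real (card T) - 1) / 2"
proof -
  have sub: "edges_on ({..<n} - T) \<subseteq> edges_on {..<n}" by (intro edges_on_mono) auto
  have le: "card T \<le> n" using assms card_mono[of "{..<n}" T] by simp
  have c: "card ({..<n} - T) = n - card T"
    using assms by (subst card_Diff_subset) (auto intro: finite_subset)
  have "card (touching n T) = card (edges_on {..<n}) - card (edges_on ({..<n} - T))"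
    unfolding touching_def all_edges_eq using sub by (intro card_Diff_subset) auto
  moreover have "card (edges_on ({..<n} - T)) \<le> card (edges_on {..<n})"
    using sub by (intro card_mono) auto
  ultimately have "real (card (touching n T)) = real n * (real n - 1) / 2 - real (n - card T) * (real (n - card T) - 1) / 2"
    by (simp add: of_nat_diff real_card_edges_on c)
  then show ?thesis using le by (simp add: of_nat_diff field_simps)
qed

lemma card_edges_split:
  assumes "E \<subseteq> all_edges n"
  shows "card E = card (E \<inter> edges_on ({..<n} - T)) + card (E \<inter> touching n T)"
proof -
  have "finite E" using assms by (rule finite_subset) simp
  then have "card (E \<inter> edges_on ({..<n} - T)) + card (E \<inter> touching n T)
      = card ((E \<inter> edges_on ({..<n} - T)) \<union> (E \<inter> touching n T))"
    by (intro card_Un_disjoint[symmetric]) (auto simp: touching_def)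
  also have "(E \<inter> edges_on ({..<n} - T)) \<union> (E \<inter> touching n T) = E"
    using assms by (auto simp: touching_def)
  finally show ?thesis by simp
qed

lemma bin_prob_ex_subset_le:
  assumes "0 \<le> p" "p \<le> 1" "1 \<le> s" "s \<le> n"
    and "\<And>S. S \<subseteq> {..<n} \<Longrightarrow> card S = s \<Longrightarrow> bin_prob A p (Q S) \<le> exp x"
  shows "bin_prob A p (\<lambda>E. \<exists>S\<subseteq>{..<n}. card S = s \<and> Q S E) \<le> exp (real s * (1 + ln (real n / real s)) + x)"
proof -
  let ?I = "{S. S \<subseteq> {..<n} \<and> card S = s}"
  have "bin_prob A p (\<lambda>E. \<exists>S\<subseteq>{..<n}. card S = s \<and> Q S E) \<le> bin_prob A p (\<lambda>E. \<exists>S\<in>?I. Q S E)"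
    using assms by (intro bin_prob_mono) auto
  also have "\<dots> \<le> (\<Sum>S\<in>?I. bin_prob A p (Q S))" using assms by (intro bin_prob_union_bound) auto
  also have "\<dots> \<le> real (card ?I) * exp x" using assms(5) by (intro sum_bounded_above) auto
  also have "\<dots> = real (n choose s) * exp x" by (simp add: n_subsets)
  also have "\<dots> \<le> exp (real s * (1 + ln (real n / real s))) * exp x"
    using assms by (intro mult_right_mono binomial_le_exp) auto
  finally show ?thesis by (simp add: exp_add)
qed

lemma bin_prob_dense_set:
  assumes "0 \<le> p" "p \<le> 1" "1 \<le> s" "s \<le> n" "1 \<le> z"
  shows "bin_prob (all_edges n) p (\<lambda>E. \<exists>S\<subseteq>{..<n}. card S = s \<and> k \<le> real (card (E \<inter> edges_on S)))
    \<le> exp (real s * (1 + ln (real n / real s)) + ((z - 1) * p * (real s * (real s - 1) / 2) - k * ln z))"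
proof (rule bin_prob_ex_subset_le[OF assms(1-4)])
  fix S assume S: "S \<subseteq> {..<n}" "card S = s"
  have "finite S" using S finite_subset by blast
  then have c: "real (card (edges_on S)) = real s * (real s - 1) / 2" using S by (simp add: real_card_edges_on)
  have sub: "edges_on S \<subseteq> all_edges n" using S by (simp add: all_edges_eq edges_on_mono)
  show "bin_prob (all_edges n) p (\<lambda>E. k \<le> real (card (E \<inter> edges_on S)))
      \<le> exp ((z - 1) * p * (real s * (real s - 1) / 2) - k * ln z)"
    by (rule bin_prob_upper_tail[OF assms(1,2) finite_all_edges sub assms(5), of k, unfolded c])
qed

lemma bin_prob_weakly_touched_set:
  assumes "0 \<le> p" "p \<le> 1" "1 \<le> t" "t \<le> n"
  shows "bin_prob (all_edges n) p (\<lambda>E. \<exists>T\<subseteq>{..<n}. card T = t \<and> real (card (E \<inter> touching n T)) \<le> k)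
    \<le> exp (real t * (1 + ln (real n / real t))
        + (k * ln 2 - p * (real t * (real n - 1) - real t * (real t - 1) / 2) / 2))"
proof (rule bin_prob_ex_subset_le[OF assms])
  fix T assume T: "T \<subseteq> {..<n}" "card T = t"
  then have "real (card (touching n T)) = real t * (real n - 1) - real t * (real t - 1) / 2"
    by (simp add: real_card_touching)
  moreover have "touching n T \<subseteq> all_edges n" by (auto simp: touching_def)
  ultimately show "bin_prob (all_edges n) p (\<lambda>E. real (card (E \<inter> touching n T)) \<le> k)
      \<le> exp (k * ln 2 - p * (real t * (real n - 1) - real t * (real t - 1) / 2) / 2)"
    using bin_prob_lower_tail[OF assms(1,2) finite_all_edges, of "{}" n "touching n T" k] by simp
qed

lemma bin_prob_ex_size_le:
  assumes "0 \<le> p" "p \<le> 1" "0 \<le> q" "q \<le> 1 / 2" "0 \<le> C" "I \<subseteq> {1..n}"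
    and "\<And>s. s \<in> I \<Longrightarrow> bin_prob A p (Q s) \<le> C * q ^ s"
  shows "bin_prob A p (\<lambda>E. \<exists>s\<in>I. Q s E) \<le> 2 * C * q"
proof -
  have fin: "finite I" using assms(6) finite_subset by blast
  have "bin_prob A p (\<lambda>E. \<exists>s\<in>I. Q s E) \<le> (\<Sum>s\<in>I. bin_prob A p (Q s))"
    by (rule bin_prob_union_bound[OF assms(1,2) fin])
  also have "\<dots> \<le> (\<Sum>s\<in>I. C * q ^ s)" using assms(7) by (rule sum_mono)
  also have "\<dots> \<le> (\<Sum>s\<in>{1..n}. C * q ^ s)" using assms by (intro sum_mono2) auto
  also have "\<dots> = C * q * (\<Sum>s<n. q ^ s)"
    unfolding sum_distrib_left by (rule sum.reindex_bij_witness[of _ Suc "\<lambda>s. s - 1"]) (auto simp flip: power_Suc)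
  also have "\<dots> \<le> C * q * 2"
  proof (rule mult_left_mono)
    have "(\<Sum>s<n. q ^ s) = (1 - q ^ n) / (1 - q)" using assms by (subst sum_gp_strict) auto
    also have "\<dots> \<le> 1 / (1/2)" using assms by (intro frac_le) auto
    finally show "(\<Sum>s<n. q ^ s) \<le> 2" by simp
  qed (use assms in auto)
  finally show ?thesis by (simp add: mult_ac)
qed

lemma bin_expect_card:
  assumes "finite A"
  shows "bin_expect A p (\<lambda>E. real (card E)) = p * real (card A)"
proof -
  have "bin_expect A p (\<lambda>E. real (card E)) = bin_expect A p (\<lambda>E. \<Sum>a\<in>A. of_bool (a \<in> E))"
  proof (rule bin_expect_cong)
    fix E assume "E \<subseteq> A"
    then show "real (card E) = (\<Sum>a\<in>A. of_bool (a \<in> E))"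
      using assms by (simp add: Int_absorb1 flip: Int_def)
  qed
  also have "\<dots> = (\<Sum>a\<in>A. p)"
    unfolding bin_expect_sum
  proof (rule sum.cong)
    fix a assume "a \<in> A"
    then show "bin_prob A p (\<lambda>E. a \<in> E) = p"
      using bin_expect_mgf[OF assms, of "{a}" "{}" p 1] by simp
  qed simp
  finally show ?thesis by simp
qed

lemma real_card_all_edges: "real (card (all_edges n)) = real n * (real n - 1) / 2"
  unfolding all_edges_eq by (subst real_card_edges_on) auto

lemma bin_prob_card_deviation:
  assumes "0 \<le> p" "p \<le> 1" "t > 0"
  shows "bin_prob (all_edges n) p (\<lambda>E. t \<le> \<bar>real (card E) - p * (real n * (real n - 1) / 2)\<bar>)
    \<le> p * (real n * (real n - 1) / 2) / t\<^sup>2"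
proof -
  have "\<bar>real (card (insert a E)) - real (card E)\<bar> \<le> 1" if "E \<subseteq> all_edges n" "a \<in> all_edges n - E" for E a
  proof -
    have "finite E" using that finite_all_edges finite_subset by blast
    then show ?thesis using that by simp
  qed
  from bin_chebyshev[OF finite_all_edges assms this] show ?thesis
    by (simp add: bin_expect_card real_card_all_edges)
qed

lemma aas_card_approx:
  assumes p: "\<And>n. 0 \<le> p n \<and> p n \<le> 1"
    and pn2: "filterlim (\<lambda>n. p n * real n ^ 2) at_top sequentially" and \<epsilon>: "\<epsilon> > 0"
  shows "aas p (\<lambda>n E. \<bar>real (card E) - p n * real n ^ 2 / 2\<bar> < \<epsilon> * (p n * real n ^ 2))"
proof (rule aasI[OF p])
  define r where "r n = 2 / \<epsilon>\<^sup>2 * inverse (p n * real n ^ 2)" for n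
  show "r \<longlonglongrightarrow> 0"
    unfolding r_def by (rule tendsto_mult_right_zero[OF tendsto_inverse_0_at_top[OF pn2]])
  have "\<forall>\<^sub>F n in sequentially. 0 < p n * real n ^ 2"
    using pn2 by (simp add: filterlim_at_top_dense)
  moreover have "\<forall>\<^sub>F n in sequentially. real n \<ge> 1 / \<epsilon>"
    using filterlim_real_sequentially by (simp add: filterlim_at_top)
  ultimately show "\<forall>\<^sub>F n in sequentially. bin_prob (all_edges n) (p n)
      (\<lambda>E. \<not> \<bar>real (card E) - p n * real n ^ 2 / 2\<bar> < \<epsilon> * (p n * real n ^ 2)) \<le> r n"
  proof eventually_elim
    case (elim n)
    let ?x = "p n * real n ^ 2"
    have n0: "n > 0" using elim(1) by (cases n) auto
    have "?x * 1 \<le> ?x * (\<epsilon> * real n)" using elim \<epsilon> by (intro mult_left_mono) (auto simp: field_simps)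
    \<comment> \<open>Replacing \<open>n (n - 1)\<close> by \<open>n ^ 2\<close> costs
      \<open>p n / 2\<close>, at most half of the allowed deviation once
      \<open>n \<ge> 1 / \<epsilon>\<close>.\<close>
    then have pn: "p n * real n \<le> \<epsilon> * ?x" using n0 by (simp add: power2_eq_square field_simps)
    have "bin_prob (all_edges n) (p n) (\<lambda>E. \<not> \<bar>real (card E) - ?x / 2\<bar> < \<epsilon> * ?x)
        \<le> bin_prob (all_edges n) (p n) (\<lambda>E. \<epsilon> * ?x / 2 \<le> \<bar>real (card E) - p n * (real n * (real n - 1) / 2)\<bar>)"
    proof (rule bin_prob_mono)
      fix E assume "\<not> \<bar>real (card E) - ?x / 2\<bar> < \<epsilon> * ?x"
      moreover have "p n * (real n * (real n - 1) / 2) = ?x / 2 - p n * real n / 2"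
        by (simp add: power2_eq_square field_simps)
      moreover have "0 \<le> p n * real n" using p by simp
      ultimately show "\<epsilon> * ?x / 2 \<le> \<bar>real (card E) - p n * (real n * (real n - 1) / 2)\<bar>"
        using pn by linarith
    qed (use p in auto)
    also have "\<dots> \<le> p n * (real n * (real n - 1) / 2) / (\<epsilon> * ?x / 2)\<^sup>2"
      using p elim \<epsilon> by (intro bin_prob_card_deviation) auto
    also have "\<dots> \<le> (?x / 2) / (\<epsilon> * ?x / 2)\<^sup>2"
      using p[of n] by (intro divide_right_mono) (auto simp: power2_eq_square intro!: mult_left_mono)
    also have "\<dots> = r n"
      using elim(1) \<epsilon> by (simp add: r_def power2_eq_square divide_simps)
    finally show ?case .
  qed
qed

text \<open>The common frame of the union bounds below: failure probabilities \<open>C q ^ s\<close>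
  at size \<open>s\<close> form a geometric series with sum at most \<open>2 C q\<close>. If
  \<open>q\<close> is a constant, the factor \<open>C\<close> has to supply the decay in
  \<open>n\<close>.\<close>

lemma aas_by_sizes:
  assumes p: "\<And>n. 0 \<le> p n \<and> p n \<le> 1" and I: "\<And>n. I n \<subseteq> {1..n}"
    and bound: "\<forall>\<^sub>F n in sequentially. \<forall>s\<in>I n. bin_prob (all_edges n) (p n) (Q n s) \<le> C n * q n ^ s"
    and q: "\<forall>\<^sub>F n in sequentially. 0 \<le> q n \<and> q n \<le> 1 / 2 \<and> 0 \<le> C n"
    and lim: "(\<lambda>n. C n * q n) \<longlonglongrightarrow> 0"
  shows "aas p (\<lambda>n E. \<forall>s\<in>I n. \<not> Q n s E)"
proof (rule aasI[OF p])
  show "(\<lambda>n. 2 * (C n * q n)) \<longlonglongrightarrow> 0" using tendsto_mult_right_zero[OF lim] .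
  show "\<forall>\<^sub>F n in sequentially. bin_prob (all_edges n) (p n) (\<lambda>E. \<not> (\<forall>s\<in>I n. \<not> Q n s E)) \<le> 2 * (C n * q n)"
    using bound q
  proof eventually_elim
    case (elim n)
    then have "bin_prob (all_edges n) (p n) (\<lambda>E. \<exists>s\<in>I n. Q n s E) \<le> 2 * C n * q n"
      using p I by (intro bin_prob_ex_size_le) auto
    then show ?case by (simp add: mult.assoc)
  qed
qed

lemma edges_on_small: "finite S \<Longrightarrow> card S \<le> 1 \<Longrightarrow> edges_on S = {}"
  using card_edges_on[of S] finite_edges_on[of S] by (simp add: binomial_eq_0)

section \<open>Vertex sets that are neither too dense nor too weakly touched\<close>

lemma aas_acyclic:
  assumes p: "\<And>n. 0 \<le> p n \<and> p n \<le> 1" and pn: "(\<lambda>n. p n * real n) \<longlonglongrightarrow> 0"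
  shows "aas p (\<lambda>n E. \<forall>S\<subseteq>{..<n}. S \<noteq> {} \<longrightarrow> card (E \<inter> edges_on S) \<le> card S - 1)"
proof -
  \<comment> \<open>The summand \<open>1 / n\<close> keeps \<open>r\<close> positive where
    \<open>p n\<close> vanishes, so that \<open>z\<close> and \<open>ln r\<close> below make
    sense.\<close>
  define r where "r n = p n * real n + 1 / real n" for n
  have "(\<lambda>n. 1 / real n) \<longlonglongrightarrow> 0" by real_asymp
  then have r: "r \<longlonglongrightarrow> 0" unfolding r_def using tendsto_add[OF pn] by simp
  define q where "q n = exp (3/2) * r n" for n
  have q0: "q \<longlonglongrightarrow> 0" unfolding q_def using tendsto_mult_right_zero[OF r] .
  define Q where "Q = (\<lambda>n s E. \<exists>S\<subseteq>{..<n}. card S = s \<and> real s \<le> real (card (E \<inter> edges_on S)))"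
  have "\<forall>\<^sub>F n in sequentially. q n < 1 / 2" using order_tendstoD(2)[OF q0, of "1 / 2"] by simp
  moreover have "\<forall>\<^sub>F n in sequentially. r n < 1" using order_tendstoD(2)[OF r] by simp
  ultimately have ev: "\<forall>\<^sub>F n in sequentially. q n < 1 / 2 \<and> r n < 1 \<and> n > 0"
    using eventually_gt_at_top[of 0] by eventually_elim simp
  have "aas p (\<lambda>n E. \<forall>s\<in>{1..n}. \<not> Q n s E)"
  proof (rule aas_by_sizes[where q = q and C = "\<lambda>_. 1", OF p])
    show "\<forall>\<^sub>F n in sequentially. 0 \<le> q n \<and> q n \<le> 1 / 2 \<and> 0 \<le> (1::real)"
      using ev by eventually_elim (use p in \<open>auto simp: q_def r_def\<close>)
    show "\<forall>\<^sub>F n in sequentially. \<forall>s\<in>{1..n}. bin_prob (all_edges n) (p n) (Q n s) \<le> 1 * q n ^ s"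
      using ev
    proof eventually_elim
      case (elim n)
      show ?case
      proof
        fix s assume s: "s \<in> {1..n}"
        \<comment> \<open>With this parameter the exponential moment costs at most
          \<open>s / 2\<close>, while \<open>s ln z\<close> cancels the entropy
          \<open>s ln (n / s)\<close> and leaves \<open>s ln r\<close>, which tends to minus
          infinity.\<close>
        define z where "z = real n / (real s * r n)"
        have r0: "r n > 0" using elim p[of n] by (auto simp: r_def intro!: add_nonneg_pos)
        have pr: "p n * real n \<le> r n" by (simp add: r_def)
        have "real s * r n \<le> real s * 1" using elim by (intro mult_left_mono) auto
        also have "\<dots> \<le> real n" using s by simp
        finally have z1: "1 \<le> z" using s r0 by (simp add: z_def)
        have lnz: "ln z = ln (real n / real s) - ln (r n)"
          using s r0 elim by (simp add: z_def ln_div ln_mult)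
        have "(z - 1) * p n * (real s * (real s - 1) / 2) \<le> z * p n * (real s * real s / 2)"
          using p[of n] z1 s by (intro mult_mono divide_right_mono) auto
        also have "\<dots> = (p n * real n) / r n * (real s / 2)"
          using s r0 by (simp add: z_def field_simps)
        also have "\<dots> \<le> 1 * (real s / 2)" using pr r0 by (intro mult_right_mono) auto
        finally have b: "(z - 1) * p n * (real s * (real s - 1) / 2) \<le> real s / 2" by simp
        have "bin_prob (all_edges n) (p n) (Q n s)
            \<le> exp (real s * (1 + ln (real n / real s)) + ((z - 1) * p n * (real s * (real s - 1) / 2) - real s * ln z))"
          unfolding Q_def using p s z1 by (intro bin_prob_dense_set) auto
        also have "\<dots> \<le> exp (real s * (3 / 2 + ln (r n)))"
          using b unfolding exp_le_cancel_iff lnz by (simp add: algebra_simps)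
        also have "\<dots> = q n ^ s" using r0 by (simp add: exp_of_nat_mult exp_add q_def)
        finally show "bin_prob (all_edges n) (p n) (Q n s) \<le> 1 * q n ^ s" by simp
      qed
    qed
  qed (use q0 in auto)
  then show ?thesis
  proof (rule aas_mono[OF p _ always_eventually[OF allI]], intro allI impI)
    fix n E S assume E: "E \<subseteq> all_edges n" "\<forall>s\<in>{1..n}. \<not> Q n s E" and S: "S \<subseteq> {..<n}" "S \<noteq> {}"
    have "finite S" using S finite_subset by blast
    moreover have "card S \<le> n" using S card_mono[of "{..<n}" S] by simp
    ultimately have "card S \<in> {1..n}" using S by (simp add: Suc_le_eq card_gt_0_iff)
    then have "\<not> Q n (card S) E" using E by blast
    then have "card (E \<inter> edges_on S) < card S" using S by (auto simp: Q_def not_le)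
    then show "card (E \<inter> edges_on S) \<le> card S - 1" by simp
  qed
qed

lemma aas_small_sets_sparse:
  assumes p: "\<And>n. 0 \<le> p n \<and> p n \<le> 1" and b: "b > 0"
    and pb: "\<forall>\<^sub>F n in sequentially. p n \<le> b / real n"
  obtains \<delta> where "\<delta> > 0" "\<delta> \<le> 1"
    and "aas p (\<lambda>n E. \<forall>S\<subseteq>{..<n}. S \<noteq> {} \<and> real (card S) \<le> \<delta> * real n \<longrightarrow>
           card (E \<inter> edges_on S) \<le> 2 * (card S - 1))"
proof -
  \<comment> \<open>For \<open>s \<le> \<delta> n\<close> this gives
    \<open>ln (n / s) \<ge> 4 + 2 b\<close>, enough to pay for the entropy and for the exponential
    moment \<open>b s / 2\<close>.\<close>
  define \<delta> where "\<delta> = exp (- (4 + 2 * b))"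
  define I where "I n = {s \<in> {2..n}. real s \<le> \<delta> * real n}" for n
  \<comment> \<open>Violating \<open>2 (s - 1)\<close> means having at least \<open>2 s - 1\<close>
    edges, by integrality. The resulting exponent of \<open>n / s\<close> is
    \<open>- (s - 1)\<close>, negative from \<open>s = 2\<close> on.\<close>
  define Q where "Q = (\<lambda>n s E. \<exists>S\<subseteq>{..<n}. card S = s \<and> 2 * real s - 1 \<le> real (card (E \<inter> edges_on S)))"
  have "aas p (\<lambda>n E. \<forall>s\<in>I n. \<not> Q n s E)"
  proof (rule aas_by_sizes[where q = "\<lambda>_. exp (- 1)" and C = "\<lambda>n. exp (4 - ln (real n) / 2)", OF p])
    have "exp (- 1) \<le> 1 / (2::real)" using exp_ge_add_one_self[of 1] by (simp add: exp_minus field_simps)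
    then show "\<forall>\<^sub>F n in sequentially. 0 \<le> exp (- 1 :: real) \<and> exp (- 1) \<le> 1 / (2::real) \<and> 0 \<le> exp (4 - ln (real n) / 2)"
      by simp
    show "(\<lambda>n. exp (4 - ln (real n) / 2) * exp (- 1)) \<longlonglongrightarrow> 0" by real_asymp
    show "\<forall>\<^sub>F n in sequentially. \<forall>s\<in>I n. bin_prob (all_edges n) (p n) (Q n s)
        \<le> exp (4 - ln (real n) / 2) * exp (- 1) ^ s"
      using pb
    proof eventually_elim
      case (elim n)
      show ?case
      proof
        fix s assume "s \<in> I n"
        then have s: "2 \<le> s" "s \<le> n" "real s \<le> \<delta> * real n" by (auto simp: I_def)
        define L where "L = ln (real n / real s)"
        define z where "z = real n / real s"
        have z1: "1 \<le> z" using s by (simp add: z_def)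
        have "exp (4 + 2 * b) * real s \<le> exp (4 + 2 * b) * (\<delta> * real n)"
          using s by (intro mult_left_mono) auto
        also have "\<dots> = real n" by (simp add: \<delta>_def flip: mult.assoc exp_add)
        finally have "exp (4 + 2 * b) \<le> real n / real s" using s by (simp add: field_simps)
        then have L: "4 + 2 * b \<le> L" unfolding L_def using s by (simp add: ln_ge_iff)
        have LL: "L = ln (real n) - ln (real s)" using s by (simp add: L_def ln_div)
        define W where "W = (z - 1) * p n * (real s * (real s - 1) / 2)"
        have "(z - 1) * p n * (real s * (real s - 1) / 2) \<le> z * (b / real n) * (real s * real s / 2)"
          using p[of n] z1 s elim b by (intro mult_mono divide_right_mono) auto
        also have "\<dots> = b * real s / 2" using s by (simp add: z_def field_simps)
        finally have c: "W \<le> b * real s / 2" unfolding W_def .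
        have "bin_prob (all_edges n) (p n) (Q n s)
            \<le> exp (real s * (1 + L) + (W - (2 * real s - 1) * L))"
          using bin_prob_dense_set[of "p n" s n z "2 * real s - 1"] p s z1
          unfolding Q_def L_def z_def W_def by auto
        also have "\<dots> \<le> exp (4 - ln (real n) / 2 - real s)"
          unfolding exp_le_cancel_iff
        proof -
          \<comment> \<open>The exponent is \<open>s + W - (s - 1) L\<close>. Half of
            \<open>(s - 1) L\<close> pays for \<open>s\<close> and \<open>W\<close>, then
            \<open>(s - 2) L / 2\<close> gives decay in \<open>s\<close>, and the remaining
            \<open>L / 2\<close> gives the factor \<open>1 / sqrt n\<close>.\<close>
          have "(real s - 1) * (2 + b) \<le> (real s - 1) * (L / 2)"
            using L s by (intro mult_left_mono) auto
          then have "4 * real s + 2 * (real s * b) - 4 - 2 * b \<le> real s * L - L" by (simp add: algebra_simps)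
          moreover have "(real s - 2) * 4 \<le> (real s - 2) * L"
            using L s b by (intro mult_left_mono) auto
          then have "4 * real s - 8 \<le> real s * L - 2 * L" by (simp add: algebra_simps)
          moreover have "real s * b \<ge> 2 * b" using s b by (intro mult_right_mono) auto
          moreover have "ln (real s) \<le> real s - 1" using s by (intro ln_le_minus_one) auto
          moreover have "real s * (1 + L) + (W - (2 * real s - 1) * L) = real s - real s * L + W + L"
            by (simp add: algebra_simps)
          moreover have "W \<le> (real s * b) / 2" using c by (simp add: mult.commute)
          ultimately show "real s * (1 + L) + (W - (2 * real s - 1) * L) \<le> 4 - ln (real n) / 2 - real s"
            using LL s(1) by linarith
        qed
        also have "\<dots> = exp (4 - ln (real n) / 2) * exp (- 1) ^ s"
          by (simp flip: exp_of_nat_mult exp_add)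
        finally show "bin_prob (all_edges n) (p n) (Q n s) \<le> exp (4 - ln (real n) / 2) * exp (- 1) ^ s" .
      qed
    qed
  qed (auto simp: I_def)
  then have "aas p (\<lambda>n E. \<forall>S\<subseteq>{..<n}. S \<noteq> {} \<and> real (card S) \<le> \<delta> * real n \<longrightarrow>
      card (E \<inter> edges_on S) \<le> 2 * (card S - 1))"
  proof (rule aas_mono[OF p _ always_eventually[OF allI]], intro allI impI)
    fix n E S assume E: "E \<subseteq> all_edges n" "\<forall>s\<in>I n. \<not> Q n s E"
      and S: "S \<subseteq> {..<n}" "S \<noteq> {} \<and> real (card S) \<le> \<delta> * real n"
    have fin: "finite S" using S finite_subset by blast
    show "card (E \<inter> edges_on S) \<le> 2 * (card S - 1)"
    proof (cases "card S \<le> 1")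
      case False
      moreover have "card S \<le> n" using S card_mono[of "{..<n}" S] by simp
      ultimately have "card S \<in> I n" using S by (simp add: I_def)
      then have "\<not> Q n (card S) E" using E by blast
      then have "real (card (E \<inter> edges_on S)) < 2 * real (card S) - 1" using S by (auto simp: Q_def not_le)
      then show ?thesis using False by linarith
    qed (simp add: edges_on_small[OF fin])
  qed
  moreover have "\<delta> \<le> 1" using b by (simp add: \<delta>_def)
  ultimately show thesis using that[of \<delta>] by (simp add: \<delta>_def)
qed

text \<open>The hypothesis \<open>conv\<close> is the exponential moment bound with
  \<open>z = 1 / sqrt \<sigma>\<close> at relative size \<open>\<sigma> = s / n\<close>: the moment
  costs \<open>(sqrt \<sigma> - \<sigma>) p n (s - 1) / 2\<close> and the threshold gains
  \<open>\<kappa> ln (1 / \<sigma>) p n (s - 1) / 2\<close>. The fraction \<open>\<tau>\<close> of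
  the gain that is left is multiplied by \<open>p n\<close> and so finally beats the entropy of
  choosing the set.\<close>

lemma aas_no_dense_set:
  fixes p :: "nat \<Rightarrow> real"
  assumes p: "\<And>n. 0 \<le> p n \<and> p n \<le> 1" and pn: "filterlim (\<lambda>n. p n * real n) at_top sequentially"
    and \<kappa>: "\<kappa> > 0" and \<tau>: "\<tau> > 0" and \<sigma>: "\<sigma>\<^sub>0 \<le> 1 / 2"
    and conv: "\<And>\<sigma>. 0 < \<sigma> \<Longrightarrow> \<sigma> \<le> \<sigma>\<^sub>0 \<Longrightarrow> sqrt \<sigma> - \<sigma> \<le> (1 - \<tau>) * \<kappa> * ln (1 / \<sigma>)"
  shows "aas p (\<lambda>n E. \<forall>S\<subseteq>{..<n}. card S \<ge> 2 \<and> real (card S) \<le> \<sigma>\<^sub>0 * real n \<longrightarrow>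
      real (card (E \<inter> edges_on S)) < \<kappa> * (p n * real n) * (real (card S) - 1))"
proof -
  define I where "I n = {s \<in> {2..n}. real s \<le> \<sigma>\<^sub>0 * real n}" for n
  define Q where "Q = (\<lambda>n s E. \<exists>S\<subseteq>{..<n}. card S = s \<and>
      \<kappa> * (p n * real n) * (real s - 1) \<le> real (card (E \<inter> edges_on S)))"
  have "aas p (\<lambda>n E. \<forall>s\<in>I n. \<not> Q n s E)"
  proof (rule aas_by_sizes[where q = "\<lambda>_. exp (- 1)" and C = "\<lambda>n. exp (1 - ln (real n))", OF p])
    have "exp (- 1) \<le> 1 / (2::real)" using exp_ge_add_one_self[of 1] by (simp add: exp_minus field_simps)
    then show "\<forall>\<^sub>F n in sequentially. 0 \<le> exp (- 1 :: real) \<and> exp (- 1) \<le> 1 / (2::real) \<and> 0 \<le> exp (1 - ln (real n))"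
      by simp
    show "(\<lambda>n. exp (1 - ln (real n)) * exp (- 1)) \<longlonglongrightarrow> 0" by real_asymp
    \<comment> \<open>With \<open>M = (s - 1) L\<close> the surplus is at least
      \<open>18 M / 2 = 9 M\<close>: the entropy takes \<open>5 M\<close> by \<open>e3\<close>, and
      \<open>ln n + s \<le> 4 M + 1\<close> by \<open>e4\<close> to \<open>e6\<close>.\<close>
    have "\<forall>\<^sub>F n in sequentially. 18 / (\<tau> * \<kappa>) \<le> p n * real n"
      using pn by (simp add: filterlim_at_top)
    then show "\<forall>\<^sub>F n in sequentially. \<forall>s\<in>I n. bin_prob (all_edges n) (p n) (Q n s)
        \<le> exp (1 - ln (real n)) * exp (- 1) ^ s"
    proof eventually_elim
      case (elim n)
      define c where "c = p n * real n"
      have c: "18 \<le> \<tau> * \<kappa> * c" using elim \<kappa> \<tau> by (simp add: c_def field_simps)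
      have c0: "0 \<le> c" using p by (simp add: c_def)
      show ?case
      proof
        fix s assume "s \<in> I n"
        then have s: "2 \<le> s" "s \<le> n" "real s \<le> \<sigma>\<^sub>0 * real n" by (auto simp: I_def)
        define L where "L = ln (real n / real s)"
        define z where "z = sqrt (real n / real s)"
        define u where "u = real s / real n"
        have n0: "real n > 0" using s by simp
        have z1: "1 \<le> z" using s by (simp add: z_def)
        have lnz: "ln z = L / 2" using s by (simp add: z_def L_def ln_sqrt)
        have u: "0 < u" "u \<le> \<sigma>\<^sub>0" using s n0 by (auto simp: u_def field_simps)
        have uL: "ln (1 / u) = L" by (simp add: u_def L_def)
        have "2 \<le> real n / real s"
        proof -
          have "2 * u \<le> 1" using u(2) \<sigma> by simp
          then show ?thesis using s n0 by (simp add: u_def field_simps)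
        qed
        then have "ln 2 \<le> L" unfolding L_def by simp
        then have L: "2 / 3 \<le> L" using ln2_ge_two_thirds by linarith
        have LL: "L = ln (real n) - ln (real s)" using s by (simp add: L_def ln_div)
        have zu: "z * u = sqrt u"
        proof -
          have "z = 1 / sqrt u" by (simp add: z_def u_def real_sqrt_divide)
          then show ?thesis using u by (simp add: real_div_sqrt)
        qed
        have "(z - 1) * p n * (real s * (real s - 1) / 2) = c / 2 * (real s - 1) * ((z - 1) * u)"
          using n0 by (simp add: c_def u_def field_simps)
        also have "(z - 1) * u = sqrt u - u" using zu by (simp add: left_diff_distrib)
        also have "c / 2 * (real s - 1) * (sqrt u - u) \<le> c / 2 * (real s - 1) * ((1 - \<tau>) * \<kappa> * L)"
          using conv[OF u] c0 s uL by (intro mult_left_mono) auto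
        finally have e1: "(z - 1) * p n * (real s * (real s - 1) / 2) \<le> c / 2 * (real s - 1) * ((1 - \<tau>) * \<kappa> * L)" .
        define M where "M = (real s - 1) * L"
        have sL: "0 \<le> M" unfolding M_def using s L by simp
        have e2: "18 * M \<le> (\<tau> * \<kappa> * c) * M"
          using c sL by (intro mult_right_mono) auto
        have "real s * (1 + L) \<le> (2 * (real s - 1)) * (5 / 2 * L)"
          using s L by (intro mult_mono) auto
        then have e3: "real s * (1 + L) \<le> 5 * M" by (simp add: M_def algebra_simps)
        have "1 * L \<le> (real s - 1) * L" using s L by (intro mult_right_mono) auto
        then have e4: "L \<le> M" by (simp add: M_def)
        have "(real s - 1) * (2 / 3) \<le> (real s - 1) * L" using s L by (intro mult_left_mono) auto
        then have e5: "2 / 3 * real s - 2 / 3 \<le> M" by (simp add: M_def)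
        have e6: "ln (real s) \<le> real s - 1" using s by (intro ln_le_minus_one) auto
        have "bin_prob (all_edges n) (p n) (Q n s)
            \<le> exp (real s * (1 + L) + ((z - 1) * p n * (real s * (real s - 1) / 2) - (\<kappa> * c * (real s - 1)) * ln z))"
          using bin_prob_dense_set[of "p n" s n z "\<kappa> * c * (real s - 1)"] p s z1
          unfolding Q_def L_def c_def by auto
        also have "\<dots> \<le> exp (1 - ln (real n) - real s)"
          unfolding exp_le_cancel_iff
        proof -
          have "c / 2 * (real s - 1) * ((1 - \<tau>) * \<kappa> * L) - (\<kappa> * c * (real s - 1)) * ln z
              = - ((\<tau> * \<kappa> * c) * M) / 2"
            unfolding lnz M_def by (simp add: field_simps)
          then show "real s * (1 + L) + ((z - 1) * p n * (real s * (real s - 1) / 2) - (\<kappa> * c * (real s - 1)) * ln z)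
              \<le> 1 - ln (real n) - real s"
            using e1 e2 e3 e4 e5 e6 LL by linarith
        qed
        also have "\<dots> = exp (1 - ln (real n)) * exp (- 1) ^ s"
          by (simp flip: exp_of_nat_mult exp_add)
        finally show "bin_prob (all_edges n) (p n) (Q n s) \<le> exp (1 - ln (real n)) * exp (- 1) ^ s" .
      qed
    qed
  qed (auto simp: I_def)
  then show ?thesis
  proof (rule aas_mono[OF p _ always_eventually[OF allI]], intro allI impI)
    fix n E S assume E: "E \<subseteq> all_edges n" "\<forall>s\<in>I n. \<not> Q n s E"
      and S: "S \<subseteq> {..<n}" "2 \<le> card S \<and> real (card S) \<le> \<sigma>\<^sub>0 * real n"
    have "card S \<le> n" using S card_mono[of "{..<n}" S] by simp
    then have "card S \<in> I n" using S by (simp add: I_def)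
    then have "\<not> Q n (card S) E" using E by blast
    then show "real (card (E \<inter> edges_on S)) < \<kappa> * (p n * real n) * (real (card S) - 1)"
      using S by (auto simp: Q_def not_le)
  qed
qed

text \<open>At most half of the vertices touch at least \<open>3/4 t (n - 1)\<close> pairs. Per
  vertex of \<open>T\<close>, the lower tail at \<open>0.51 d\<close> gains
  \<open>3 d / 8 - 0.51 d ln 2 > d / 50\<close>, and the condition on \<open>ln (n / t)\<close>
  limits the entropy to \<open>d / 100\<close>. The value \<open>0.51\<close> leaves room above the
  density, which is about \<open>d / 2\<close>.\<close>

lemma aas_well_touched:
  fixes p :: "nat \<Rightarrow> real"
  assumes p: "\<And>n. 0 \<le> p n \<and> p n \<le> 1"
    and pn: "filterlim (\<lambda>n. p n * (real n - 1)) at_top sequentially"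
  shows "aas p (\<lambda>n E. \<forall>T\<subseteq>{..<n}. T \<noteq> {} \<and> 2 * card T \<le> n
      \<and> 1 + ln (real n / real (card T)) \<le> p n * (real n - 1) / 100 \<longrightarrow>
      51 / 100 * (p n * (real n - 1)) * real (card T) < real (card (E \<inter> touching n T)))"
proof -
  define d where "d = (\<lambda>n. p n * (real n - 1))"
  define I where "I n = {t \<in> {1..n}. 2 * t \<le> n \<and> 1 + ln (real n / real t) \<le> d n / 100}" for n
  define Q where "Q = (\<lambda>n t E. \<exists>T\<subseteq>{..<n}. card T = t \<and>
      real (card (E \<inter> touching n T)) \<le> 51 / 100 * d n * real t)"
  have dlim: "filterlim d at_top sequentially" using pn by (simp add: d_def)
  have "((\<lambda>x::real. exp (- (x / 100))) \<longlongrightarrow> 0) at_top" by real_asymp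
  then have q0: "(\<lambda>n. exp (- (d n / 100))) \<longlonglongrightarrow> 0" using dlim by (rule filterlim_compose)
  have "aas p (\<lambda>n E. \<forall>s\<in>I n. \<not> Q n s E)"
  proof (rule aas_by_sizes[where q = "\<lambda>n. exp (- (d n / 100))" and C = "\<lambda>_. 1", OF p])
    have "\<forall>\<^sub>F n in sequentially. exp (- (d n / 100)) < 1 / 2" using order_tendstoD(2)[OF q0, of "1 / 2"] by simp
    then show "\<forall>\<^sub>F n in sequentially. 0 \<le> exp (- (d n / 100)) \<and> exp (- (d n / 100)) \<le> 1 / 2 \<and> 0 \<le> (1::real)"
      by eventually_elim simp
    have "\<forall>\<^sub>F n in sequentially. 0 \<le> d n" using dlim by (simp add: filterlim_at_top)
    then show "\<forall>\<^sub>F n in sequentially. \<forall>t\<in>I n. bin_prob (all_edges n) (p n) (Q n t) \<le> 1 * exp (- (d n / 100)) ^ t"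
    proof eventually_elim
      case (elim n)
      show ?case
      proof
        fix t assume "t \<in> I n"
        then have t: "1 \<le> t" "2 * t \<le> n" "1 + ln (real n / real t) \<le> d n / 100" by (auto simp: I_def)
        have two_t: "2 * real t \<le> real n" using t(2) by linarith
        have dt: "0 \<le> d n * real t" using elim by simp
        have "p n * real t * (3 / 4 * (real n - 1)) \<le> p n * real t * ((real n - 1) - (real t - 1) / 2)"
        proof (rule mult_left_mono)
          show "3 / 4 * (real n - 1) \<le> (real n - 1) - (real t - 1) / 2" using two_t by (simp add: diff_divide_distrib)
        qed (use p in auto)
        then have e1: "3 / 4 * (d n * real t) \<le> p n * (real t * (real n - 1) - real t * (real t - 1) / 2)"
          by (simp add: d_def field_simps)
        have e2: "real t * (1 + ln (real n / real t)) \<le> real t * (d n / 100)"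
          using t by (intro mult_left_mono) auto
        have e3: "(d n * real t) * ln 2 \<le> (d n * real t) * (25 / 36)"
          using dt ln2_le_25_over_36 by (intro mult_left_mono) auto
        have "bin_prob (all_edges n) (p n) (Q n t)
          \<le> exp (real t * (1 + ln (real n / real t))
            + (51 / 100 * d n * real t * ln 2 - p n * (real t * (real n - 1) - real t * (real t - 1) / 2) / 2))"
          unfolding Q_def using p t by (intro bin_prob_weakly_touched_set) auto
        also have "\<dots> \<le> exp (real t * (- (d n / 100)))"
          unfolding exp_le_cancel_iff using e1 e2 e3 dt by (simp add: algebra_simps)
        also have "\<dots> = exp (- (d n / 100)) ^ t" by (rule exp_of_nat_mult)
        finally show "bin_prob (all_edges n) (p n) (Q n t) \<le> 1 * exp (- (d n / 100)) ^ t" by simp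
      qed
    qed
  qed (use q0 in \<open>auto simp: I_def\<close>)
  then show ?thesis
  proof (rule aas_mono[OF p _ always_eventually[OF allI]], intro allI impI)
    fix n E T assume E: "E \<subseteq> all_edges n" "\<forall>s\<in>I n. \<not> Q n s E"
      and T: "T \<subseteq> {..<n}" "T \<noteq> {} \<and> 2 * card T \<le> n \<and> 1 + ln (real n / real (card T)) \<le> p n * (real n - 1) / 100"
    have "finite T" using T finite_subset by blast
    then have "card T \<in> I n" using T by (auto simp: I_def d_def Suc_le_eq card_gt_0_iff)
    then have "\<not> Q n (card T) E" using E by blast
    then show "51 / 100 * (p n * (real n - 1)) * real (card T) < real (card (E \<inter> touching n T))"
      using T by (auto simp: Q_def not_le d_def)
  qed
qed

section \<open>Arboricity of sparse random graphs\<close>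

lemma le_mult_pred_iff_real:
  assumes "1 \<le> s"
  shows "m \<le> k * (s - 1) \<longleftrightarrow> real m \<le> real k * (real s - 1)"
proof -
  have "real k * (real s - 1) = real (k * (s - 1))" using assms by (simp add: of_nat_diff)
  then show ?thesis by (simp only: of_nat_le_iff)
qed

lemma arboricity_le_iff_gnp:
  assumes "E \<subseteq> all_edges n"
  shows "arboricity E \<le> k \<longleftrightarrow>
    (\<forall>S\<subseteq>{..<n}. S \<noteq> {} \<longrightarrow> card (E \<inter> edges_on S) \<le> k * (card S - 1))"
  using assms by (intro arboricity_le_iff) (auto simp: all_edges_eq)

lemma card_le_arboricity:
  assumes "E \<subseteq> all_edges n" "S \<subseteq> {..<n}" "S \<noteq> {}"
  shows "card (E \<inter> edges_on S) \<le> arboricity E * (card S - 1)"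
  using assms arboricity_le_iff_gnp[OF assms(1), of "arboricity E"] by simp

lemma arboricity_mono:
  assumes "E' \<subseteq> E" "E \<subseteq> all_edges n"
  shows "arboricity E' \<le> arboricity E"
proof -
  have "card (E' \<inter> edges_on S) \<le> card (E \<inter> edges_on S)" for S
    using assms finite_subset[OF assms(2)] by (intro card_mono) auto
  then have "card (E' \<inter> edges_on S) \<le> arboricity E * (card S - 1)" if "S \<subseteq> {..<n}" "S \<noteq> {}" for S
    using card_le_arboricity[OF assms(2) that] le_trans by blast
  moreover have "E' \<subseteq> all_edges n" using assms by blast
  ultimately show ?thesis by (simp add: arboricity_le_iff_gnp)
qed

lemma arboricity_le_ceiling:
  assumes E: "E \<subseteq> all_edges n" and "0 \<le> x"
    and dense: "\<And>S. S \<subseteq> {..<n} \<Longrightarrow> 2 \<le> card S \<Longrightarrow> real (card (E \<inter> edges_on S)) \<le> x * (real (card S) - 1)"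
  shows "int (arboricity E) \<le> \<lceil>x\<rceil>"
proof -
  define k where "k = nat \<lceil>x\<rceil>"
  have xk: "x \<le> real k" and k: "int k = \<lceil>x\<rceil>" using assms(2) by (auto simp: k_def)
  have "card (E \<inter> edges_on S) \<le> k * (card S - 1)" if S: "S \<subseteq> {..<n}" "S \<noteq> {}" for S
  proof (cases "card S \<le> 1")
    case True
    then show ?thesis using edges_on_small[of S] S finite_subset by fastforce
  next
    case False
    then have "real (card (E \<inter> edges_on S)) \<le> x * (real (card S) - 1)" using dense S by simp
    also have "\<dots> \<le> real k * (real (card S) - 1)" using xk False by (intro mult_right_mono) auto
    finally show ?thesis using False by (subst le_mult_pred_iff_real) auto
  qed
  then have "arboricity E \<le> k" using arboricity_le_iff_gnp[OF E] by blast
  then show ?thesis using k by simp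
qed

text \<open>The density condition for the whole vertex set. This bound is deterministic, so only
  upper bounds remain to be proved for dense random graphs.\<close>

lemma ceiling_density_le_arboricity:
  assumes E: "E \<subseteq> all_edges n" and n: "n \<ge> 2"
  shows "\<lceil>real (card E) / (real n - 1)\<rceil> \<le> int (arboricity E)"
proof -
  have "card (E \<inter> edges_on {..<n}) \<le> arboricity E * (card {..<n} - 1)"
    using n by (intro card_le_arboricity[OF E]) (auto simp: lessThan_empty_iff)
  moreover have "E \<inter> edges_on {..<n} = E" using E by (auto simp: all_edges_eq)
  ultimately have "card E \<le> arboricity E * (n - 1)" by simp
  then have "real (card E) \<le> real (arboricity E) * (real n - 1)"
    using n by (subst (asm) le_mult_pred_iff_real) auto
  then have "real (card E) / (real n - 1) \<le> real (arboricity E)" using n by (simp add: field_simps)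
  then show ?thesis by (simp add: ceiling_le_iff)
qed

lemma aas_arboricity_le_1:
  assumes p: "\<And>n. 0 \<le> p n \<and> p n \<le> 1" and pn: "(\<lambda>n. p n * real n) \<longlonglongrightarrow> 0"
  shows "aas p (\<lambda>n E. arboricity E \<le> 1)"
  by (rule aas_mono[OF p aas_acyclic[OF assms]]) (simp add: arboricity_le_iff_gnp)

lemma filterlim_pn2:
  assumes "a > 0" "\<forall>\<^sub>F n in sequentially. a / real n \<le> p n"
  shows "filterlim (\<lambda>n. p n * real n ^ 2) at_top sequentially"
proof -
  have "filterlim (\<lambda>n. a * real n) at_top sequentially"
    using assms(1) by (intro filterlim_tendsto_pos_mult_at_top[OF tendsto_const _ filterlim_real_sequentially])
  then show ?thesis
  proof (rule filterlim_at_top_mono)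
    show "\<forall>\<^sub>F n in sequentially. a * real n \<le> p n * real n ^ 2"
      using assms(2) eventually_gt_at_top[of 0]
    proof eventually_elim
      case (elim n)
      then have "a \<le> p n * real n" by (simp add: field_simps)
      then have "a * real n \<le> p n * real n * real n" by (intro mult_right_mono) auto
      then show ?case by (simp add: power2_eq_square mult.assoc)
    qed
  qed
qed

section \<open>Order of magnitude of the arboricity for \<open>p\<close> of order
  \<open>1 / n\<close>\<close>

definition isolated :: "nat \<Rightarrow> nat set set \<Rightarrow> nat set" where
  "isolated n E = {v. v < n \<and> (\<forall>e\<in>E. v \<notin> e)}"

text \<open>All edges survive the deletion of the isolated vertices, so linearly many of them raise
  the density by a constant factor.\<close>

lemma card_le_arboricity_isolated:
  assumes E: "E \<subseteq> all_edges n"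
  shows "card E \<le> arboricity E * (n - card (isolated n E))"
proof -
  let ?S = "{..<n} - isolated n E"
  have sub: "E \<subseteq> edges_on ?S"
  proof
    fix e assume "e \<in> E"
    then have "e \<subseteq> {..<n}" "card e = 2" using E by (auto simp: all_edges_eq edges_on_alt)
    moreover have "e \<inter> isolated n E = {}" using \<open>e \<in> E\<close> by (auto simp: isolated_def)
    ultimately show "e \<in> edges_on ?S" by (auto simp: edges_on_alt)
  qed
  have card: "card ?S = n - card (isolated n E)"
    by (subst card_Diff_subset) (auto simp: isolated_def)
  show ?thesis
  proof (cases "?S = {}")
    case True
    then have "E = {}" using sub by (auto simp: edges_on_def)
    then show ?thesis by simp
  next
    case False
    have "card E = card (E \<inter> edges_on ?S)" using sub by (simp add: Int_absorb2)
    also have "\<dots> \<le> arboricity E * (card ?S - 1)" using False by (intro card_le_arboricity[OF E]) auto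
    also have "\<dots> \<le> arboricity E * card ?S" by simp
    finally show ?thesis using card by simp
  qed
qed

lemma isolated_iff:
  assumes "E \<subseteq> all_edges n"
  shows "v \<in> isolated n E \<longleftrightarrow> v < n \<and> card (E \<inter> touching n {v}) = 0"
proof -
  have fin: "finite E" using assms finite_all_edges finite_subset by blast
  have "e \<in> touching n {v} \<longleftrightarrow> v \<in> e" if "e \<in> E" for e
    using that assms by (auto simp: touching_def all_edges_eq edges_on_alt)
  then have "E \<inter> touching n {v} = {} \<longleftrightarrow> (\<forall>e\<in>E. v \<notin> e)" by auto
  then show ?thesis using fin by (simp add: isolated_def)
qed

lemma bin_expect_isolated:
  "bin_expect (all_edges n) p (\<lambda>E. real (card (isolated n E))) = real n * (1 - p) ^ (n - 1)"
proof -
  \<comment> \<open>Since \<open>0 ^ 0 = 1\<close>, the indicator of degree 0 is an exponential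
    moment with \<open>z = 0\<close>.\<close>
  have "bin_expect (all_edges n) p (\<lambda>E. real (card (isolated n E)))
      = bin_expect (all_edges n) p (\<lambda>E. \<Sum>v<n. of_bool ({} \<subseteq> E) * 0 ^ card (E \<inter> touching n {v}))"
  proof (rule bin_expect_cong)
    fix E assume E: "E \<subseteq> all_edges n"
    have "isolated n E = {v \<in> {..<n}. card (E \<inter> touching n {v}) = 0}"
      using isolated_iff[OF E] by auto
    then show "real (card (isolated n E)) = (\<Sum>v<n. of_bool ({} \<subseteq> E) * 0 ^ card (E \<inter> touching n {v}))"
      by (simp add: power_0_left sum.If_cases Int_def)
  qed
  also have "\<dots> = (\<Sum>v<n. (1 - p) ^ (n - 1))"
    unfolding bin_expect_sum
  proof (rule sum.cong)
    fix v assume v: "v \<in> {..<n}"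
    then have "real (card (touching n {v})) = real n - 1" by (subst real_card_touching) auto
    then have c: "card (touching n {v}) = n - 1" using v by (auto simp: of_nat_diff)
    have "touching n {v} \<subseteq> all_edges n" by (auto simp: touching_def)
    then show "bin_expect (all_edges n) p (\<lambda>E. of_bool ({} \<subseteq> E) * 0 ^ card (E \<inter> touching n {v})) = (1 - p) ^ (n - 1)"
      by (subst bin_expect_mgf) (auto simp: c)
  qed simp
  finally show ?thesis by simp
qed

lemma isolated_lipschitz:
  assumes "E \<subseteq> all_edges n" "a \<in> all_edges n - E"
  shows "\<bar>real (card (isolated n (insert a E))) - real (card (isolated n E))\<bar> \<le> 2"
proof -
  have fin: "finite (isolated n E)" by (auto simp: isolated_def)
  have a: "card a = 2" using assms by (auto simp: all_edges_eq edges_on_alt)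
  have eq: "isolated n (insert a E) = isolated n E - a" by (auto simp: isolated_def)
  have "card (isolated n E) \<le> card (isolated n E - a) + card a"
    using diff_card_le_card_Diff[of a "isolated n E"] a card_ge_0_finite[of a] by linarith
  moreover have "card (isolated n E - a) \<le> card (isolated n E)" using fin by (intro card_mono) auto
  ultimately show ?thesis unfolding eq using a by linarith
qed

text \<open>For \<open>p \<le> 1/2\<close> one has \<open>1 - p \<ge> exp (- 2 p)\<close>, so the
  mean is at least \<open>exp (- 2 b) n\<close>, twice the stated bound. One edge changes the count
  by at most 2, which makes the variance linear in \<open>n\<close> and the failure probability of
  order \<open>1 / n\<close>.\<close>

lemma aas_many_isolated:
  assumes p: "\<And>n. 0 \<le> p n \<and> p n \<le> 1" and b: "b > 0"
    and pb: "\<forall>\<^sub>F n in sequentially. p n \<le> b / real n"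
  shows "aas p (\<lambda>n E. exp (- 2 * b) / 2 * real n < real (card (isolated n E)))"
proof (rule aasI[OF p])
  let ?\<gamma> = "exp (- 2 * b) / 2"
  have "(\<lambda>n. 2 * b / ?\<gamma>\<^sup>2 * (1 / real n)) \<longlonglongrightarrow> 0"
    by (intro tendsto_mult_right_zero lim_1_over_n)
  then show "(\<lambda>n. 2 * b / ?\<gamma>\<^sup>2 / real n) \<longlonglongrightarrow> 0" by simp
  have "\<forall>\<^sub>F n in sequentially. real n \<ge> 2 * b" using filterlim_real_sequentially by (simp add: filterlim_at_top)
  then show "\<forall>\<^sub>F n in sequentially. bin_prob (all_edges n) (p n)
      (\<lambda>E. \<not> ?\<gamma> * real n < real (card (isolated n E))) \<le> 2 * b / ?\<gamma>\<^sup>2 / real n"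
    using pb eventually_gt_at_top[of 0]
  proof eventually_elim
    case (elim n)
    let ?\<mu> = "bin_expect (all_edges n) (p n) (\<lambda>E. real (card (isolated n E)))"
    have "b / real n \<le> 1 / 2" using elim by (simp add: field_simps)
    then have ph: "0 \<le> p n" "p n \<le> 1 / 2" using p[of n] elim(2) by linarith+
    have "- 2 * p n \<le> ln (1 - p n)"
    proof -
      have "p n * p n \<le> p n * (1 / 2)" using ph by (intro mult_left_mono) auto
      then show ?thesis using ln_one_minus_pos_lower_bound[OF ph] by (simp add: power2_eq_square)
    qed
    then have "exp (- 2 * p n) \<le> 1 - p n" using ph by (simp add: ln_ge_iff)
    then have "exp (- 2 * p n) ^ (n - 1) \<le> (1 - p n) ^ (n - 1)" by (intro power_mono) auto
    moreover have "exp (- 2 * b) \<le> exp (- 2 * p n) ^ (n - 1)"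
    proof -
      have "real (n - 1) * p n \<le> real n * (b / real n)" using elim b p by (intro mult_mono) auto
      then have "- 2 * b \<le> real (n - 1) * (- 2 * p n)" using elim by simp
      then show ?thesis by (simp flip: exp_of_nat_mult)
    qed
    ultimately have "real n * exp (- 2 * b) \<le> real n * (1 - p n) ^ (n - 1)"
      by (intro mult_left_mono) auto
    then have \<mu>: "2 * (?\<gamma> * real n) \<le> ?\<mu>" by (simp add: bin_expect_isolated mult.commute)
    have "bin_prob (all_edges n) (p n) (\<lambda>E. \<not> ?\<gamma> * real n < real (card (isolated n E)))
        \<le> bin_prob (all_edges n) (p n) (\<lambda>E. ?\<gamma> * real n \<le> \<bar>real (card (isolated n E)) - ?\<mu>\<bar>)"
      using p \<mu> by (intro bin_prob_mono) auto
    also have "\<dots> \<le> 2\<^sup>2 * p n * real (card (all_edges n)) / (?\<gamma> * real n)\<^sup>2"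
      using p elim isolated_lipschitz by (intro bin_chebyshev) auto
    also have "\<dots> \<le> 2\<^sup>2 * (b / real n) * (real n * real n / 2) / (?\<gamma> * real n)\<^sup>2"
      unfolding real_card_all_edges using p elim b
      by (intro divide_right_mono mult_mono mult_left_mono) auto
    also have "\<dots> = 2 * b / ?\<gamma>\<^sup>2 / real n" using elim by (simp add: power2_eq_square field_simps)
    finally show ?case .
  qed
qed

lemma aas_arboricity_Theta:
  assumes p: "\<And>n. 0 \<le> p n \<and> p n \<le> 1" and ab: "0 < a" "a \<le> b"
    and pab: "\<forall>\<^sub>F n in sequentially. a / real n \<le> p n \<and> p n \<le> b / real n"
  shows "\<exists>c1 c2::real. 0 < c1 \<and> c1 \<le> c2 \<and>
      aas p (\<lambda>n E. (1 + c1) * p n * real n / 2 \<le> real (arboricity E) \<and>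
                   real (arboricity E) \<le> (1 + c2) * p n * real n / 2)"
proof -
  have b: "b > 0" using ab by simp
  have pa: "\<forall>\<^sub>F n in sequentially. a / real n \<le> p n" and pb: "\<forall>\<^sub>F n in sequentially. p n \<le> b / real n"
    using pab by (auto elim: eventually_mono)
  have pn2: "filterlim (\<lambda>n. p n * real n ^ 2) at_top sequentially"
    by (rule filterlim_pn2[OF ab(1) pa])
  obtain \<delta> where \<delta>: "\<delta> > 0" "\<delta> \<le> 1"
    and sparse: "aas p (\<lambda>n E. \<forall>S\<subseteq>{..<n}. S \<noteq> {} \<and> real (card S) \<le> \<delta> * real n \<longrightarrow>
           card (E \<inter> edges_on S) \<le> 2 * (card S - 1))"
    using aas_small_sets_sparse[OF p b pb] by blast
  define \<gamma> where "\<gamma> = exp (- 2 * b) / 2"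
  have "exp (- 2 * b) \<le> 1" using b by simp
  then have \<gamma>: "0 < \<gamma>" "\<gamma> < 1" unfolding \<gamma>_def by (simp, linarith)
  \<comment> \<open>The 2 serves sets of size at most \<open>\<delta> n\<close>. A larger set spans
    at most all \<open>b n\<close> edges and satisfies
    \<open>card S - 1 \<ge> \<delta> n / 2\<close>, whence \<open>2 b / \<delta>\<close>.\<close>
  define x where "x = 2 + 2 * b / \<delta>"
  have x: "2 \<le> x" "2 * b / \<delta> \<le> x" using b \<delta> by (auto simp: x_def)
  \<comment> \<open>At least \<open>(1 - \<gamma> / 2) p n\<cdot>n / 2\<close> edges on at most
    \<open>(1 - \<gamma>) n\<close> vertices, and
    \<open>(1 - \<gamma>) (1 + \<gamma> / 2) \<le> 1 - \<gamma> / 2\<close>.\<close>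
  define c1 where "c1 = \<gamma> / 2"
  \<comment> \<open>The arboricity is at most the constant \<open>x + 1\<close>; as
    \<open>a \<le> p n\<close>, this is at most \<open>2 (x + 1) / a\<close> times
    \<open>p n / 2\<close>. Adding \<open>c1\<close> ensures \<open>c1 \<le> c2\<close>.\<close>
  define c2 where "c2 = c1 + 2 * (x + 1) / a"
  have ax: "0 \<le> 2 * (x + 1) / a" using x ab by simp
  have "aas p (\<lambda>n E. (\<gamma> * real n < real (card (isolated n E)) \<and>
      \<bar>real (card E) - p n * real n ^ 2 / 2\<bar> < \<gamma> / 4 * (p n * real n ^ 2)) \<and>
      (\<forall>S\<subseteq>{..<n}. S \<noteq> {} \<and> real (card S) \<le> \<delta> * real n \<longrightarrow> card (E \<inter> edges_on S) \<le> 2 * (card S - 1)))"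
    unfolding \<gamma>_def using b
    by (intro aas_conj[OF p] sparse aas_many_isolated[OF p b pb] aas_card_approx[OF p pn2]) auto
  then have "aas p (\<lambda>n E. (1 + c1) * p n * real n / 2 \<le> real (arboricity E) \<and>
      real (arboricity E) \<le> (1 + c2) * p n * real n / 2)"
  proof (rule aas_mono[OF p])
    show "\<forall>\<^sub>F n in sequentially. \<forall>E\<subseteq>all_edges n.
       (\<gamma> * real n < real (card (isolated n E)) \<and>
        \<bar>real (card E) - p n * real n ^ 2 / 2\<bar> < \<gamma> / 4 * (p n * real n ^ 2)) \<and>
       (\<forall>S\<subseteq>{..<n}. S \<noteq> {} \<and> real (card S) \<le> \<delta> * real n \<longrightarrow> card (E \<inter> edges_on S) \<le> 2 * (card S - 1)) \<longrightarrow>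
       (1 + c1) * p n * real n / 2 \<le> real (arboricity E) \<and> real (arboricity E) \<le> (1 + c2) * p n * real n / 2"
      using pa pb eventually_gt_at_top[of 0]
    proof eventually_elim
      case (elim n)
      define c where "c = p n * real n"
      have c: "a \<le> c" "c \<le> b" using elim by (auto simp: c_def field_simps)
      have cn: "p n * real n ^ 2 = c * real n" by (simp add: c_def power2_eq_square)
      have cn0: "0 < c * real n" using c ab elim by simp
      show ?case
      proof (intro allI impI)
        fix E assume E: "E \<subseteq> all_edges n" and H: "(\<gamma> * real n < real (card (isolated n E)) \<and>
          \<bar>real (card E) - p n * real n ^ 2 / 2\<bar> < \<gamma> / 4 * (p n * real n ^ 2)) \<and>
          (\<forall>S\<subseteq>{..<n}. S \<noteq> {} \<and> real (card S) \<le> \<delta> * real n \<longrightarrow> card (E \<inter> edges_on S) \<le> 2 * (card S - 1))"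
        have "\<bar>real (card E) - p n * real n ^ 2 / 2\<bar> < \<gamma> / 4 * (p n * real n ^ 2)" using H by blast
        then have m: "c * real n / 2 - \<gamma> / 4 * (c * real n) < real (card E)"
          "real (card E) < c * real n / 2 + \<gamma> / 4 * (c * real n)"
          unfolding cn abs_less_iff by linarith+
        have iso: "\<gamma> * real n < real (card (isolated n E))" using H by blast
        have "card (isolated n E) \<le> card {..<n}" by (intro card_mono) (auto simp: isolated_def)
        then have "real (n - card (isolated n E)) \<le> real n - \<gamma> * real n" using iso by (simp add: of_nat_diff)
        then have "real (arboricity E) * real (n - card (isolated n E)) \<le> real (arboricity E) * ((1 - \<gamma>) * real n)"
          by (intro mult_left_mono) (auto simp: left_diff_distrib)
        moreover have "real (card E) \<le> real (arboricity E) * real (n - card (isolated n E))"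
          using card_le_arboricity_isolated[OF E] by (metis of_nat_le_iff of_nat_mult)
        ultimately have "c * real n / 2 - \<gamma> / 4 * (c * real n) \<le> real (arboricity E) * ((1 - \<gamma>) * real n)"
          using m(1) by linarith
        then have "(c / 2 * (1 - \<gamma> / 2)) * real n \<le> (real (arboricity E) * (1 - \<gamma>)) * real n"
          by (simp add: algebra_simps)
        then have "c / 2 * (1 - \<gamma> / 2) \<le> real (arboricity E) * (1 - \<gamma>)"
          by (rule mult_right_le_imp_le) (use elim in simp)
        moreover have "(1 - \<gamma>) * (1 + c1) \<le> 1 - \<gamma> / 2" by (simp add: c1_def algebra_simps)
        then have "c / 2 * ((1 - \<gamma>) * (1 + c1)) \<le> c / 2 * (1 - \<gamma> / 2)" using c ab by (intro mult_left_mono) auto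
        moreover have "(c / 2 * (1 + c1)) * (1 - \<gamma>) = c / 2 * ((1 - \<gamma>) * (1 + c1))" by (simp only: mult_ac)
        ultimately have "(c / 2 * (1 + c1)) * (1 - \<gamma>) \<le> real (arboricity E) * (1 - \<gamma>)" by linarith
        then have "c / 2 * (1 + c1) \<le> real (arboricity E)" using \<gamma> by simp
        then have lower: "(1 + c1) * p n * real n / 2 \<le> real (arboricity E)" by (simp add: c_def mult_ac)
        have "int (arboricity E) \<le> \<lceil>x\<rceil>"
        proof (rule arboricity_le_ceiling[OF E])
          fix S assume S: "S \<subseteq> {..<n}" "2 \<le> card S"
          show "real (card (E \<inter> edges_on S)) \<le> x * (real (card S) - 1)"
          proof (cases "real (card S) \<le> \<delta> * real n")
            case True
            moreover have "S \<noteq> {}" using S by auto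
            ultimately have "card (E \<inter> edges_on S) \<le> 2 * (card S - 1)" using H S by blast
            then have "real (card (E \<inter> edges_on S)) \<le> 2 * (real (card S) - 1)"
              using S by (subst (asm) le_mult_pred_iff_real) auto
            also have "\<dots> \<le> x * (real (card S) - 1)" using x S by (intro mult_right_mono) auto
            finally show ?thesis .
          next
            case False
            have "finite E" using E finite_all_edges finite_subset by blast
            then have "real (card (E \<inter> edges_on S)) \<le> real (card E)" by (simp add: card_mono)
            also have "\<dots> \<le> c * real n"
            proof -
              have "\<gamma> * (c * real n) \<le> 1 * (c * real n)" using \<gamma> cn0 by (intro mult_right_mono) auto
              then show ?thesis using m(2) cn0 by linarith
            qed
            also have "\<dots> \<le> b * real n" using c by (intro mult_right_mono) auto
            also have "\<dots> = b / \<delta> * (\<delta> * real n)" using \<delta> by simp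
            also have "\<dots> \<le> b / \<delta> * (2 * (real (card S) - 1))"
              using False S b \<delta> by (intro mult_left_mono) auto
            also have "\<dots> = 2 * b / \<delta> * (real (card S) - 1)" by simp
            also have "\<dots> \<le> x * (real (card S) - 1)" using x S by (intro mult_right_mono) auto
            finally show ?thesis .
          qed
        qed (use x in simp)
        then have "real (arboricity E) \<le> x + 1" by linarith
        also have "\<dots> = (2 * (x + 1) / a) * (a / 2)" using ab by simp
        also have "\<dots> \<le> (1 + c2) * (c / 2)"
          using ax c ab \<gamma> by (intro mult_mono) (auto simp: c2_def c1_def)
        finally have "real (arboricity E) \<le> (1 + c2) * p n * real n / 2" by (simp add: c_def mult_ac)
        with lower show "(1 + c1) * p n * real n / 2 \<le> real (arboricity E) \<and>
            real (arboricity E) \<le> (1 + c2) * p n * real n / 2" by blast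
      qed
    qed
  qed
  moreover have "0 < c1" "c1 \<le> c2" using \<gamma> ax by (auto simp: c1_def c2_def)
  ultimately show ?thesis by blast
qed

section \<open>Two-point concentration for \<open>p\<close> of order \<open>1 / n\<close>\<close>

definition deletion_distance :: "nat \<Rightarrow> nat set set \<Rightarrow> nat" where
  "deletion_distance k E = (LEAST j. \<exists>Z\<subseteq>E. card Z = j \<and> arboricity (E - Z) \<le> k)"

lemma arboricity_empty: "arboricity {} = 0"
  using arboricity_le_iff_gnp[of "{}" 0 0] by simp

lemma deletion_distance_witness: "\<exists>Z\<subseteq>E. card Z = deletion_distance k E \<and> arboricity (E - Z) \<le> k"
proof -
  have "\<exists>Z\<subseteq>E. card Z = card E \<and> arboricity (E - Z) \<le> k" by (auto simp: arboricity_empty)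
  then show ?thesis
    unfolding deletion_distance_def by (rule LeastI[of "\<lambda>j. \<exists>Z\<subseteq>E. card Z = j \<and> arboricity (E - Z) \<le> k"])
qed

lemma deletion_distance_le: "Z \<subseteq> E \<Longrightarrow> arboricity (E - Z) \<le> k \<Longrightarrow> deletion_distance k E \<le> card Z"
  unfolding deletion_distance_def by (intro Least_le) auto

text \<open>Add \<open>a\<close> to a deletion set in one direction, drop it in the other. The
  arboricity itself is a.a.s. bounded here, so deviations of order \<open>sqrt n\<close> would say
  nothing about it, whereas the deletion distance is compared with a multiple of
  \<open>n\<close>.\<close>

lemma deletion_distance_lipschitz:
  assumes E: "E \<subseteq> all_edges n" and a: "a \<in> all_edges n - E"
  shows "\<bar>real (deletion_distance k (insert a E)) - real (deletion_distance k E)\<bar> \<le> 1"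
proof -
  have fin: "finite (insert a E)" using E finite_subset by (metis finite.insertI finite_all_edges)
  obtain Z where Z: "Z \<subseteq> E" "card Z = deletion_distance k E" "arboricity (E - Z) \<le> k"
    using deletion_distance_witness by blast
  have "insert a E - insert a Z = E - Z" using a by auto
  then have "deletion_distance k (insert a E) \<le> card (insert a Z)"
    using Z by (intro deletion_distance_le) auto
  also have "\<dots> \<le> card Z + 1" using fin Z by (metis Suc_eq_plus1 card_insert_le_m1 card_insert_if finite_insert finite_subset le_Suc_eq order_refl)
  finally have 1: "deletion_distance k (insert a E) \<le> deletion_distance k E + 1" using Z by simp
  obtain Z' where Z': "Z' \<subseteq> insert a E" "card Z' = deletion_distance k (insert a E)"
    "arboricity (insert a E - Z') \<le> k"
    using deletion_distance_witness by blast
  have "arboricity (E - (Z' - {a})) \<le> arboricity (insert a E - Z')"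
    using a E by (intro arboricity_mono[of _ _ n]) auto
  then have "deletion_distance k E \<le> card (Z' - {a})"
    using Z' by (intro deletion_distance_le) auto
  also have "\<dots> \<le> card Z'" using Z' fin by (intro card_mono) (auto dest: finite_subset)
  finally have 2: "deletion_distance k E \<le> deletion_distance k (insert a E)" using Z' by simp
  show ?thesis using 1 2 by linarith
qed

text \<open>If \<open>k\<close> forests cover \<open>G\<close> with probability not too small, then the number of edges to be deleted
  from \<open>G\<close> to make this true is a.a.s. below \<open>\<delta> n/2\<close> by concentration. Hence a set violating the
  Nash-Williams condition for \<open>k + 1\<close> has at most \<open>\<delta> n\<close> vertices, and such sets are too sparse.\<close>

lemma aas_arboricity_two_point:
  assumes p: "\<And>n. 0 \<le> p n \<and> p n \<le> 1" and ab: "0 < a" "a \<le> b"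
    and pab: "\<forall>\<^sub>F n in sequentially. a / real n \<le> p n \<and> p n \<le> b / real n"
  shows "\<exists>k :: nat \<Rightarrow> nat. (\<forall>n. 0 < k n) \<and> aas p (\<lambda>n E. arboricity E \<in> {k n, k n + 1})"
proof -
  have b: "b > 0" using ab by simp
  have pa: "\<forall>\<^sub>F n in sequentially. a / real n \<le> p n" and pb: "\<forall>\<^sub>F n in sequentially. p n \<le> b / real n"
    using pab by (auto elim: eventually_mono)
  have pn2: "filterlim (\<lambda>n. p n * real n ^ 2) at_top sequentially"
    by (rule filterlim_pn2[OF ab(1) pa])
  obtain \<delta> where \<delta>: "\<delta> > 0" "\<delta> \<le> 1"
    and sparse: "aas p (\<lambda>n E. \<forall>S\<subseteq>{..<n}. S \<noteq> {} \<and> real (card S) \<le> \<delta> * real n \<longrightarrow>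
           card (E \<inter> edges_on S) \<le> 2 * (card S - 1))"
    using aas_small_sets_sparse[OF p b pb] by blast
  define P where "P n k = bin_prob (all_edges n) (p n) (\<lambda>E. arboricity E \<le> k)" for n k
  \<comment> \<open>The level \<open>1 / sqrt n\<close> tends to 0, so values below
    \<open>k0\<close> are negligible, yet it is above the Chebyshev bound \<open>C / n\<close>, so
    the event at \<open>k0\<close> cannot be a large deviation.\<close>
  define k0 where "k0 n = (LEAST k. 1 / sqrt (real n) \<le> P n k)" for n
  \<comment> \<open>Besides positivity, the maximum yields \<open>k + 1 \<ge> 2\<close>, which
    covers the bound \<open>2 (card S - 1)\<close> for small sets.\<close>
  define k where "k n = max 1 (k0 n)" for n
  have k0: "1 / sqrt (real n) \<le> P n (k0 n)" if "n > 0" for n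
  proof -
    have "P n (arboricity (all_edges n)) = bin_expect (all_edges n) (p n) (\<lambda>_. 1)"
      unfolding P_def by (rule bin_expect_cong) (auto intro!: arboricity_mono[of _ "all_edges n" n])
    then have "1 / sqrt (real n) \<le> P n (arboricity (all_edges n))"
      using that by (simp add: bin_expect_const)
    then show ?thesis unfolding k0_def by (rule LeastI)
  qed
  have Pk: "1 / sqrt (real n) \<le> P n (k n)" if "n > 0" for n
  proof -
    have "P n (k0 n) \<le> P n (k n)" unfolding P_def using p by (intro bin_prob_mono) (auto simp: k_def)
    then show ?thesis using k0[OF that] by linarith
  qed
  have "aas p (\<lambda>n E. \<bar>real (card E) - p n * real n ^ 2 / 2\<bar> < 1 / 2 * (p n * real n ^ 2))"
    by (rule aas_card_approx[OF p pn2]) simp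
  then have nonempty: "aas p (\<lambda>n E. 0 < card E)"
  proof (rule aas_mono[OF p _ always_eventually[OF allI]], intro allI impI)
    fix n E assume "\<bar>real (card E) - p n * real n ^ 2 / 2\<bar> < 1 / 2 * (p n * real n ^ 2)"
    then have "0 < real (card E)" unfolding abs_less_iff by linarith
    then show "0 < card E" by simp
  qed
  have lower: "aas p (\<lambda>n E. k n \<le> arboricity E)"
  proof (rule aasI[OF p])
    let ?r = "\<lambda>n. 1 / sqrt (real n) + bin_prob (all_edges n) (p n) (\<lambda>E. \<not> 0 < card E)"
    have "(\<lambda>n. 1 / sqrt (real n)) \<longlonglongrightarrow> 0" by real_asymp
    then show "?r \<longlonglongrightarrow> 0" using tendsto_add[OF _ aasD[OF nonempty]] by fastforce
    show "\<forall>\<^sub>F n in sequentially. bin_prob (all_edges n) (p n) (\<lambda>E. \<not> k n \<le> arboricity E) \<le> ?r n"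
    proof (intro always_eventually allI)
      fix n
      have "bin_prob (all_edges n) (p n) (\<lambda>E. \<not> k n \<le> arboricity E)
          \<le> bin_prob (all_edges n) (p n) (\<lambda>E. (k0 n \<noteq> 0 \<and> arboricity E \<le> k0 n - 1) \<or> \<not> 0 < card E)"
      proof (rule bin_prob_mono)
        fix E assume E: "E \<subseteq> all_edges n" and lt: "\<not> k n \<le> arboricity E"
        show "(k0 n \<noteq> 0 \<and> arboricity E \<le> k0 n - 1) \<or> \<not> 0 < card E"
        \<comment> \<open>When \<open>k0 = 0\<close> the maximum puts \<open>k = 1\<close>, and only
          arboricity 0 is to be excluded; it forces an edgeless graph, which is unlikely.\<close>
        proof (cases "arboricity E = 0")
          case True
          then show ?thesis using card_le_arboricity_isolated[OF E] by simp
        next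
          case False
          then show ?thesis using lt by (auto simp: k_def)
        qed
      qed (use p in auto)
      also have "\<dots> \<le> bin_prob (all_edges n) (p n) (\<lambda>E. k0 n \<noteq> 0 \<and> arboricity E \<le> k0 n - 1)
          + bin_prob (all_edges n) (p n) (\<lambda>E. \<not> 0 < card E)"
        using p by (intro bin_prob_disj) auto
      also have "bin_prob (all_edges n) (p n) (\<lambda>E. k0 n \<noteq> 0 \<and> arboricity E \<le> k0 n - 1) \<le> 1 / sqrt (real n)"
      proof (cases "k0 n = 0")
        case True
        then show ?thesis by (simp add: bin_expect_const)
      next
        case False
        then have "\<not> 1 / sqrt (real n) \<le> P n (k0 n - 1)"
          using not_less_Least[of "k0 n - 1" "\<lambda>k. 1 / sqrt (real n) \<le> P n k"] by (simp add: k0_def)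
        then show ?thesis using False by (simp add: P_def)
      qed
      finally show "bin_prob (all_edges n) (p n) (\<lambda>E. \<not> k n \<le> arboricity E) \<le> ?r n" by simp
    qed
  qed
  have close: "aas p (\<lambda>n E. real (deletion_distance (k n) E) < \<delta> * real n / 2)"
  proof (rule aasI[OF p])
    define C where "C = 8 * b / \<delta>\<^sup>2"
    have "(\<lambda>n. C * (1 / real n)) \<longlonglongrightarrow> 0" by (intro tendsto_mult_right_zero lim_1_over_n)
    then show "(\<lambda>n. C / real n) \<longlonglongrightarrow> 0" by simp
    have "filterlim (\<lambda>n. sqrt (real n)) at_top sequentially" by real_asymp
    then have "\<forall>\<^sub>F n in sequentially. C < sqrt (real n)" by (simp add: filterlim_at_top_dense)
    then show "\<forall>\<^sub>F n in sequentially. bin_prob (all_edges n) (p n)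
        (\<lambda>E. \<not> real (deletion_distance (k n) E) < \<delta> * real n / 2) \<le> C / real n"
      using pb eventually_gt_at_top[of 0]
    proof eventually_elim
      case (elim n)
      let ?f = "\<lambda>E. real (deletion_distance (k n) E)"
      define \<mu> where "\<mu> = bin_expect (all_edges n) (p n) ?f"
      define t where "t = \<delta> * real n / 4"
      have t: "t > 0" using elim \<delta> by (simp add: t_def)
      have "bin_prob (all_edges n) (p n) (\<lambda>E. t \<le> \<bar>?f E - \<mu>\<bar>)
          \<le> 1\<^sup>2 * p n * real (card (all_edges n)) / t\<^sup>2"
        unfolding \<mu>_def using p t deletion_distance_lipschitz by (intro bin_chebyshev) auto
      also have "\<dots> \<le> 1\<^sup>2 * (b / real n) * (real n * real n / 2) / t\<^sup>2"
        unfolding real_card_all_edges using p elim b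
        by (intro divide_right_mono mult_mono mult_left_mono) auto
      also have "\<dots> = C / real n" using elim \<delta> by (simp add: t_def C_def power2_eq_square field_simps)
      finally have dev: "bin_prob (all_edges n) (p n) (\<lambda>E. t \<le> \<bar>?f E - \<mu>\<bar>) \<le> C / real n" .
      \<comment> \<open>If the mean were at least \<open>t\<close>, distance 0 would be a deviation
        by \<open>t\<close>, of probability at most \<open>C / n\<close>; but it has probability at
        least \<open>1 / sqrt n\<close>. Hence a distance of \<open>2 t\<close> is a deviation by
        \<open>t\<close> as well.\<close>
      have "\<mu> < t"
      proof (rule ccontr)
        assume "\<not> \<mu> < t"
        have "1 / sqrt (real n) \<le> P n (k n)" using Pk elim by simp
        also have "\<dots> \<le> bin_prob (all_edges n) (p n) (\<lambda>E. t \<le> \<bar>?f E - \<mu>\<bar>)"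
          unfolding P_def
        proof (rule bin_prob_mono)
          fix E assume "arboricity E \<le> k n"
          then have "deletion_distance (k n) E = 0" using deletion_distance_le[of "{}" E "k n"] by simp
          then show "t \<le> \<bar>?f E - \<mu>\<bar>" using \<open>\<not> \<mu> < t\<close> by simp
        qed (use p in auto)
        also note dev
        finally have "1 / sqrt (real n) \<le> C / real n" .
        then have "real n / sqrt (real n) \<le> C" using elim by (simp add: field_simps)
        then show False using elim by (simp add: real_div_sqrt)
      qed
      then have "bin_prob (all_edges n) (p n) (\<lambda>E. \<not> ?f E < \<delta> * real n / 2)
          \<le> bin_prob (all_edges n) (p n) (\<lambda>E. t \<le> \<bar>?f E - \<mu>\<bar>)"
        using p by (intro bin_prob_mono) (auto simp: t_def)
      then show ?case using dev by linarith
    qed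
  qed
  have "aas p (\<lambda>n E. k n \<le> arboricity E \<and> (real (deletion_distance (k n) E) < \<delta> * real n / 2 \<and>
      (\<forall>S\<subseteq>{..<n}. S \<noteq> {} \<and> real (card S) \<le> \<delta> * real n \<longrightarrow> card (E \<inter> edges_on S) \<le> 2 * (card S - 1))))"
    by (intro aas_conj[OF p] lower close sparse)
  then have "aas p (\<lambda>n E. arboricity E \<in> {k n, k n + 1})"
  proof (rule aas_mono[OF p _ always_eventually[OF allI]], intro allI impI)
    fix n E assume E: "E \<subseteq> all_edges n" and H: "k n \<le> arboricity E \<and> (real (deletion_distance (k n) E) < \<delta> * real n / 2 \<and>
      (\<forall>S\<subseteq>{..<n}. S \<noteq> {} \<and> real (card S) \<le> \<delta> * real n \<longrightarrow> card (E \<inter> edges_on S) \<le> 2 * (card S - 1)))"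
    obtain Z where Z: "Z \<subseteq> E" "card Z = deletion_distance (k n) E" "arboricity (E - Z) \<le> k n"
      using deletion_distance_witness by blast
    have fin: "finite E" using E finite_all_edges finite_subset by blast
    have "int (arboricity E) \<le> \<lceil>real (k n + 1)\<rceil>"
    proof (rule arboricity_le_ceiling[OF E])
      fix S assume S: "S \<subseteq> {..<n}" "2 \<le> card S"
      then have ne: "S \<noteq> {}" by auto
      show "real (card (E \<inter> edges_on S)) \<le> real (k n + 1) * (real (card S) - 1)"
      proof (cases "real (card S) \<le> \<delta> * real n")
        case True
        then have "card (E \<inter> edges_on S) \<le> 2 * (card S - 1)" using H S ne by blast
        then have "real (card (E \<inter> edges_on S)) \<le> 2 * (real (card S) - 1)"
          using S by (subst (asm) le_mult_pred_iff_real) auto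
        also have "\<dots> \<le> real (k n + 1) * (real (card S) - 1)" using S by (intro mult_right_mono) (auto simp: k_def)
        finally show ?thesis .
      next
        case False
        have "card ((E - Z) \<inter> edges_on S) \<le> k n * (card S - 1)"
          using arboricity_le_iff_gnp[of "E - Z" n "k n"] Z E S(1) ne by blast
        then have 1: "real (card ((E - Z) \<inter> edges_on S)) \<le> real (k n) * (real (card S) - 1)"
          using S by (subst (asm) le_mult_pred_iff_real) auto
        have "card (E \<inter> edges_on S) \<le> card (Z \<union> ((E - Z) \<inter> edges_on S))"
          using fin Z by (intro card_mono) (auto dest: finite_subset)
        also have "\<dots> \<le> card Z + card ((E - Z) \<inter> edges_on S)" by (rule card_Un_le)
        finally have 2: "real (card (E \<inter> edges_on S)) \<le> real (card Z) + real (card ((E - Z) \<inter> edges_on S))" by linarith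
        have "real (card Z) < \<delta> * real n / 2" using H Z by simp
        \<comment> \<open>Here \<open>\<delta> n / 2 < card S / 2 \<le> card S - 1\<close>, so the
          deleted edges fit into the allowance of one more forest.\<close>
        then have "real (card Z) \<le> real (card S) - 1" using False S by linarith
        then show ?thesis using 1 2 by (simp add: distrib_right)
      qed
    qed simp
    then have "arboricity E \<le> k n + 1" by (simp only: ceiling_of_nat of_nat_le_iff)
    then show "arboricity E \<in> {k n, k n + 1}" using H by auto
  qed
  moreover have "\<forall>n. 0 < k n" by (simp add: k_def less_max_iff_disj)
  ultimately show ?thesis by blast
qed

section \<open>Arboricity of dense random graphs\<close>

text \<open>For more than half of the vertices, subtract the edges touching the complement from
  \<open>card E = x (n - 1)\<close>; the density condition then becomes \<open>large\<close>. Taking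
  \<open>y = 0\<close> yields the exact value, \<open>y = 1\<close> the two possible values.\<close>

lemma arboricity_le_ceiling_density:
  assumes E: "E \<subseteq> all_edges n" and n: "n \<ge> 2" and y: "0 \<le> y"
    and small: "\<And>S. S \<subseteq> {..<n} \<Longrightarrow> 2 \<le> card S \<Longrightarrow> 2 * card S \<le> n \<Longrightarrow>
      real (card (E \<inter> edges_on S)) \<le> real (card E) / (real n - 1) * (real (card S) - 1)"
    and large: "\<And>T. T \<subseteq> {..<n} \<Longrightarrow> T \<noteq> {} \<Longrightarrow> 2 * card T \<le> n \<Longrightarrow>
      real (card E) / (real n - 1) * real (card T) \<le> real (card (E \<inter> touching n T)) + y * (real n - real (card T) - 1)"
  shows "int (arboricity E) \<le> \<lceil>real (card E) / (real n - 1) + y\<rceil>"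
proof (rule arboricity_le_ceiling[OF E])
  define x where "x = real (card E) / (real n - 1)"
  have m: "x * (real n - 1) = real (card E)" using n by (simp add: x_def)
  show "0 \<le> real (card E) / (real n - 1) + y" using n y by simp
  fix S assume S: "S \<subseteq> {..<n}" "2 \<le> card S"
  have yS: "0 \<le> y * (real (card S) - 1)" using y S by simp
  have "real (card (E \<inter> edges_on S)) \<le> (x + y) * (real (card S) - 1)"
  proof (cases "2 * card S \<le> n")
    case True
    then show ?thesis using small[OF S] yS by (simp add: x_def distrib_right)
  next
    case False
    define T where "T = {..<n} - S"
    have fin: "finite S" using S finite_subset by blast
    have le: "card S \<le> n" using S card_mono[of "{..<n}" S] by simp
    have cT: "card T = n - card S" using S fin by (simp add: T_def card_Diff_subset)
    have "{..<n} - T = S" using S by (auto simp: T_def)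
    then have split: "card E = card (E \<inter> edges_on S) + card (E \<inter> touching n T)"
      using card_edges_split[OF E, of T] by simp
    have "x * real (card T) \<le> real (card (E \<inter> touching n T)) + y * (real n - real (card T) - 1)"
    proof (cases "T = {}")
      case True
      then show ?thesis using y n by simp
    next
      case False
      then show ?thesis using large[of T] cT \<open>\<not> 2 * card S \<le> n\<close> by (simp add: T_def x_def)
    qed
    then have "real (card (E \<inter> edges_on S)) \<le> real (card E) - x * real (card T) + y * (real n - real (card T) - 1)"
      using split by simp
    also have "\<dots> = (x + y) * (real (card S) - 1)"
      unfolding m[symmetric] using cT le by (simp add: of_nat_diff algebra_simps)
    finally show ?thesis .
  qed
  then show "real (card (E \<inter> edges_on S)) \<le> (real (card E) / (real n - 1) + y) * (real (card S) - 1)"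
    by (simp add: x_def)
qed

lemma filterlim_expected_degree:
  fixes p :: "nat \<Rightarrow> real"
  assumes p: "\<And>n. 0 \<le> p n \<and> p n \<le> 1" and pn: "filterlim (\<lambda>n. p n * real n) at_top sequentially"
  shows "filterlim (\<lambda>n. p n * (real n - 1)) at_top sequentially"
proof -
  have "filterlim (\<lambda>n. - 1 + p n * real n) at_top sequentially"
    by (rule filterlim_tendsto_add_at_top[OF tendsto_const pn])
  then show ?thesis
  proof (rule filterlim_at_top_mono)
    show "\<forall>\<^sub>F n in sequentially. - 1 + p n * real n \<le> p n * (real n - 1)"
      using p by (intro always_eventually) (simp add: right_diff_distrib)
  qed
qed

text \<open>The properties shared by both dense statements. The condition on the logarithm leaves
  open only sets \<open>T\<close> of at most \<open>exp (1 - d / 100) n\<close> vertices, and these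
  are what the two proofs treat differently.\<close>

definition density_regular :: "real \<Rightarrow> nat \<Rightarrow> nat set set \<Rightarrow> bool" where
  "density_regular d n E \<longleftrightarrow>
     (\<forall>S\<subseteq>{..<n}. 2 \<le> card S \<and> 2 * card S \<le> n \<longrightarrow>
        real (card (E \<inter> edges_on S)) \<le> real (card E) / (real n - 1) * (real (card S) - 1)) \<and>
     real (card E) / (real n - 1) \<le> 51 / 100 * d \<and>
     (\<forall>T\<subseteq>{..<n}. T \<noteq> {} \<and> 2 * card T \<le> n \<and> 1 + ln (real n / real (card T)) \<le> d / 100 \<longrightarrow>
        51 / 100 * d * real (card T) < real (card (E \<inter> touching n T)))"

lemma aas_density_regular:
  fixes p :: "nat \<Rightarrow> real"
  assumes p: "\<And>n. 0 \<le> p n \<and> p n \<le> 1" and pn: "filterlim (\<lambda>n. p n * real n) at_top sequentially"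
  shows "aas p (\<lambda>n. density_regular (p n * (real n - 1)) n)"
proof -
  have "\<forall>\<^sub>F n in sequentially. 1 \<le> p n * real n" using pn by (simp add: filterlim_at_top)
  then have "\<forall>\<^sub>F n in sequentially. 1 / real n \<le> p n"
    using eventually_gt_at_top[of 0] by eventually_elim (simp add: field_simps)
  then have pn2: "filterlim (\<lambda>n. p n * real n ^ 2) at_top sequentially"
    by (rule filterlim_pn2[OF zero_less_one])
  have dlim: "filterlim (\<lambda>n. p n * (real n - 1)) at_top sequentially"
    by (rule filterlim_expected_degree[OF p pn])
  \<comment> \<open>The left side never exceeds its value \<open>1/4\<close> at
    \<open>\<sigma> = 1/4\<close>, and \<open>ln (1 / \<sigma>) \<ge> ln 2 \<ge> 2/3\<close>; the
    product \<open>0.8 * 0.49 * 2/3\<close> is still above \<open>1/4\<close>. The factor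
    \<open>0.49\<close> stays below the density of the whole graph.\<close>
  have "sqrt \<sigma> - \<sigma> \<le> (1 - 1 / 5) * (49 / 100) * ln (1 / \<sigma>)" (is "_ \<le> ?c * ?l") if "0 < \<sigma>" "\<sigma> \<le> 1 / 2" for \<sigma> :: real
  proof -
    have "0 \<le> (sqrt \<sigma> - 1 / 2)\<^sup>2" by simp
    then have "sqrt \<sigma> - \<sigma> \<le> 1 / 4" using that by (simp add: power2_eq_square algebra_simps)
    also have "\<dots> \<le> ?c * (2 / 3)" by simp
    also have "\<dots> \<le> ?c * ?l"
    proof (rule mult_left_mono)
      have "ln 2 \<le> ?l" using that by (simp add: field_simps)
      then show "2 / 3 \<le> ?l" using ln2_ge_two_thirds by linarith
    qed simp
    finally show ?thesis .
  qed
  then have dense: "aas p (\<lambda>n E. \<forall>S\<subseteq>{..<n}. card S \<ge> 2 \<and> real (card S) \<le> 1 / 2 * real n \<longrightarrow>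
      real (card (E \<inter> edges_on S)) < 49 / 100 * (p n * real n) * (real (card S) - 1))"
    by (intro aas_no_dense_set[OF p pn, where \<tau> = "1/5"]) auto
  have m: "aas p (\<lambda>n E. \<bar>real (card E) - p n * real n ^ 2 / 2\<bar> < 1 / 200 * (p n * real n ^ 2))"
    by (rule aas_card_approx[OF p pn2]) simp
  \<comment> \<open>The edge count is at most \<open>0.505 p n ^ 2\<close>; the step to
    \<open>0.51\<close> absorbs the change from \<open>n\<close> to \<open>n - 1\<close>.\<close>
  have ev: "\<forall>\<^sub>F n in sequentially. 505 / 1000 * real n ^ 2 \<le> 51 / 100 * (real n - 1) ^ 2" by real_asymp
  show ?thesis
  proof (rule aas_mono[OF p aas_conj[OF p aas_conj[OF p dense m] aas_well_touched[OF p dlim]]])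
    show "\<forall>\<^sub>F n in sequentially. \<forall>E\<subseteq>all_edges n.
       ((\<forall>S\<subseteq>{..<n}. 2 \<le> card S \<and> real (card S) \<le> 1 / 2 * real n \<longrightarrow>
          real (card (E \<inter> edges_on S)) < 49 / 100 * (p n * real n) * (real (card S) - 1)) \<and>
        \<bar>real (card E) - p n * real n ^ 2 / 2\<bar> < 1 / 200 * (p n * real n ^ 2)) \<and>
       (\<forall>T\<subseteq>{..<n}. T \<noteq> {} \<and> 2 * card T \<le> n \<and> 1 + ln (real n / real (card T)) \<le> p n * (real n - 1) / 100 \<longrightarrow>
          51 / 100 * (p n * (real n - 1)) * real (card T) < real (card (E \<inter> touching n T))) \<longrightarrow> density_regular (p n * (real n - 1)) n E"
      using ev eventually_ge_at_top[of 2]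
    proof eventually_elim
      case (elim n)
      define c where "c = p n * real n"
      have cn: "p n * real n ^ 2 = c * real n" by (simp add: c_def power2_eq_square)
      have c0: "0 \<le> c" using p by (simp add: c_def)
      show ?case
        unfolding density_regular_def
      proof (intro allI impI, elim conjE, intro conjI)
        fix E assume dense: "\<forall>S\<subseteq>{..<n}. 2 \<le> card S \<and> real (card S) \<le> 1 / 2 * real n \<longrightarrow>
            real (card (E \<inter> edges_on S)) < 49 / 100 * (p n * real n) * (real (card S) - 1)"
          and "\<bar>real (card E) - p n * real n ^ 2 / 2\<bar> < 1 / 200 * (p n * real n ^ 2)"
        from this(2) have m: "495 / 1000 * (c * real n) \<le> real (card E)" "real (card E) \<le> 505 / 1000 * (c * real n)"
          unfolding cn abs_less_iff by linarith+
        have "49 / 100 * c * (real n - 1) \<le> 49 / 100 * c * real n" using c0 by (intro mult_left_mono) auto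
        also have "\<dots> \<le> real (card E)"
        proof -
          have "0 \<le> c * real n" using c0 by simp
          then show ?thesis using m(1) by linarith
        qed
        finally have x: "49 / 100 * c \<le> real (card E) / (real n - 1)" using elim by (simp add: field_simps)
        show "\<forall>S\<subseteq>{..<n}. 2 \<le> card S \<and> 2 * card S \<le> n \<longrightarrow>
          real (card (E \<inter> edges_on S)) \<le> real (card E) / (real n - 1) * (real (card S) - 1)"
        proof (intro allI impI)
          fix S assume S: "S \<subseteq> {..<n}" "2 \<le> card S \<and> 2 * card S \<le> n"
          then have "real (card (E \<inter> edges_on S)) \<le> 49 / 100 * c * (real (card S) - 1)"
            using dense unfolding c_def by (intro less_imp_le) auto
          also have "\<dots> \<le> real (card E) / (real n - 1) * (real (card S) - 1)"
            using x S by (intro mult_right_mono) auto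
          finally show "real (card (E \<inter> edges_on S)) \<le> real (card E) / (real n - 1) * (real (card S) - 1)" .
        qed
        have "real (card E) \<le> p n * (505 / 1000 * real n ^ 2)"
          using m(2) by (simp add: c_def power2_eq_square)
        also have "\<dots> \<le> p n * (51 / 100 * (real n - 1) ^ 2)" using elim p by (intro mult_left_mono) auto
        finally show "real (card E) / (real n - 1) \<le> 51 / 100 * (p n * (real n - 1))"
          using elim by (simp add: field_simps power2_eq_square)
      qed
    qed
  qed
qed

lemma small_of_ln_ratio:
  assumes "0 < t" "0 < n" "\<not> 1 + ln (real n / real t) \<le> x"
  shows "real t \<le> exp (1 - x) * real n"
proof -
  have "ln (real t / real n) < 1 - x" using assms by (simp add: ln_div)
  then have "exp (ln (real t / real n)) < exp (1 - x)" by simp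
  then show ?thesis using assms by (simp add: field_simps)
qed

lemma aas_arboricity_dense:
  fixes p :: "nat \<Rightarrow> real"
  assumes p: "\<And>n. 0 \<le> p n \<and> p n \<le> 1" and pn: "filterlim (\<lambda>n. p n * real n) at_top sequentially"
  shows "aas p (\<lambda>n E. int (arboricity E) \<in>
      {\<lceil>real (card E) / (real n - 1)\<rceil>, \<lceil>real (card E) / (real n - 1)\<rceil> + 1})"
proof (rule aas_mono[OF p aas_density_regular[OF p pn]])
  have "\<forall>\<^sub>F x in at_top. 51 / 100 * x * exp (1 - x / 100) \<le> (1 / 4 :: real)" by real_asymp
  then have "\<forall>\<^sub>F n in sequentially. 51 / 100 * (p n * (real n - 1)) * exp (1 - p n * (real n - 1) / 100) \<le> 1 / 4"
    using filterlim_expected_degree[OF p pn] by (rule eventually_compose_filterlim)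
  then show "\<forall>\<^sub>F n in sequentially. \<forall>E\<subseteq>all_edges n.
      density_regular (p n * (real n - 1)) n E \<longrightarrow>
      int (arboricity E) \<in> {\<lceil>real (card E) / (real n - 1)\<rceil>, \<lceil>real (card E) / (real n - 1)\<rceil> + 1}"
    using eventually_ge_at_top[of 4]
  proof eventually_elim
    case (elim n)
    define d where "d = p n * (real n - 1)"
    have n0: "0 < n" using elim by simp
    have d0: "0 \<le> d" using p elim by (simp add: d_def)
    show ?case
      unfolding density_regular_def
    proof (intro allI impI, elim conjE)
      fix E assume E: "E \<subseteq> all_edges n"
        and small: "\<forall>S\<subseteq>{..<n}. 2 \<le> card S \<and> 2 * card S \<le> n \<longrightarrow>
          real (card (E \<inter> edges_on S)) \<le> real (card E) / (real n - 1) * (real (card S) - 1)"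
        and x: "real (card E) / (real n - 1) \<le> 51 / 100 * (p n * (real n - 1))"
        and touch: "\<forall>T\<subseteq>{..<n}. T \<noteq> {} \<and> 2 * card T \<le> n \<and> 1 + ln (real n / real (card T)) \<le> p n * (real n - 1) / 100 \<longrightarrow>
         51 / 100 * (p n * (real n - 1)) * real (card T) < real (card (E \<inter> touching n T))"
      have "int (arboricity E) \<le> \<lceil>real (card E) / (real n - 1) + 1\<rceil>"
      proof (rule arboricity_le_ceiling_density[OF E])
        fix T assume T: "T \<subseteq> {..<n}" "T \<noteq> {}" "2 * card T \<le> n"
        have fin: "finite T" using T finite_subset by blast
        have t: "0 < card T" using T fin by (simp add: card_gt_0_iff)
        have xt: "real (card E) / (real n - 1) * real (card T) \<le> 51 / 100 * d * real (card T)"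
          using x by (intro mult_right_mono) (auto simp: d_def)
        show "real (card E) / (real n - 1) * real (card T)
            \<le> real (card (E \<inter> touching n T)) + 1 * (real n - real (card T) - 1)"
        proof (cases "1 + ln (real n / real (card T)) \<le> d / 100")
          case True
          then have "51 / 100 * d * real (card T) < real (card (E \<inter> touching n T))"
            using touch T unfolding d_def by blast
          moreover have "real (card T) + 1 \<le> real n" using T(3) elim by linarith
          ultimately have "51 / 100 * d * real (card T) \<le> real (card (E \<inter> touching n T)) + 1 * (real n - real (card T) - 1)"
            by simp
          then show ?thesis by (rule order_trans[OF xt])
        next
          case False
          \<comment> \<open>The edges touching such a \<open>T\<close> are not counted at all:
            \<open>x card T \<le> n / 4\<close> is already below \<open>n - card T - 1\<close>, the
            allowance of the extra forest.\<close>
          have "51 / 100 * d * real (card T) \<le> 51 / 100 * d * (exp (1 - d / 100) * real n)"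
            using small_of_ln_ratio[OF t n0 False] d0 by (intro mult_left_mono) auto
          also have "\<dots> = (51 / 100 * d * exp (1 - d / 100)) * real n" by simp
          also have "\<dots> \<le> 1 / 4 * real n" using elim by (intro mult_right_mono) (auto simp: d_def)
          finally have "51 / 100 * d * real (card T) \<le> real n / 4" by simp
          moreover have "2 * real (card T) \<le> real n" "4 \<le> real n" using T(3) elim by linarith+
          ultimately have "51 / 100 * d * real (card T) \<le> real (card (E \<inter> touching n T)) + 1 * (real n - real (card T) - 1)"
            by simp
          then show ?thesis by (rule order_trans[OF xt])
        qed
      qed (use elim small in auto)
      also have "\<lceil>real (card E) / (real n - 1) + 1\<rceil> = \<lceil>real (card E) / (real n - 1)\<rceil> + 1" by simp
      finally show "int (arboricity E) \<in> {\<lceil>real (card E) / (real n - 1)\<rceil>, \<lceil>real (card E) / (real n - 1)\<rceil> + 1}"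
        using ceiling_density_le_arboricity[OF E] elim by force
    qed
  qed
qed

section \<open>Degrees and the exact value above the threshold\<close>

abbreviation deg :: "nat \<Rightarrow> nat set set \<Rightarrow> nat \<Rightarrow> nat" where
  "deg n E v \<equiv> card (E \<inter> touching n {v})"

lemma touching_iff: "e \<in> all_edges n \<Longrightarrow> e \<in> touching n T \<longleftrightarrow> e \<inter> T \<noteq> {}"
  by (auto simp: touching_def all_edges_eq edges_on_alt)

text \<open>An edge is counted once for each of its ends in \<open>T\<close>, so the edges inside
  \<open>T\<close> count twice.\<close>

lemma sum_deg:
  assumes E: "E \<subseteq> all_edges n" and T: "T \<subseteq> {..<n}"
  shows "(\<Sum>v\<in>T. deg n E v) = card (E \<inter> touching n T) + card (E \<inter> edges_on T)"
proof -
  have fin: "finite E" "finite T" using E T finite_all_edges finite_subset by blast+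
  have card_eq: "card (E \<inter> B) = (\<Sum>e\<in>E. of_bool (e \<in> B))" for B
    using fin by (simp add: Int_def)
  have "(\<Sum>v\<in>T. deg n E v) = (\<Sum>e\<in>E. \<Sum>v\<in>T. of_bool (e \<in> touching n {v}))"
    unfolding card_eq by (rule sum.swap)
  also have "\<dots> = (\<Sum>e\<in>E. of_bool (e \<in> touching n T) + of_bool (e \<in> edges_on T))"
  proof (rule sum.cong)
    fix e assume "e \<in> E"
    then have e: "e \<in> all_edges n" using E by blast
    then have c: "card e = 2" by (simp add: all_edges_eq edges_on_alt)
    have "(\<Sum>v\<in>T. of_bool (e \<in> touching n {v}) :: nat) = (\<Sum>v\<in>T. of_bool (v \<in> e))"
      by (simp add: touching_iff[OF e])
    also have "\<dots> = card (e \<inter> T)" using fin by (simp add: Int_def conj_commute)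
    also have "\<dots> = of_bool (e \<inter> T \<noteq> {}) + of_bool (e \<subseteq> T)"
    proof -
      obtain a b where "e = {a, b}" "a \<noteq> b" using c by (auto simp: card_2_iff)
      then show ?thesis by (cases "a \<in> T"; cases "b \<in> T") auto
    qed
    finally show "(\<Sum>v\<in>T. of_bool (e \<in> touching n {v}))
        = of_bool (e \<in> touching n T) + (of_bool (e \<in> edges_on T) :: nat)"
      using c by (simp add: touching_iff[OF e] edges_on_alt)
  qed simp
  also have "\<dots> = card (E \<inter> touching n T) + card (E \<inter> edges_on T)"
    unfolding card_eq by (rule sum.distrib)
  finally show ?thesis .
qed

text \<open>An edge of \<open>T\<close> that meets \<open>L\<close> has exactly one end in
  \<open>L\<close>. Sending it to its other end is injective, as no vertex has two neighbours in
  \<open>L\<close>.\<close>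

lemma card_edges_on_le_of_scattered:
  assumes fin: "finite T"
    and nonadj: "\<And>u v. u \<in> L \<Longrightarrow> v \<in> L \<Longrightarrow> {u, v} \<in> E \<Longrightarrow> u = v"
    and noncommon: "\<And>u v w. u \<in> L \<Longrightarrow> v \<in> L \<Longrightarrow> {u, w} \<in> E \<Longrightarrow> {v, w} \<in> E \<Longrightarrow> u = v"
  shows "card (E \<inter> edges_on T) \<le> card (E \<inter> edges_on (T - L)) + card (T - L)"
proof -
  define F where "F = E \<inter> edges_on T - edges_on (T - L)"
  have "\<exists>u l. e = {l, u} \<and> u \<in> T - L \<and> l \<in> L" if e: "e \<in> F" for e
  proof -
    obtain a b where ab: "e = {a, b}" "a \<in> T" "b \<in> T" "a \<noteq> b"
      using e by (auto simp: F_def edges_on_def)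
    have "\<not> (a \<in> L \<and> b \<in> L)" using nonadj[of a b] e ab by (auto simp: F_def)
    moreover have "a \<in> L \<or> b \<in> L" using e ab by (auto simp: F_def edges_on_def)
    ultimately show ?thesis using ab by (metis DiffI insert_commute)
  qed
  then obtain g h where gh: "\<And>e. e \<in> F \<Longrightarrow> e = {h e, g e} \<and> g e \<in> T - L \<and> h e \<in> L" by metis
  have "inj_on g F"
  proof
    fix e e' assume e: "e \<in> F" "e' \<in> F" "g e = g e'"
    have "{h e, g e} \<in> E" "{h e', g e} \<in> E" using gh[OF e(1)] gh[OF e(2)] e by (auto simp: F_def)
    then have "h e = h e'" using noncommon gh e by blast
    then show "e = e'" using gh e by metis
  qed
  then have "card F \<le> card (T - L)" using gh fin by (intro card_inj_on_le[of g]) auto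
  moreover have "card (E \<inter> edges_on T) \<le> card ((E \<inter> edges_on (T - L)) \<union> F)"
    using fin finite_edges_on[OF fin] finite_edges_on[of "T - L"] by (intro card_mono) (auto simp: F_def)
  moreover have "card ((E \<inter> edges_on (T - L)) \<union> F) \<le> card (E \<inter> edges_on (T - L)) + card F"
    by (rule card_Un_le)
  ultimately show ?thesis by linarith
qed

text \<open>Sliding a window of length \<open>\<surd>\<mu>\<close> to the right of \<open>j\<close> changes the Poisson weights only by a
  bounded factor, and the weights sum up to at most one.\<close>

lemma poisson_weight_le:
  fixes \<mu> :: real
  assumes \<mu>: "1 \<le> \<mu>" and j: "real j \<le> \<mu> + 3"
  shows "\<mu> ^ j / fact j \<le> exp (4 + \<mu>) / sqrt \<mu>"
proof -
  define r where "r = nat \<lfloor>sqrt \<mu>\<rfloor>"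
  have s1: "1 \<le> sqrt \<mu>" using \<mu> by simp
  have r: "real r \<le> sqrt \<mu>" "sqrt \<mu> \<le> real (Suc r)" using s1 by (auto simp: r_def) linarith
  have fact_le: "fact (j + i) \<le> fact j * real (j + i) ^ i" for i
  proof (induction i)
    case (Suc i)
    have "fact (j + Suc i) = real (j + Suc i) * fact (j + i)" by simp
    also have "\<dots> \<le> real (j + Suc i) * (fact j * real (j + i) ^ i)" using Suc by (intro mult_left_mono) auto
    also have "\<dots> \<le> real (j + Suc i) * (fact j * real (j + Suc i) ^ i)"
      by (intro mult_left_mono power_mono) auto
    finally show ?case by (simp add: mult_ac)
  qed simp
  \<comment> \<open>The ratio of \<open>fact (j + i)\<close> to \<open>fact j * \<mu> ^ i\<close> is
    at most \<open>((j + i) / \<mu>) ^ i \<le> exp (i (3 + sqrt \<mu>) / \<mu>)\<close>. For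
    \<open>i \<le> sqrt \<mu>\<close> the exponent is at most
    \<open>(3 sqrt \<mu> + \<mu>) / \<mu> \<le> 4\<close>.\<close>
  have win: "\<mu> ^ j / fact j \<le> exp 4 * (\<mu> ^ (j + i) / fact (j + i))" if "i \<le> r" for i
  proof -
    have ir: "real i \<le> sqrt \<mu>" using that r by linarith
    have "real (j + i) \<le> \<mu> + 3 + sqrt \<mu>" using j ir by simp
    also have "\<dots> = \<mu> * (1 + (3 + sqrt \<mu>) / \<mu>)" using \<mu> by (simp add: field_simps)
    also have "\<dots> \<le> \<mu> * exp ((3 + sqrt \<mu>) / \<mu>)" using \<mu> by (intro mult_left_mono) auto
    finally have "real (j + i) ^ i \<le> (\<mu> * exp ((3 + sqrt \<mu>) / \<mu>)) ^ i" by (intro power_mono) auto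
    also have "\<dots> = \<mu> ^ i * exp (real i * ((3 + sqrt \<mu>) / \<mu>))" by (simp only: power_mult_distrib exp_of_nat_mult)
    also have "\<dots> \<le> \<mu> ^ i * exp 4"
    proof (intro mult_left_mono)
      have "real i * ((3 + sqrt \<mu>) / \<mu>) \<le> sqrt \<mu> * ((3 + sqrt \<mu>) / \<mu>)"
        using ir \<mu> by (intro mult_right_mono) auto
      also have "\<dots> = (3 * sqrt \<mu> + \<mu>) / \<mu>" using \<mu> by (simp add: field_simps)
      also have "\<dots> \<le> 4"
      proof -
        have "sqrt \<mu> * 1 \<le> sqrt \<mu> * sqrt \<mu>" using s1 by (intro mult_left_mono) auto
        then have "sqrt \<mu> \<le> \<mu>" using \<mu> by simp
        then show ?thesis using \<mu> by (simp add: field_simps)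
      qed
      finally show "exp (real i * ((3 + sqrt \<mu>) / \<mu>)) \<le> exp 4" by simp
    qed (use \<mu> in auto)
    finally have "fact j * real (j + i) ^ i \<le> fact j * (\<mu> ^ i * exp 4)" by (intro mult_left_mono) auto
    then have "fact (j + i) \<le> fact j * (\<mu> ^ i * exp 4)" using fact_le[of i] by linarith
    then have "\<mu> ^ j * fact (j + i) \<le> \<mu> ^ j * (fact j * (\<mu> ^ i * exp 4))" using \<mu> by (intro mult_left_mono) auto
    then show ?thesis by (simp add: field_simps power_add)
  qed
  have "real (Suc r) * (\<mu> ^ j / fact j) = (\<Sum>i\<in>{..r}. \<mu> ^ j / fact j)" by simp
  also have "\<dots> \<le> (\<Sum>i\<in>{..r}. exp 4 * (\<mu> ^ (j + i) / fact (j + i)))" using win by (intro sum_mono) auto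
  also have "\<dots> = exp 4 * (\<Sum>l\<in>(+) j ` {..r}. \<mu> ^ l / fact l)"
    by (simp add: sum_distrib_left sum.reindex)
  also have "\<dots> \<le> exp 4 * exp \<mu>" using \<mu> by (intro mult_left_mono sum_power_div_fact_le_exp) auto
  finally have "real (Suc r) * (\<mu> ^ j / fact j) \<le> exp (4 + \<mu>)" by (simp add: exp_add)
  moreover have "sqrt \<mu> * (\<mu> ^ j / fact j) \<le> real (Suc r) * (\<mu> ^ j / fact j)"
    using r \<mu> by (intro mult_right_mono) auto
  ultimately have "sqrt \<mu> * (\<mu> ^ j / fact j) \<le> exp (4 + \<mu>)" by linarith
  then show ?thesis using s1 by (simp add: field_simps)
qed

text \<open>With \<open>\<mu> = d / 2\<close>, the probability of the value \<open>j\<close> is at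
  most \<open>exp (3 - 2 \<mu>) * 2 ^ j\<close> times \<open>\<mu> ^ j / fact j\<close>; the 3
  bounds \<open>p j\<close> and comes from \<open>p d \<le> 2\<close>. The last factor is at most
  \<open>exp (4 + \<mu>) / sqrt \<mu>\<close>, and the powers of 2 up to \<open>\<mu> + 2\<close>
  sum to at most \<open>8 * 2 powr \<mu>\<close>. Finally
  \<open>\<mu> - \<mu> ln 2 = d / arb_beta\<close>.\<close>

lemma bin_prob_half_mean:
  assumes p: "0 \<le> p" "p \<le> 1" and A: "finite A" "B \<subseteq> A"
    and d: "d = p * real (card B)" "2 \<le> d" and pd: "p * d \<le> 2"
  shows "bin_prob A p (\<lambda>E. real (card (E \<inter> B)) \<le> d / 2 + 2)
    \<le> 8 * exp 7 * exp (- d / arb_beta) / sqrt (d / 2)"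
proof -
  define \<mu> where "\<mu> = d / 2"
  have \<mu>: "1 \<le> \<mu>" using d by (simp add: \<mu>_def)
  define J where "J = nat \<lfloor>\<mu> + 2\<rfloor>"
  have J: "real l \<le> \<mu> + 2 \<longleftrightarrow> l \<le> J" for l
  proof -
    have "l \<le> J \<longleftrightarrow> int l \<le> \<lfloor>\<mu> + 2\<rfloor>" unfolding J_def using \<mu> by (intro le_nat_iff) linarith
    then show ?thesis by (simp only: le_floor_iff of_int_of_nat_eq)
  qed
  have weight: "bin_prob A p (\<lambda>E. card (E \<inter> B) = j) \<le> exp (7 - \<mu>) / sqrt \<mu> * 2 ^ j" if j: "j \<le> J" for j
  proof (cases "j \<le> card B")
    case True
    have jm: "real j \<le> \<mu> + 2" using J j by blast
    have "p * real j \<le> p * (\<mu> + 2)" using p jm by (intro mult_left_mono) auto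
    also have "\<dots> \<le> 3" using pd p by (simp add: \<mu>_def algebra_simps)
    finally have pj: "p * real j \<le> 3" .
    have "real (card B choose j) * fact j \<le> real (card B) ^ j"
      using binomial_fact_pow[of "card B" j] by (metis of_nat_fact of_nat_le_iff of_nat_mult of_nat_power)
    then have ch: "real (card B choose j) \<le> real (card B) ^ j / fact j" by (simp add: field_simps)
    have "(1 - p) ^ (card B - j) \<le> exp (- p * real (card B - j))"
      using one_plus_power_le_exp[of "- p" "card B - j"] p by simp
    also have "\<dots> = exp (p * real j - d)" using True d by (simp add: of_nat_diff algebra_simps)
    also have "\<dots> \<le> exp (3 - 2 * \<mu>)" using pj by (simp add: \<mu>_def)
    finally have q: "(1 - p) ^ (card B - j) \<le> exp (3 - 2 * \<mu>)" .
    have "bin_prob A p (\<lambda>E. card (E \<inter> B) = j) \<le> real (card B choose j) * p ^ j * (1 - p) ^ (card B - j)"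
      by (rule bin_prob_card_eq_le[OF p A])
    also have "\<dots> \<le> (real (card B) ^ j / fact j) * p ^ j * exp (3 - 2 * \<mu>)"
      using ch q p by (intro mult_mono) auto
    also have "\<dots> = d ^ j / fact j * exp (3 - 2 * \<mu>)" by (simp add: d power_mult_distrib mult_ac)
    also have "\<dots> = 2 ^ j * exp (3 - 2 * \<mu>) * (\<mu> ^ j / fact j)"
      by (simp add: \<mu>_def power_divide)
    also have "\<dots> \<le> 2 ^ j * exp (3 - 2 * \<mu>) * (exp (4 + \<mu>) / sqrt \<mu>)"
      using poisson_weight_le[OF \<mu>, of j] jm by (intro mult_left_mono) auto
    also have "\<dots> = exp (7 - \<mu>) / sqrt \<mu> * 2 ^ j" by (simp add: mult_ac flip: exp_add)
    finally show ?thesis .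
  next
    case False
    have "bin_prob A p (\<lambda>E. card (E \<inter> B) = j) \<le> real (card B choose j) * p ^ j * (1 - p) ^ (card B - j)"
      by (rule bin_prob_card_eq_le[OF p A])
    also have "\<dots> = 0" using False by (simp add: binomial_eq_0)
    also have "0 \<le> exp (7 - \<mu>) / sqrt \<mu> * 2 ^ j" using \<mu> by simp
    finally show ?thesis .
  qed
  have "bin_prob A p (\<lambda>E. real (card (E \<inter> B)) \<le> d / 2 + 2) \<le> bin_prob A p (\<lambda>E. \<exists>j\<in>{..J}. card (E \<inter> B) = j)"
    using p J by (intro bin_prob_mono) (auto simp: \<mu>_def)
  also have "\<dots> \<le> (\<Sum>j\<in>{..J}. bin_prob A p (\<lambda>E. card (E \<inter> B) = j))"
    using p by (intro bin_prob_union_bound) auto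
  also have "\<dots> \<le> (\<Sum>j\<in>{..J}. exp (7 - \<mu>) / sqrt \<mu> * 2 ^ j)" using weight by (intro sum_mono) auto
  also have "\<dots> = exp (7 - \<mu>) / sqrt \<mu> * (\<Sum>j<Suc J. 2 ^ j)"
    by (simp only: sum_distrib_left lessThan_Suc_atMost)
  also have "\<dots> \<le> exp (7 - \<mu>) / sqrt \<mu> * (8 * exp (\<mu> * ln 2))"
  proof (rule mult_left_mono)
    have "(\<Sum>j<Suc J. (2::real) ^ j) \<le> 2 * 2 ^ J" by (subst sum_gp_strict) auto
    also have "(2::real) ^ J = exp (real J * ln 2)" by (simp add: exp_of_nat_mult)
    also have "\<dots> \<le> exp ((\<mu> + 2) * ln 2)" using J by (simp add: mult_right_mono)
    also have "\<dots> = 4 * exp (\<mu> * ln 2)"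
    proof -
      have "exp (2 * ln 2) = (4::real)" using exp_of_nat_mult[of 2 "ln 2 :: real"] by simp
      then show ?thesis by (simp add: distrib_right exp_add)
    qed
    finally show "(\<Sum>j<Suc J. (2::real) ^ j) \<le> 8 * exp (\<mu> * ln 2)" by simp
  qed (use \<mu> in auto)
  also have "\<dots> = 8 * exp 7 * exp (- d / arb_beta) / sqrt (d / 2)"
  proof -
    have "- d / arb_beta = \<mu> * ln 2 - \<mu>"
      by (simp add: arb_beta_def ln_div \<mu>_def field_simps)
    then have "exp 7 * exp (- d / arb_beta) = exp (7 - \<mu>) * exp (\<mu> * ln 2)" by (simp flip: exp_add)
    then show ?thesis unfolding \<mu>_def by simp
  qed
  finally show ?thesis .
qed

text \<open>Edges inside \<open>T\<close> are counted twice in the sum of degrees and have to be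
  subtracted once. Every vertex outside \<open>L\<close> has a surplus \<open>\<kappa> + 1\<close>
  over \<open>h\<close>: \<open>\<kappa>\<close> pays for the edges inside \<open>T - L\<close>, and
  1 for the edge that may join it to \<open>L\<close>. Vertices of \<open>L\<close> need pay
  nothing.\<close>

lemma touching_ge_of_degrees:
  assumes E: "E \<subseteq> all_edges n" and T: "T \<subseteq> {..<n}"
    and h: "\<And>v. v \<in> T \<Longrightarrow> h \<le> real (deg n E v)"
    and l: "\<And>v. v \<in> T - L \<Longrightarrow> l \<le> real (deg n E v)"
    and scattered: "\<And>u v. u \<in> L \<Longrightarrow> v \<in> L \<Longrightarrow> {u, v} \<in> E \<Longrightarrow> u = v"
      "\<And>u v w. u \<in> L \<Longrightarrow> v \<in> L \<Longrightarrow> {u, w} \<in> E \<Longrightarrow> {v, w} \<in> E \<Longrightarrow> u = v"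
    and sparse: "real (card (E \<inter> edges_on (T - L))) \<le> \<kappa> * real (card (T - L))"
    and gap: "h + \<kappa> + 1 \<le> l"
  shows "h * real (card T) \<le> real (card (E \<inter> touching n T))"
proof -
  have fin: "finite T" using T finite_subset by blast
  have "h * real (card (T \<inter> L)) \<le> (\<Sum>v\<in>T \<inter> L. real (deg n E v))"
    using sum_bounded_below[of "T \<inter> L" h "\<lambda>v. real (deg n E v)"] h by (simp add: mult.commute)
  moreover have "l * real (card (T - L)) \<le> (\<Sum>v\<in>T - L. real (deg n E v))"
    using sum_bounded_below[of "T - L" l "\<lambda>v. real (deg n E v)"] l by (simp add: mult.commute)
  moreover have "(\<Sum>v\<in>T. real (deg n E v)) = (\<Sum>v\<in>T \<inter> L. real (deg n E v)) + (\<Sum>v\<in>T - L. real (deg n E v))"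
    by (rule sum.Int_Diff[OF fin])
  moreover have "(\<Sum>v\<in>T. real (deg n E v)) = real (card (E \<inter> touching n T)) + real (card (E \<inter> edges_on T))"
    using sum_deg[OF E T] by (metis of_nat_add of_nat_sum)
  moreover have "card (E \<inter> edges_on T) \<le> card (E \<inter> edges_on (T - L)) + card (T - L)"
    by (rule card_edges_on_le_of_scattered[OF fin scattered])
  then have "real (card (E \<inter> edges_on T)) \<le> (\<kappa> + 1) * real (card (T - L))"
    using sparse by (simp add: distrib_right)
  moreover have "(h + \<kappa> + 1) * real (card (T - L)) \<le> l * real (card (T - L))"
    using gap by (intro mult_right_mono) auto
  then have "h * real (card (T - L)) + (\<kappa> + 1) * real (card (T - L)) \<le> l * real (card (T - L))"
    by (simp add: distrib_right)
  moreover have "card T = card (T \<inter> L) + card (T - L)"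
    using fin by (metis card_Int_Diff)
  then have "h * real (card T) = h * real (card (T \<inter> L)) + h * real (card (T - L))"
    by (simp add: distrib_left)
  ultimately show ?thesis by linarith
qed

text \<open>The prescribed edges \<open>A0\<close>, later an edge or a path joining \<open>u\<close>
  and \<open>v\<close>, are removed from the counted pairs to gain independence. At least
  \<open>2 (n - 1) - 3\<close> pairs remain: the pair \<open>{u, v}\<close> is shared and at most
  two are prescribed. Then \<open>1.1 ln 2 - 1 < - 0.23\<close>.\<close>

lemma bin_prob_low_pair:
  assumes p: "0 \<le> p" "p \<le> 1" and uv: "u < n" "v < n" "u \<noteq> v"
    and A0: "A0 \<subseteq> all_edges n" "card A0 \<le> 2" and d: "d = p * (real n - 1)"
  shows "bin_prob (all_edges n) p (\<lambda>E. A0 \<subseteq> E \<and> real (deg n E u) \<le> 55 / 100 * d \<and> real (deg n E v) \<le> 55 / 100 * d)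
    \<le> p ^ card A0 * exp (2 - 23 / 100 * d)"
proof -
  define B where "B = touching n {u, v} - A0"
  have d0: "0 \<le> d" using p uv by (simp add: d)
  have B: "B \<subseteq> all_edges n" by (auto simp: B_def touching_def)
  have finA0: "finite A0" using A0 finite_all_edges finite_subset by blast
  have "real (card (touching n {u, v})) = 2 * (real n - 1) - 1"
    using uv by (subst real_card_touching) auto
  moreover have "card (touching n {u, v}) - card A0 \<le> card B"
    unfolding B_def by (rule diff_card_le_card_Diff[OF finA0])
  ultimately have "2 * (real n - 1) - 3 \<le> real (card B)" using A0(2) by linarith
  then have "p * (2 * (real n - 1) - 3) \<le> p * real (card B)" using p by (intro mult_left_mono) auto
  then have pB: "2 * d - 3 \<le> p * real (card B)" using p by (simp add: d algebra_simps)
  have "bin_prob (all_edges n) p (\<lambda>E. A0 \<subseteq> E \<and> real (deg n E u) \<le> 55 / 100 * d \<and> real (deg n E v) \<le> 55 / 100 * d)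
      \<le> bin_prob (all_edges n) p (\<lambda>E. A0 \<subseteq> E \<and> real (card (E \<inter> B)) \<le> 110 / 100 * d)"
  proof (rule bin_prob_mono[OF p])
    fix E assume E: "E \<subseteq> all_edges n"
      and low: "A0 \<subseteq> E \<and> real (deg n E u) \<le> 55 / 100 * d \<and> real (deg n E v) \<le> 55 / 100 * d"
    have "finite E" using E finite_all_edges finite_subset by blast
    then have "card (E \<inter> B) \<le> card (E \<inter> touching n {u, v})" by (intro card_mono) (auto simp: B_def)
    also have "\<dots> \<le> deg n E u + deg n E v" using sum_deg[OF E, of "{u, v}"] uv by simp
    finally have "real (card (E \<inter> B)) \<le> real (deg n E u) + real (deg n E v)" by linarith
    then show "A0 \<subseteq> E \<and> real (card (E \<inter> B)) \<le> 110 / 100 * d" using low by linarith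
  qed
  also have "\<dots> \<le> p ^ card A0 * exp (110 / 100 * d * ln 2 - p * real (card B) / 2)"
    using A0 B by (intro bin_prob_lower_tail[OF p]) (auto simp: B_def)
  also have "\<dots> \<le> p ^ card A0 * exp (2 - 23 / 100 * d)"
  proof -
    have "d * ln 2 \<le> d * (25 / 36)" using d0 ln2_le_25_over_36 by (intro mult_left_mono) auto
    then have "110 / 100 * d * ln 2 - p * real (card B) / 2 \<le> 2 - 23 / 100 * d" using pB d0 by simp
    then show ?thesis using p by (intro mult_left_mono) auto
  qed
  finally show ?thesis .
qed

definition low_degrees_scattered :: "real \<Rightarrow> nat \<Rightarrow> nat set set \<Rightarrow> bool" where
  "low_degrees_scattered l n E \<longleftrightarrow>
     (\<forall>u<n. \<forall>v<n. u \<noteq> v \<and> real (deg n E u) \<le> l \<and> real (deg n E v) \<le> l \<longrightarrow>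
        {u, v} \<notin> E \<and> (\<forall>w. \<not> ({u, w} \<in> E \<and> {v, w} \<in> E)))"

text \<open>Adjacent pairs and pairs with a common neighbour contribute at most
  \<open>n (p n + (p n) ^ 2) exp (2 - 0.23 d)\<close>. From \<open>d \<ge> 5.5 ln n\<close> one gets
  \<open>exp (- d / 5) \<le> n powr (- 1.1)\<close>, which beats the factor \<open>n\<close>; the
  remaining \<open>exp (- 0.03 d)\<close> absorbs the polynomial in \<open>d\<close>.\<close>

lemma aas_low_degrees_scattered:
  fixes p :: "nat \<Rightarrow> real"
  assumes p: "\<And>n. 0 \<le> p n \<and> p n \<le> 1"
    and dln: "\<forall>\<^sub>F n in sequentially. 11 / 2 * ln (real n) \<le> p n * (real n - 1)"
    and dlim: "filterlim (\<lambda>n. p n * (real n - 1)) at_top sequentially"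
  shows "aas p (\<lambda>n. low_degrees_scattered (55 / 100 * (p n * (real n - 1))) n)"
proof (rule aasI[OF p])
  define d where "d = (\<lambda>n. p n * (real n - 1))"
  show "(\<lambda>n. exp (- ln (real n) / 10)) \<longlonglongrightarrow> 0" by real_asymp
  have "\<forall>\<^sub>F x in at_top. (2 * x + 4 * x ^ 2) * exp (2 - 3 / 100 * x) \<le> (1::real)" by real_asymp
  then have ev: "\<forall>\<^sub>F n in sequentially. (2 * d n + 4 * d n ^ 2) * exp (2 - 3 / 100 * d n) \<le> 1"
    unfolding d_def using dlim by (rule eventually_compose_filterlim)
  show "\<forall>\<^sub>F n in sequentially. bin_prob (all_edges n) (p n) (\<lambda>E. \<not> low_degrees_scattered (55 / 100 * (p n * (real n - 1))) n E) \<le> exp (- ln (real n) / 10)"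
    using ev dln eventually_ge_at_top[of 2]
  proof eventually_elim
    case (elim n)
    have P: "0 \<le> p n" "p n \<le> 1" using p by auto
    define low where "low A0 u v E \<longleftrightarrow> A0 \<subseteq> E \<and> real (deg n E u) \<le> 55 / 100 * d n \<and> real (deg n E v) \<le> 55 / 100 * d n"
      for A0 u v E
    define I1 where "I1 = {(u, v). u < n \<and> v < n \<and> u \<noteq> v}"
    define I2 where "I2 = {(w, u, v). w < n \<and> (u, v) \<in> I1 \<and> w \<noteq> u \<and> w \<noteq> v}"
    let ?x = "exp (2 - 23 / 100 * d n)"
    have sub: "I1 \<subseteq> {..<n} \<times> {..<n}" "I2 \<subseteq> {..<n} \<times> {..<n} \<times> {..<n}" by (auto simp: I1_def I2_def)
    have fin: "finite I1" "finite I2" by (rule finite_subset[OF sub(1)], simp) (rule finite_subset[OF sub(2)], simp)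
    have "card I1 \<le> n * n" "card I2 \<le> n * (n * n)"
      using card_mono[OF _ sub(1)] card_mono[OF _ sub(2)] by (simp_all add: card_cartesian_product)
    then have c: "real (card I1) \<le> real n ^ 2" "real (card I2) \<le> real n ^ 3"
      unfolding power2_eq_square power3_eq_cube by (metis of_nat_le_iff of_nat_mult mult.assoc)+
    have b1: "bin_prob (all_edges n) (p n) (\<lambda>E. \<exists>i\<in>I1. case i of (u, v) \<Rightarrow> low {{u, v}} u v E) \<le> real n ^ 2 * (p n * ?x)"
    proof -
      have "bin_prob (all_edges n) (p n) (\<lambda>E. \<exists>i\<in>I1. case i of (u, v) \<Rightarrow> low {{u, v}} u v E)
          \<le> (\<Sum>i\<in>I1. bin_prob (all_edges n) (p n) (\<lambda>E. case i of (u, v) \<Rightarrow> low {{u, v}} u v E))"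
        by (rule bin_prob_union_bound[OF P fin(1)])
      also have "\<dots> \<le> (\<Sum>i\<in>I1. p n * ?x)"
      proof (rule sum_mono)
        fix i assume "i \<in> I1"
        then obtain u v where i: "i = (u, v)" "u < n" "v < n" "u \<noteq> v" by (auto simp: I1_def)
        have "{{u, v}} \<subseteq> all_edges n" using i by (auto simp: all_edges_def)
        then show "bin_prob (all_edges n) (p n) (\<lambda>E. case i of (u, v) \<Rightarrow> low {{u, v}} u v E) \<le> p n * ?x"
          using bin_prob_low_pair[OF P i(2-4), of "{{u, v}}" "d n"] i by (simp add: low_def d_def)
      qed
      also have "\<dots> \<le> real n ^ 2 * (p n * ?x)" using c P by (simp add: mult_right_mono)
      finally show ?thesis .
    qed
    have b2: "bin_prob (all_edges n) (p n) (\<lambda>E. \<exists>i\<in>I2. case i of (w, u, v) \<Rightarrow> low {{u, w}, {v, w}} u v E)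
        \<le> real n ^ 3 * (p n ^ 2 * ?x)"
    proof -
      have "bin_prob (all_edges n) (p n) (\<lambda>E. \<exists>i\<in>I2. case i of (w, u, v) \<Rightarrow> low {{u, w}, {v, w}} u v E)
          \<le> (\<Sum>i\<in>I2. bin_prob (all_edges n) (p n) (\<lambda>E. case i of (w, u, v) \<Rightarrow> low {{u, w}, {v, w}} u v E))"
        by (rule bin_prob_union_bound[OF P fin(2)])
      also have "\<dots> \<le> (\<Sum>i\<in>I2. p n ^ 2 * ?x)"
      proof (rule sum_mono)
        fix i assume "i \<in> I2"
        then obtain u v w where i: "i = (w, u, v)" "u < n" "v < n" "u \<noteq> v" and w: "w < n" "w \<noteq> u" "w \<noteq> v"
          by (auto simp: I1_def I2_def)
        have "{{u, w}, {v, w}} \<subseteq> all_edges n" using i w by (auto simp: all_edges_def)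
        moreover have "card {{u, w}, {v, w}} = 2" using i w by (auto simp: card_2_iff doubleton_eq_iff)
        ultimately show "bin_prob (all_edges n) (p n) (\<lambda>E. case i of (w, u, v) \<Rightarrow> low {{u, w}, {v, w}} u v E) \<le> p n ^ 2 * ?x"
          using bin_prob_low_pair[OF P i(2-4), of "{{u, w}, {v, w}}" "d n"] i
          by (simp only: low_def d_def prod.case order_refl simp_thms)
      qed
      also have "\<dots> \<le> real n ^ 3 * (p n ^ 2 * ?x)" using c P by (simp add: mult_right_mono)
      finally show ?thesis .
    qed
    have "p n * real n \<le> p n * (2 * (real n - 1))" using P elim by (intro mult_left_mono) auto
    then have pn: "p n * real n \<le> 2 * d n" by (simp add: d_def algebra_simps)
    have pn0: "0 \<le> p n * real n" using P by simp
    have "bin_prob (all_edges n) (p n) (\<lambda>E. \<not> low_degrees_scattered (55 / 100 * (p n * (real n - 1))) n E)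
      \<le> bin_prob (all_edges n) (p n) (\<lambda>E. (\<exists>i\<in>I1. case i of (u, v) \<Rightarrow> low {{u, v}} u v E)
          \<or> (\<exists>i\<in>I2. case i of (w, u, v) \<Rightarrow> low {{u, w}, {v, w}} u v E))"
    proof (rule bin_prob_mono[OF P])
      fix E assume E: "E \<subseteq> all_edges n" and "\<not> low_degrees_scattered (55 / 100 * (p n * (real n - 1))) n E"
      then obtain u v where uv: "(u, v) \<in> I1" "real (deg n E u) \<le> 55 / 100 * d n" "real (deg n E v) \<le> 55 / 100 * d n"
        and or: "{u, v} \<in> E \<or> (\<exists>w. {u, w} \<in> E \<and> {v, w} \<in> E)"
        unfolding I1_def d_def low_degrees_scattered_def by blast
      from or show "(\<exists>i\<in>I1. case i of (u, v) \<Rightarrow> low {{u, v}} u v E)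
          \<or> (\<exists>i\<in>I2. case i of (w, u, v) \<Rightarrow> low {{u, w}, {v, w}} u v E)"
      proof
        assume "{u, v} \<in> E"
        then show ?thesis using uv by (intro disjI1 bexI[of _ "(u, v)"]) (auto simp: low_def)
      next
        assume "\<exists>w. {u, w} \<in> E \<and> {v, w} \<in> E"
        then obtain w where w: "{u, w} \<in> E" "{v, w} \<in> E" by blast
        then have "{u, w} \<in> all_edges n" "{v, w} \<in> all_edges n" using E by auto
        then have "w < n" "w \<noteq> u" "w \<noteq> v" by (auto simp: all_edges_def doubleton_eq_iff)
        then have "(w, u, v) \<in> I2" using uv by (simp add: I2_def)
        then show ?thesis using uv w by (intro disjI2 bexI[of _ "(w, u, v)"]) (auto simp: low_def)
      qed
    qed
    also have "\<dots> \<le> real n ^ 2 * (p n * ?x) + real n ^ 3 * (p n ^ 2 * ?x)"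
      by (rule order_trans[OF bin_prob_disj[OF P] add_mono[OF b1 b2]])
    also have "\<dots> = real n * ?x * (p n * real n + (p n * real n) ^ 2)"
      by (simp add: power2_eq_square power3_eq_cube algebra_simps)
    also have "\<dots> \<le> real n * ?x * (2 * d n + (2 * d n) ^ 2)"
      using pn pn0 by (intro mult_left_mono add_mono power_mono) auto
    also have "\<dots> = real n * exp (- d n / 5) * ((2 * d n + 4 * d n ^ 2) * exp (2 - 3 / 100 * d n))"
    proof -
      have "?x = exp (- d n / 5) * exp (2 - 3 / 100 * d n)" by (simp flip: exp_add)
      then show ?thesis by (simp add: power2_eq_square)
    qed
    also have "\<dots> \<le> real n * exp (- d n / 5) * 1" using elim(1) by (intro mult_left_mono) auto
    also have "\<dots> \<le> real n * exp (- 11 / 10 * ln (real n))"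
      using elim(2) by (simp add: d_def mult_left_mono)
    also have "\<dots> = exp (ln (real n) + - 11 / 10 * ln (real n))" unfolding exp_add using elim by simp
    also have "\<dots> = exp (- ln (real n) / 10)" by simp
    finally show ?case .
  qed
qed

lemma arb_beta_ge: "6 \<le> arb_beta"
proof -
  have "1 - ln 2 \<le> (1/3 :: real)" "0 < 1 - ln (2::real)" using ln2_ge_two_thirds ln2_le_25_over_36 by linarith+
  then show ?thesis by (simp add: arb_beta_def ln_div field_simps)
qed

text \<open>Up to \<open>20 ln n\<close> the mean degree is small enough for
  \<open>bin_prob_half_mean\<close>: the term with \<open>n powr (- 1/4)\<close> is at most 1 and
  \<open>p D \<le> 2\<close>. Beyond that the exponential moment bound gives
  \<open>exp (1 - 2 ln n)\<close> per vertex. The terms added to half the mean leave room for the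
  fluctuation of the number of edges.\<close>

lemma aas_min_degree:
  fixes p w :: "nat \<Rightarrow> real"
  assumes p: "\<And>n. 0 \<le> p n \<and> p n \<le> 1" and w: "filterlim w at_top sequentially"
    and d: "\<And>n. p n * (real n - 1) = arb_beta * (ln (real n) - ln (ln (real n)) / 2) + w n"
    and dln: "\<forall>\<^sub>F n in sequentially. 11 / 2 * ln (real n) \<le> p n * (real n - 1)"
  shows "aas p (\<lambda>n E. \<forall>v<n. p n * (real n - 1) / 2 + 1 + p n * (real n - 1) * real n powr (- 1/4) \<le> real (deg n E v))"
proof (rule aasI[OF p])
  let ?r = "\<lambda>n. 8 * exp 7 * exp (- w n / arb_beta) + exp (1 - ln (real n))"
  have \<beta>: "arb_beta > 0" using arb_beta_ge by linarith
  have "((\<lambda>x. exp (- x)) \<longlongrightarrow> (0::real)) at_top" by real_asymp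
  moreover have "filterlim (\<lambda>n. w n / arb_beta) at_top sequentially"
    using filterlim_tendsto_pos_mult_at_top[OF tendsto_const[of "1 / arb_beta"] _ w] \<beta> by simp
  ultimately have "(\<lambda>n. exp (- (w n / arb_beta))) \<longlonglongrightarrow> 0" by (rule filterlim_compose)
  then have "(\<lambda>n. 8 * exp 7 * exp (- w n / arb_beta)) \<longlonglongrightarrow> 0"
    by (intro tendsto_mult_right_zero) simp
  moreover have "(\<lambda>n. exp (1 - ln (real n))) \<longlonglongrightarrow> 0" by real_asymp
  ultimately show "?r \<longlonglongrightarrow> 0" using tendsto_add by fastforce
  have e1: "\<forall>\<^sub>F n in sequentially. real n powr (- 1/4) * (20 * ln (real n)) \<le> 1" by real_asymp
  have e2: "\<forall>\<^sub>F n in sequentially. (20 * ln (real n)) ^ 2 \<le> 2 * (real n - 1)" by real_asymp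
  have e3: "\<forall>\<^sub>F n in sequentially. real n powr (- 1/4) \<le> 1 / 20" by real_asymp
  show "\<forall>\<^sub>F n in sequentially. bin_prob (all_edges n) (p n) (\<lambda>E. \<not> (\<forall>v<n.
      p n * (real n - 1) / 2 + 1 + p n * (real n - 1) * real n powr (- 1/4) \<le> real (deg n E v))) \<le> ?r n"
    using e1 e2 e3 dln eventually_ge_at_top[of 3]
  proof eventually_elim
    case (elim n)
    have P: "0 \<le> p n" "p n \<le> 1" using p by auto
    define D where "D = p n * (real n - 1)"
    define h where "h = D / 2 + 1 + D * real n powr (- 1/4)"
    have D0: "0 \<le> D" using P elim by (simp add: D_def)
    have ln1: "1 \<le> ln (real n)"
      using exp_le elim(5) by (simp add: ln_ge_iff)
    have D: "D = arb_beta * (ln (real n) - ln (ln (real n)) / 2) + w n" unfolding D_def by (rule d)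
    have one: "bin_prob (all_edges n) (p n) (\<lambda>E. real (deg n E v) \<le> h) \<le> ?r n / real n" if v: "v < n" for v
    proof -
      let ?B = "touching n {v}"
      have cB: "real (card ?B) = real n - 1" using v by (subst real_card_touching) auto
      have B: "?B \<subseteq> all_edges n" by (auto simp: touching_def)
      show ?thesis
      proof (cases "D \<le> 20 * ln (real n)")
        case True
        have "D * real n powr (- 1/4) \<le> 20 * ln (real n) * real n powr (- 1/4)"
          using True by (intro mult_right_mono) auto
        also have "\<dots> \<le> 1" using elim(1) by (simp add: mult.commute)
        finally have h: "h \<le> D / 2 + 2" by (simp add: h_def)
        have D2: "2 \<le> D" using elim(4) ln1 unfolding D_def by linarith
        have "D * D \<le> (20 * ln (real n)) * (20 * ln (real n))" using True D0 ln1 by (intro mult_mono) auto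
        also have "\<dots> \<le> 2 * (real n - 1)" using elim(2) by (simp add: power2_eq_square)
        finally have "(p n * D) * (real n - 1) \<le> 2 * (real n - 1)" by (simp add: D_def mult_ac)
        then have pD: "p n * D \<le> 2" by (rule mult_right_le_imp_le) (use elim in simp)
        have "bin_prob (all_edges n) (p n) (\<lambda>E. real (deg n E v) \<le> h)
            \<le> bin_prob (all_edges n) (p n) (\<lambda>E. real (deg n E v) \<le> D / 2 + 2)"
          using h by (intro bin_prob_mono[OF P]) auto
        also have "\<dots> \<le> 8 * exp 7 * exp (- D / arb_beta) / sqrt (D / 2)"
          using D2 pD by (intro bin_prob_half_mean[OF P _ B]) (simp_all add: cB D_def)
        also have "\<dots> \<le> 8 * exp 7 * exp (- D / arb_beta) / sqrt (ln (real n))"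
          using elim(4) ln1 unfolding D_def[symmetric] by (intro divide_left_mono) auto
        also have "\<dots> = 8 * exp 7 * exp (- w n / arb_beta) / real n"
        proof -
          have pos: "0 < ln (real n)" using ln1 by linarith
          have ls: "ln (sqrt (ln (real n))) = ln (ln (real n)) / 2" using pos by (simp add: ln_sqrt)
          have r: "exp (ln (ln (real n)) / 2) = sqrt (ln (real n))"
            unfolding ls[symmetric] using pos by (intro exp_ln) simp
          have "- D / arb_beta = - w n / arb_beta - ln (real n) + ln (ln (real n)) / 2"
            unfolding D using \<beta> by (simp add: field_simps)
          \<comment> \<open>The \<open>ln (ln n)\<close> term of the threshold yields
            \<open>sqrt (ln n)\<close>, which the denominator cancels; what remains per vertex is
            \<open>1 / n\<close> times a null sequence.\<close>
          then have "exp (- D / arb_beta) = exp (- w n / arb_beta) / real n * sqrt (ln (real n))"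
            using elim by (simp only: exp_add exp_diff r exp_ln of_nat_0_less_iff)
          then show ?thesis using pos by simp
        qed
        also have "\<dots> \<le> ?r n / real n" by (intro divide_right_mono) auto
        finally show ?thesis .
      next
        case False
        have "D * real n powr (- 1/4) \<le> D * (1 / 20)" using D0 elim(3) by (intro mult_left_mono) auto
        then have h: "h \<le> 11 / 20 * D + 1" by (simp add: h_def)
        have h0: "0 \<le> h" using D0 by (simp add: h_def)
        have "h * ln 2 \<le> h * (25 / 36)" using h0 ln2_le_25_over_36 by (intro mult_left_mono) auto
        then have x: "h * ln 2 - D / 2 \<le> 1 - 2 * ln (real n)" using h False ln1 by linarith
        have "bin_prob (all_edges n) (p n) (\<lambda>E. real (deg n E v) \<le> h) \<le> exp (h * ln 2 - D / 2)"
          using bin_prob_lower_tail[OF P finite_all_edges, of "{}" n ?B h] B by (simp add: cB D_def)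
        also have "\<dots> \<le> exp (1 - 2 * ln (real n))" using x by simp
        also have "\<dots> = exp (1 - ln (real n)) / exp (ln (real n))" by (simp flip: exp_diff)
        also have "\<dots> = exp (1 - ln (real n)) / real n" using elim by simp
        also have "\<dots> \<le> ?r n / real n" by (intro divide_right_mono) auto
        finally show ?thesis .
      qed
    qed
    have "bin_prob (all_edges n) (p n) (\<lambda>E. \<not> (\<forall>v<n. h \<le> real (deg n E v)))
        \<le> bin_prob (all_edges n) (p n) (\<lambda>E. \<exists>v\<in>{..<n}. real (deg n E v) \<le> h)"
      by (intro bin_prob_mono[OF P]) force
    also have "\<dots> \<le> (\<Sum>v<n. bin_prob (all_edges n) (p n) (\<lambda>E. real (deg n E v) \<le> h))"
      by (intro bin_prob_union_bound[OF P]) auto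
    also have "\<dots> \<le> (\<Sum>v<n. ?r n / real n)" using one by (intro sum_mono) auto
    also have "\<dots> = ?r n" using elim by simp
    finally show ?case unfolding h_def D_def .
  qed
qed

text \<open>The mean of \<open>card E / (n - 1)\<close> is \<open>D / 2 + p / 2\<close>, so half of
  the added 1 covers the excess of the mean. The other half and \<open>D n powr (- 1/4)\<close>
  serve as the deviation in Chebyshev's inequality.\<close>

lemma aas_card_le:
  fixes p :: "nat \<Rightarrow> real"
  assumes p: "\<And>n. 0 \<le> p n \<and> p n \<le> 1"
    and dlim: "filterlim (\<lambda>n. p n * (real n - 1)) at_top sequentially"
  shows "aas p (\<lambda>n E. real (card E) / (real n - 1)
      \<le> p n * (real n - 1) / 2 + 1 + p n * (real n - 1) * real n powr (- 1/4))"
proof (rule aasI[OF p])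
  let ?r = "\<lambda>n. real n * real n powr (1/4) / (real n - 1) ^ 2"
  show "?r \<longlonglongrightarrow> 0" by real_asymp
  have "\<forall>\<^sub>F n in sequentially. 0 < p n * (real n - 1)" using dlim by (simp add: filterlim_at_top_dense)
  then show "\<forall>\<^sub>F n in sequentially. bin_prob (all_edges n) (p n) (\<lambda>E. \<not> real (card E) / (real n - 1)
      \<le> p n * (real n - 1) / 2 + 1 + p n * (real n - 1) * real n powr (- 1/4)) \<le> ?r n"
    using eventually_ge_at_top[of 2]
  proof eventually_elim
    case (elim n)
    have P: "0 \<le> p n" "p n \<le> 1" using p by auto
    define D where "D = p n * (real n - 1)"
    define u where "u = D * real n powr (- 1/4)"
    define t where "t = (real n - 1) * (1 / 2 + u)"
    have n1: "0 < real n - 1" using elim by simp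
    have u: "0 < u" using elim by (simp add: u_def D_def)
    have t: "0 < t" unfolding t_def using n1 u by (intro mult_pos_pos) auto
    have Dn: "D \<le> real n - 1" unfolding D_def using P n1 by (simp add: mult_left_le_one_le)
    define V where "V = u * (real n - 1)"
    define M where "M = D / 2 * (real n - 1)"
    have mean: "p n * (real n * (real n - 1) / 2) = M + D / 2"
      by (simp add: M_def D_def field_simps)
    have "bin_prob (all_edges n) (p n) (\<lambda>E. \<not> real (card E) / (real n - 1) \<le> D / 2 + 1 + u)
        \<le> bin_prob (all_edges n) (p n) (\<lambda>E. t \<le> \<bar>real (card E) - p n * (real n * (real n - 1) / 2)\<bar>)"
    proof (rule bin_prob_mono[OF P])
      fix E assume "\<not> real (card E) / (real n - 1) \<le> D / 2 + 1 + u"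
      then have "(D / 2 + 1 + u) * (real n - 1) < real (card E)" using n1 by (simp add: field_simps)
      then have "M + (real n - 1) + V < real (card E)" by (simp add: M_def V_def distrib_right)
      moreover have "t = (real n - 1) / 2 + V" by (simp add: t_def V_def distrib_left mult.commute)
      moreover have "D / 2 \<le> (real n - 1) / 2" "real n - 1 = (real n - 1) / 2 + (real n - 1) / 2" using Dn by simp_all
      ultimately have "t \<le> real (card E) - (M + D / 2)" by linarith
      then show "t \<le> \<bar>real (card E) - p n * (real n * (real n - 1) / 2)\<bar>"
        unfolding mean by linarith
    qed
    also have "\<dots> \<le> p n * (real n * (real n - 1) / 2) / t\<^sup>2"
      by (rule bin_prob_card_deviation[OF P t])
    also have "\<dots> \<le> p n * (real n * (real n - 1) / 2) / ((real n - 1) ^ 2 * u)"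
    proof (rule divide_left_mono)
      \<comment> \<open>Bounding the squared deviation below by a multiple of \<open>u\<close> makes
        \<open>D\<close> cancel, so the error bound depends on \<open>n\<close> alone.\<close>
      have "u \<le> (1 / 2 + u) ^ 2" using u by (simp add: power2_eq_square algebra_simps)
      then show "(real n - 1) ^ 2 * u \<le> t\<^sup>2" unfolding t_def power_mult_distrib by (intro mult_left_mono) auto
    qed (use P n1 u t in auto)
    also have "\<dots> = real n * real n powr (1/4) / (real n - 1) ^ 2 / 2"
    proof -
      have eq: "p n * (real n * (real n - 1) / 2) = D * (real n / 2)" "u = D / real n powr (1/4)"
        by (simp_all add: D_def u_def powr_minus_divide)
      have "0 < D" "0 < real n powr (1/4)" using elim by (auto simp: D_def)
      then show ?thesis unfolding eq using n1 by simp
    qed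
    also have "\<dots> \<le> ?r n"
    proof -
      have half: "x / 2 \<le> x" if "0 \<le> x" for x :: real using that by simp
      show ?thesis by (rule half) simp
    qed
    finally show ?case unfolding D_def u_def .
  qed
qed

lemma aas_arboricity_eq:
  fixes p w :: "nat \<Rightarrow> real"
  assumes p: "\<And>n. 0 \<le> p n \<and> p n \<le> 1" and w: "filterlim w at_top sequentially"
    and d: "\<And>n. p n * (real n - 1) = arb_beta * (ln (real n) - ln (ln (real n)) / 2) + w n"
  shows "aas p (\<lambda>n E. int (arboricity E) = \<lceil>real (card E) / (real n - 1)\<rceil>)"
proof -
  \<comment> \<open>As \<open>arb_beta \<ge> 6\<close>, lowering 6 to \<open>11/2\<close> makes room
    for the correction by \<open>ln (ln n)\<close>.\<close>
  have dln: "\<forall>\<^sub>F n in sequentially. 11 / 2 * ln (real n) \<le> p n * (real n - 1)"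
  proof -
    have "\<forall>\<^sub>F n in sequentially. 0 \<le> w n" using w by (simp add: filterlim_at_top)
    moreover have "\<forall>\<^sub>F n in sequentially. 11 / 2 * ln (real n) \<le> 6 * (ln (real n) - ln (ln (real n)) / 2)"
      by real_asymp
    moreover have "\<forall>\<^sub>F n in sequentially. 0 \<le> ln (real n) - ln (ln (real n)) / 2" by real_asymp
    ultimately show ?thesis
    proof eventually_elim
      case (elim n)
      have "6 * (ln (real n) - ln (ln (real n)) / 2) \<le> arb_beta * (ln (real n) - ln (ln (real n)) / 2)"
        using arb_beta_ge elim by (intro mult_right_mono) auto
      then show ?case unfolding d using elim by linarith
    qed
  qed
  have dlim: "filterlim (\<lambda>n. p n * (real n - 1)) at_top sequentially"
  proof (rule filterlim_at_top_mono[OF _ dln])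
    show "filterlim (\<lambda>n. 11 / 2 * ln (real n)) at_top sequentially" by real_asymp
  qed
  have pn: "filterlim (\<lambda>n. p n * real n) at_top sequentially"
    by (rule filterlim_at_top_mono[OF dlim]) (use p in \<open>auto intro!: always_eventually mult_left_mono\<close>)
  \<comment> \<open>\<open>57600 = 240 ^ 2\<close>, and \<open>1 / 240 = 1/2 * 1/80 * 2/3\<close> is
    the bound required of \<open>sqrt x\<close> below.\<close>
  define \<sigma> where "\<sigma> = (1 / 57600 :: real)"
  have "sqrt x - x \<le> (1 - 1 / 2) * (1 / 80) * ln (1 / x)" if x: "0 < x" "x \<le> \<sigma>" for x :: real
  proof -
    have "sqrt x \<le> sqrt ((1 / 240)\<^sup>2)" using x unfolding real_sqrt_le_iff by (simp add: \<sigma>_def power2_eq_square)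
    then have "sqrt x - x \<le> (1 - 1 / 2) * (1 / 80) * (2 / 3)" using x by simp
    also have "\<dots> \<le> (1 - 1 / 2) * (1 / 80) * ln (1 / x)"
    proof (rule mult_left_mono)
      have "ln 2 \<le> ln (1 / x)" using x by (simp add: \<sigma>_def field_simps)
      then show "2 / 3 \<le> ln (1 / x)" using ln2_ge_two_thirds by linarith
    qed simp
    finally show ?thesis .
  qed
  then have sparse: "aas p (\<lambda>n E. \<forall>S\<subseteq>{..<n}. card S \<ge> 2 \<and> real (card S) \<le> \<sigma> * real n \<longrightarrow>
      real (card (E \<inter> edges_on S)) < 1 / 80 * (p n * real n) * (real (card S) - 1))"
    by (intro aas_no_dense_set[OF p pn, where \<tau> = "1/2"]) (auto simp: \<sigma>_def)
  let ?h = "\<lambda>n. p n * (real n - 1) / 2 + 1 + p n * (real n - 1) * real n powr (- 1/4)"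
  have good: "aas p (\<lambda>n E. ((density_regular (p n * (real n - 1)) n E \<and>
      (\<forall>S\<subseteq>{..<n}. card S \<ge> 2 \<and> real (card S) \<le> \<sigma> * real n \<longrightarrow>
        real (card (E \<inter> edges_on S)) < 1 / 80 * (p n * real n) * (real (card S) - 1))) \<and>
      low_degrees_scattered (55 / 100 * (p n * (real n - 1))) n E) \<and>
      (\<forall>v<n. ?h n \<le> real (deg n E v)) \<and> real (card E) / (real n - 1) \<le> ?h n)"
    by (intro aas_conj[OF p] aas_density_regular[OF p pn] sparse aas_low_degrees_scattered[OF p dln dlim]
        aas_min_degree[OF p w d dln] aas_card_le[OF p dlim])
  show ?thesis
  proof (rule aas_mono[OF p good])
    have "\<forall>\<^sub>F x in at_top. exp (1 - x / 100) \<le> \<sigma> \<and> (80::real) \<le> x"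
      unfolding \<sigma>_def by (intro eventually_conj; real_asymp)
    then have ev1: "\<forall>\<^sub>F n in sequentially. exp (1 - p n * (real n - 1) / 100) \<le> \<sigma> \<and> 80 \<le> p n * (real n - 1)"
      using dlim by (rule eventually_compose_filterlim)
    have ev2: "\<forall>\<^sub>F n in sequentially. real n powr (- 1/4) \<le> 1 / 80" by real_asymp
    show "\<forall>\<^sub>F n in sequentially. \<forall>E\<subseteq>all_edges n. ((density_regular (p n * (real n - 1)) n E \<and>
      (\<forall>S\<subseteq>{..<n}. card S \<ge> 2 \<and> real (card S) \<le> \<sigma> * real n \<longrightarrow>
        real (card (E \<inter> edges_on S)) < 1 / 80 * (p n * real n) * (real (card S) - 1))) \<and>
      low_degrees_scattered (55 / 100 * (p n * (real n - 1))) n E) \<and>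
      (\<forall>v<n. ?h n \<le> real (deg n E v)) \<and> real (card E) / (real n - 1) \<le> ?h n \<longrightarrow>
      int (arboricity E) = \<lceil>real (card E) / (real n - 1)\<rceil>"
      using ev1 ev2 eventually_ge_at_top[of 2]
    proof eventually_elim
      case (elim n)
      define D where "D = p n * (real n - 1)"
      define h where "h = D / 2 + 1 + D * real n powr (- 1/4)"
      have D: "80 \<le> D" "exp (1 - D / 100) \<le> \<sigma>" using elim by (auto simp: D_def)
      have n0: "0 < n" using elim by simp
      show ?case
        unfolding density_regular_def low_degrees_scattered_def D_def[symmetric] h_def[symmetric]
      proof (intro allI impI, elim conjE)
        fix E assume E: "E \<subseteq> all_edges n"
          and small: "\<forall>S\<subseteq>{..<n}. 2 \<le> card S \<and> 2 * card S \<le> n \<longrightarrow>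
            real (card (E \<inter> edges_on S)) \<le> real (card E) / (real n - 1) * (real (card S) - 1)"
          and x: "real (card E) / (real n - 1) \<le> 51 / 100 * D"
          and touch: "\<forall>T\<subseteq>{..<n}. T \<noteq> {} \<and> 2 * card T \<le> n \<and> 1 + ln (real n / real (card T)) \<le> D / 100 \<longrightarrow>
            51 / 100 * D * real (card T) < real (card (E \<inter> touching n T))"
          and sparse: "\<forall>S\<subseteq>{..<n}. card S \<ge> 2 \<and> real (card S) \<le> \<sigma> * real n \<longrightarrow>
            real (card (E \<inter> edges_on S)) < 1 / 80 * (p n * real n) * (real (card S) - 1)"
          and low: "\<forall>u<n. \<forall>v<n. u \<noteq> v \<and> real (deg n E u) \<le> 55 / 100 * D \<and> real (deg n E v) \<le> 55 / 100 * D \<longrightarrow>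
            {u, v} \<notin> E \<and> (\<forall>w. \<not> ({u, w} \<in> E \<and> {v, w} \<in> E))"
          and mindeg: "\<forall>v<n. h \<le> real (deg n E v)" and m: "real (card E) / (real n - 1) \<le> h"
        define L where "L = {v. v < n \<and> real (deg n E v) \<le> 55 / 100 * D}"
        have "int (arboricity E) \<le> \<lceil>real (card E) / (real n - 1) + 0\<rceil>"
        proof (rule arboricity_le_ceiling_density[OF E])
          fix T assume T: "T \<subseteq> {..<n}" "T \<noteq> {}" "2 * card T \<le> n"
          have fin: "finite T" using T finite_subset by blast
          have t: "0 < card T" using T fin by (simp add: card_gt_0_iff)
          have "real (card E) / (real n - 1) * real (card T) \<le> real (card (E \<inter> touching n T))"
          proof (cases "1 + ln (real n / real (card T)) \<le> D / 100")
            case True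
            have "real (card E) / (real n - 1) * real (card T) \<le> 51 / 100 * D * real (card T)"
              using x by (rule mult_right_mono) simp
            also have "\<dots> \<le> real (card (E \<inter> touching n T))" using touch T True by (intro less_imp_le) blast
            finally show ?thesis .
          next
            case False
            have "real (card T) \<le> exp (1 - D / 100) * real n" by (rule small_of_ln_ratio[OF t n0 False])
            also have "\<dots> \<le> \<sigma> * real n" using D by (intro mult_right_mono) auto
            finally have t\<sigma>: "real (card T) \<le> \<sigma> * real n" .
            have "h * real (card T) \<le> real (card (E \<inter> touching n T))"
            \<comment> \<open>Once \<open>n powr (- 1/4) \<le> 1 / 80\<close>, \<open>h\<close> is
              at most \<open>D / 2 + 1 + D / 80\<close>. The gap condition then asks for
              \<open>D / 40 + 2 \<le> D / 20\<close>, which is \<open>D \<ge> 80\<close>.\<close>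
            proof (rule touching_ge_of_degrees[OF E T(1), where L = L and l = "55 / 100 * D" and \<kappa> = "D / 80"])
              show "h \<le> real (deg n E v)" if "v \<in> T" for v using mindeg that T by auto
              show "55 / 100 * D \<le> real (deg n E v)" if "v \<in> T - L" for v using that T by (auto simp: L_def)
              show "u = v" if "u \<in> L" "v \<in> L" "{u, v} \<in> E" for u v
                using low that unfolding L_def by blast
              show "u = v" if "u \<in> L" "v \<in> L" "{u, w} \<in> E" "{v, w} \<in> E" for u v w
                using low that unfolding L_def by blast
              show "real (card (E \<inter> edges_on (T - L))) \<le> D / 80 * real (card (T - L))"
              proof (cases "2 \<le> card (T - L)")
                case True
                have le: "card (T - L) \<le> card T" using fin by (intro card_mono) auto
                then have "real (card (T - L)) \<le> \<sigma> * real n" using t\<sigma> by linarith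
                then have "real (card (E \<inter> edges_on (T - L))) \<le> 1 / 80 * (p n * real n) * (real (card (T - L)) - 1)"
                  using sparse T True by (intro less_imp_le) blast
                also have "\<dots> = 1 / 80 * p n * (real n * (real (card (T - L)) - 1))" by simp
                also have "\<dots> \<le> 1 / 80 * p n * ((real n - 1) * real (card (T - L)))"
                \<comment> \<open>With \<open>s = card (T - L) \<le> n\<close> one has
                  \<open>n (s - 1) \<le> (n - 1) s\<close>, which turns the bound in terms of
                  \<open>p n\<close> into one in terms of \<open>D\<close>.\<close>
                proof (rule mult_left_mono)
                  have "real (card (T - L)) \<le> real n" using le T(3) by linarith
                  then show "real n * (real (card (T - L)) - 1) \<le> (real n - 1) * real (card (T - L))"
                    by (simp add: algebra_simps)
                qed (use p in simp)
                also have "\<dots> = D / 80 * real (card (T - L))" by (simp add: D_def)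
                finally show ?thesis .
              next
                case False
                then show ?thesis using fin D edges_on_small[of "T - L"] by simp
              qed
              have "D * real n powr (- 1/4) \<le> D * (1 / 80)" using elim D by (intro mult_left_mono) auto
              then show "h + D / 80 + 1 \<le> 55 / 100 * D" using D h_def by linarith
            qed
            moreover have "real (card E) / (real n - 1) * real (card T) \<le> h * real (card T)"
              using m by (rule mult_right_mono) simp
            ultimately show ?thesis by linarith
          qed
          then show "real (card E) / (real n - 1) * real (card T)
              \<le> real (card (E \<inter> touching n T)) + 0 * (real n - real (card T) - 1)" by simp
        qed (use elim small in auto)
        then show "int (arboricity E) = \<lceil>real (card E) / (real n - 1)\<rceil>"
          using ceiling_density_le_arboricity[OF E] elim by force
      qed
    qed
  qed
qed

theorem theorem2p4:
  fixes p :: "nat \<Rightarrow> real"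
  assumes p_range: "\<And>n. 0 \<le> p n \<and> p n \<le> 1"
  shows
   "(\<forall>w :: nat \<Rightarrow> real.
       filterlim w at_top sequentially \<and>
       (\<forall>n. p n * (real n - 1) = arb_beta * (ln (real n) - ln (ln (real n)) / 2) + w n)
       \<longrightarrow> aas p (\<lambda>n E. int (arboricity E) = \<lceil>real (card E) / (real n - 1)\<rceil>))
    \<and> (filterlim (\<lambda>n. p n * real n) at_top sequentially
       \<longrightarrow> aas p (\<lambda>n E. int (arboricity E) \<in>
              {\<lceil>real (card E) / (real n - 1)\<rceil>, \<lceil>real (card E) / (real n - 1)\<rceil> + 1}))
    \<and> ((\<exists>a b::real. 0 < a \<and> a \<le> b \<and>
          (\<forall>\<^sub>F n in sequentially. a / real n \<le> p n \<and> p n \<le> b / real n))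
       \<longrightarrow> (\<exists>c1 c2::real. 0 < c1 \<and> c1 \<le> c2 \<and>
              aas p (\<lambda>n E. (1 + c1) * p n * real n / 2 \<le> real (arboricity E) \<and>
                           real (arboricity E) \<le> (1 + c2) * p n * real n / 2))
         \<and> (\<exists>k :: nat \<Rightarrow> nat. (\<forall>n. 0 < k n) \<and>
              aas p (\<lambda>n E. arboricity E \<in> {k n, k n + 1})))
    \<and> ((\<lambda>n. p n * real n) \<longlonglongrightarrow> 0
       \<longrightarrow> aas p (\<lambda>n E. arboricity E \<le> 1))"
proof (intro conjI allI impI)
  show "aas p (\<lambda>n E. int (arboricity E) = \<lceil>real (card E) / (real n - 1)\<rceil>)"
    if "filterlim w at_top sequentially \<and>
       (\<forall>n. p n * (real n - 1) = arb_beta * (ln (real n) - ln (ln (real n)) / 2) + w n)" for w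
    using that by (intro aas_arboricity_eq[OF p_range, of w]) auto
qed (use aas_arboricity_dense[where p = p, OF p_range] aas_arboricity_Theta[where p = p, OF p_range]
      aas_arboricity_two_point[where p = p, OF p_range] aas_arboricity_le_1[where p = p, OF p_range] in blast)+

end
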